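(* There exist absolute constants $K>0$ and $n_0$ such that for every integer $n\ge n_0$, writing $N=2^n=|\mathbb F_2^n|$, $$ r_{\angle}(\mathbb F_2^n)\;\le\; K\,N^2\,\frac{\log\log\log N}{\log\log N}. $$
   Context: For a finite abelian group $G$ (written additively), a corner in $G\times G$ is a triple of points $\{(x,y),(x+d,y),(x,y+d)\}$ with $x,y,d\in G$ and $d\neq 0$. The quantity $r_{\angle}(G)$ is the cardinality of the largest subset of $G\times G$ containing no corner. $\mathbb F_2^n$ is regarded as the additive group of $n$-dimensional vectors over the field with two elements. *)

theory Defs
  imports Complex_Main "HOL-Algebra.Product_Groups" "HOL-Number_Theory.Residues"
begin

text \<open>Abelian groups are HOL-Algebra groups, whose notation is multiplicative: the sum
  \<open>x + d\<close> is written \<open>x \<otimes> d\<close> and the neutral element \<open>0\<close> is written \<open>\<one>\<close>.\<close>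

definition is_corner :: "('a, 'b) monoid_scheme \<Rightarrow> ('a \<times> 'a) set \<Rightarrow> bool" where
  "is_corner G T \<longleftrightarrow>
     (\<exists>x\<in>carrier G. \<exists>y\<in>carrier G. \<exists>d\<in>carrier G. d \<noteq> \<one>\<^bsub>G\<^esub> \<and>
        T = {(x, y), (x \<otimes>\<^bsub>G\<^esub> d, y), (x, y \<otimes>\<^bsub>G\<^esub> d)})"

definition corner_free :: "('a, 'b) monoid_scheme \<Rightarrow> ('a \<times> 'a) set \<Rightarrow> bool" where
  "corner_free G A \<longleftrightarrow> (\<nexists>T. is_corner G T \<and> T \<subseteq> A)"

text \<open>Meaningful for finite \<open>carrier G\<close>, where the maximum is over a finite nonempty set
  (the empty set is corner-free).\<close>

definition r_corner :: "('a, 'b) monoid_scheme \<Rightarrow> nat" where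
  "r_corner G = Max {card A | A. A \<subseteq> carrier G \<times> carrier G \<and> corner_free G A}"

text \<open>Vectors are functions on \<open>{..<n}\<close> (extensional, i.e. \<open>undefined\<close> elsewhere) with values in
  \<open>residue_ring 2\<close>, added coordinatewise.\<close>

definition F2_vec :: "nat \<Rightarrow> (nat \<Rightarrow> int) monoid" where
  "F2_vec n = product_group {..<n} (\<lambda>_. add_monoid (residue_ring 2))"

lemma field_residue_ring_2: "field (residue_ring 2)"
  using residues_prime.is_field[of 2] by (simp add: residues_prime_def)

lemma comm_group_F2_vec: "comm_group (F2_vec n)"
proof -
  interpret R: field "residue_ring 2"
    by (rule field_residue_ring_2)
  show ?thesis
  proof (rule group.group_comm_groupI)
    show "group (F2_vec n)"
      unfolding F2_vec_def by (rule product_group) (rule R.a_group)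
    show "\<And>u v. u \<in> carrier (F2_vec n) \<Longrightarrow> v \<in> carrier (F2_vec n)
        \<Longrightarrow> u \<otimes>\<^bsub>F2_vec n\<^esub> v = v \<otimes>\<^bsub>F2_vec n\<^esub> u"
      by (simp add: F2_vec_def residue_ring_def add.commute)
  qed
qed

lemma finite_carrier_F2_vec: "finite (carrier (F2_vec n))"
  by (simp add: F2_vec_def residue_ring_def finite_PiE)

lemma order_F2_vec: "order (F2_vec n) = 2 ^ n"
  by (simp add: order_def F2_vec_def residue_ring_def card_PiE)

end

theory Submission
  imports Defs "HOL-Library.Z2" "HOL-Library.Function_Algebras" "HOL-Real_Asymp.Real_Asymp"
begin

text \<open>Let \<open>A\<close> be a corner-free set of relative density \<open>\<alpha>\<close> among the pairs \<open>(x, y) \<in> X \<times> Y\<close> with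
  \<open>x + y \<in> Z\<close>, where \<open>X\<close>, \<open>Y\<close>, \<open>Z\<close> are Fourier-uniform subsets of an elementary abelian 2-group.
  Writing \<open>z = x + y\<close>, \<open>A\<close> becomes three bipartite graphs on \<open>X\<close>, \<open>Y\<close>, \<open>Z\<close> whose triangles are the
  corners, so the triangle count is far too small. As in the work of Kelley, Lovett and Meka,
  Hoelder's inequality then forces a high moment of the codegrees of the graph on \<open>X \<times> Y\<close> or of the
  one on \<open>X \<times> Z\<close> to deviate from its expected value. The centred codegree kernel is positive
  semidefinite, hence the deviation is upwards, and sifting produces a rectangle of relative size
  \<open>\<alpha>\<close> to a power polynomial in \<open>log (1 / \<alpha>)\<close> on which the density is larger by a constant factor.

  As in Shkredov's argument one restores uniformity by passing to a subgroup, whose codimension is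
  polynomial in the inverse of the uniformity parameter. Only \<open>O(log (1 / \<alpha>))\<close> steps are possible, and
  the same uniformity parameter serves in all of them, so the dimension \<open>n\<close> is at most
  \<open>exp (C (log (1 / \<alpha>))\<^sup>4)\<close>. This is stronger than what is needed: it suffices to use it with
  \<open>\<alpha> = 1 / ln n\<close>.\<close>

section \<open>Characters of elementary abelian 2-groups\<close>

text \<open>High moments appear because passing between a graph and its ambient graph costs a factor
  \<open>\<alpha>\<close>, and a moment of order log (1 / \<open>\<alpha>\<close>) turns that into a
  bounded factor in the base. Corner-freeness makes the centred codegree nearly -1 on edges, not
  merely biased. After decoupling, a Gram kernel \<open>h\<close> has a \<open>k\<close>-th moment
  that is not small; all its power sums are nonnegative, so the middle binomial term alone makes (1
  + \<open>h\<close>)^(2 \<open>k\<close>) about 4^\<open>k\<close> on average. Codegrees are thus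
  nearly twice their expected value in a high norm, which leaves room for all constants: 1.62 > 1.5
  > 1.4 for codegrees, then 1.4 / 1.01 > 1.3 > 1.2 > 1.01 for densities. The obstacle is sparsity:
  the sides become thinner at every step, but the gain and the size of the new rectangle relative to
  the old one may depend on \<open>\<alpha>\<close> only. So trivial bounds in 1 /
  \<open>\<sigma>\<close> are used only where uniformity supplies a factor \<open>\<eta>\<close>,
  and \<open>\<eta>\<close> is fixed after \<open>\<sigma>\<close>, a lower bound for the densities
  at every step.\<close>

class elementary_2_group = ab_group_add +
  assumes add_self [simp]: "x + x = 0"
begin

lemma add_self_left [simp]: "x + (x + y) = y"
  by (metis add_self add.assoc add_0_left)

lemma add_self_right [simp]: "y + x + x = y"
  by (simp add: add.assoc)

end

text \<open>Elements are their own inverses, so closure under negation is automatic. Subgroups are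
  sets inside one fixed type, so that the iteration can pass to smaller groups without changing
  types.\<close>

definition subgrp :: "'a::elementary_2_group set \<Rightarrow> bool" where
  "subgrp W \<longleftrightarrow> finite W \<and> 0 \<in> W \<and> (\<forall>x\<in>W. \<forall>y\<in>W. x + y \<in> W)"

lemma subgrpD:
  assumes "subgrp W"
  shows "finite W" "0 \<in> W" "\<And>x y. x \<in> W \<Longrightarrow> y \<in> W \<Longrightarrow> x + y \<in> W" "card W > 0"
  using assms by (auto simp: subgrp_def card_gt_0_iff)

lemma sum_translate:
  fixes f :: "'a::elementary_2_group \<Rightarrow> 'b::comm_monoid_add"
  assumes "subgrp W" "g \<in> W"
  shows "(\<Sum>x\<in>W. f (x + g)) = (\<Sum>x\<in>W. f x)"
  by (rule sum.reindex_bij_witness[of _ "\<lambda>x. x + g" "\<lambda>x. x + g"])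
     (use assms in \<open>auto intro: subgrpD\<close>)

text \<open>Elements have order at most 2, so real values suffice. The value 0 outside
  \<open>W\<close> makes each character a unique function; hence \<open>chars W\<close> is finite
  and can be summed over.\<close>

definition chars :: "'a::elementary_2_group set \<Rightarrow> ('a \<Rightarrow> real) set" where
  "chars W = {\<chi>. (\<forall>x\<in>W. \<chi> x = 1 \<or> \<chi> x = -1) \<and>
     (\<forall>x\<in>W. \<forall>y\<in>W. \<chi> (x + y) = \<chi> x * \<chi> y) \<and> (\<forall>x. x \<notin> W \<longrightarrow> \<chi> x = 0)}"

definition triv :: "'a::elementary_2_group set \<Rightarrow> 'a \<Rightarrow> real" where
  "triv W x = of_bool (x \<in> W)"

lemma finite_chars:
  assumes "finite W"
  shows "finite (chars W)"
proof (rule finite_subset)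
  show "chars W \<subseteq> {\<chi>. \<forall>x. (x \<in> W \<longrightarrow> \<chi> x \<in> {1, -1}) \<and> (x \<notin> W \<longrightarrow> \<chi> x = 0)}"
    by (auto simp: chars_def)
  show "finite {\<chi>. \<forall>x. (x \<in> W \<longrightarrow> \<chi> x \<in> {1, -1::real}) \<and> (x \<notin> W \<longrightarrow> \<chi> x = 0)}"
    using assms by (intro finite_set_of_finite_funs) auto
qed

lemma charsD:
  assumes "\<chi> \<in> chars W"
  shows "x \<in> W \<Longrightarrow> \<chi> x = 1 \<or> \<chi> x = -1"
    "x \<in> W \<Longrightarrow> y \<in> W \<Longrightarrow> \<chi> (x + y) = \<chi> x * \<chi> y"
    "x \<in> W \<Longrightarrow> \<chi> x * \<chi> x = 1" "x \<notin> W \<Longrightarrow> \<chi> x = 0"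
  using assms by (auto simp: chars_def)

lemma triv_chars: "subgrp W \<Longrightarrow> triv W \<in> chars W"
  by (auto simp: chars_def triv_def subgrp_def)

lemma char_nontriv:
  assumes "\<chi> \<in> chars W" "\<chi> \<noteq> triv W"
  obtains g where "g \<in> W" "\<chi> g = -1"
proof -
  obtain x where "\<chi> x \<noteq> triv W x" using assms(2) by auto
  then have "x \<in> W \<and> \<chi> x = -1"
    using charsD(1)[OF assms(1), of x] charsD(4)[OF assms(1), of x]
    by (cases "x \<in> W") (auto simp: triv_def)
  then show ?thesis using that by blast
qed

lemma sum_char:
  assumes W: "subgrp W" and \<chi>: "\<chi> \<in> chars W"
  shows "(\<Sum>x\<in>W. \<chi> x) = (if \<chi> = triv W then real (card W) else 0)"
proof (cases "\<chi> = triv W")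
  case True
  then show ?thesis by (simp add: triv_def)
next
  case False
  then obtain g where g: "g \<in> W" "\<chi> g = -1" using char_nontriv \<chi> by blast
  have "(\<Sum>x\<in>W. \<chi> x) = (\<Sum>x\<in>W. \<chi> (x + g))" using sum_translate[OF W g(1)] by metis
  also have "\<dots> = (\<Sum>x\<in>W. - \<chi> x)" using charsD(2)[OF \<chi>] g by (intro sum.cong) auto
  finally show ?thesis using False by (simp add: sum_negf)
qed

text \<open>A subgroup maximal among those avoiding \<open>x\<close> has index 2.\<close>

lemma char_separates:
  assumes W: "subgrp W" and x: "x \<in> W" "x \<noteq> 0"
  obtains \<chi> where "\<chi> \<in> chars W" "\<chi> x = -1"
proof -
  define P where "P H \<longleftrightarrow> subgrp H \<and> H \<subseteq> W \<and> x \<notin> H" for H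
  have fin: "finite W" using W by (simp add: subgrp_def)
  have "P {0}" using x W by (auto simp: P_def subgrp_def)
  moreover have "\<forall>H. P H \<longrightarrow> card H < card W + 1"
    using fin by (auto simp: P_def less_Suc_eq_le intro: card_mono)
  ultimately obtain H where H: "P H" and Hmax: "\<And>H'. P H' \<Longrightarrow> card H' \<le> card H"
    using ex_has_greatest_nat[of P "{0}" card "card W + 1"] by blast
  have sH: "subgrp H" "H \<subseteq> W" "x \<notin> H" using H by (auto simp: P_def)
  have cover: "g + x \<in> H" if g: "g \<in> W" "g \<notin> H" for g
  proof (rule ccontr)
    assume gx: "g + x \<notin> H"
    define H' where "H' = H \<union> (\<lambda>h. h + g) ` H"
    have "subgrp H'"
      unfolding subgrp_def
    proof (intro conjI ballI)
      show "finite H'" "0 \<in> H'" using sH by (auto simp: H'_def subgrp_def)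
      fix a b assume ab: "a \<in> H'" "b \<in> H'"
      obtain h u where a: "h \<in> H" "u = 0 \<or> u = g" "a = h + u" using ab(1) unfolding H'_def
        by force
      obtain h' u' where b: "h' \<in> H" "u' = 0 \<or> u' = g" "b = h' + u'" using ab(2) unfolding H'_def
        by force
      have *: "h + h' \<in> H" using a(1) b(1) sH(1) by (auto simp: subgrp_def)
      have "a + b = (h + h') + (u + u')" using a b by (simp add: algebra_simps)
      moreover have "u + u' = 0 \<or> u + u' = g" using a(2) b(2) by auto
      ultimately show "a + b \<in> H'" using * unfolding H'_def by auto
    qed
    moreover have "H' \<subseteq> W" using sH g W by (auto simp: H'_def subgrp_def)
    moreover have "x \<notin> H'"
    proof
      assume "x \<in> H'"
      then obtain h where "h \<in> H" "x = h + g" using sH by (auto simp: H'_def)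
      then have "g + x = h" by simp
      then show False using gx \<open>h \<in> H\<close> by simp
    qed
    ultimately have "card H' \<le> card H" using Hmax by (simp add: P_def)
    moreover have "g \<in> H'" using subgrpD(2)[OF sH(1)] unfolding H'_def by force
    then have "H \<subset> H'" using g unfolding H'_def by auto
    moreover have "finite H'" using sH by (auto simp: H'_def subgrp_def)
    ultimately show False by (meson leD psubset_card_mono)
  qed
  define \<chi> where "\<chi> u = (if u \<in> H then 1 else if u \<in> W then -1 else (0::real))" for u
  have "\<chi> \<in> chars W"
    unfolding chars_def
  proof (intro CollectI conjI ballI allI impI)
    fix u v assume uv: "u \<in> W" "v \<in> W"
    have uvW: "u + v \<in> W" using uv W by (auto simp: subgrp_def)
    have hc: "a + b \<in> H" if "a \<in> H" "b \<in> H" for a b using that sH(1) by (auto simp: subgrp_def)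
    have "u + v \<in> H" if "u \<notin> H" "v \<notin> H"
    proof -
      have "(u + x) + (v + x) \<in> H" using hc cover that uv by blast
      moreover have "(u + x) + (v + x) = u + v" by (simp add: ac_simps)
      ultimately show ?thesis by simp
    qed
    moreover have "u + v \<notin> H" if "u \<in> H" "v \<notin> H" using hc[of u "u + v"] that by auto
    moreover have "u + v \<notin> H" if "u \<notin> H" "v \<in> H" using hc[of "u + v" v] that by auto
    moreover have "u + v \<in> H" if "u \<in> H" "v \<in> H" using hc that by auto
    ultimately show "\<chi> (u + v) = \<chi> u * \<chi> v" using uv uvW by (auto simp: \<chi>_def)
  qed (use sH in \<open>auto simp: \<chi>_def\<close>)
  moreover have "\<chi> x = -1" using sH x by (auto simp: \<chi>_def)
  ultimately show ?thesis using that by blast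
qed

text \<open>For \<open>x \<noteq> 0\<close>, multiplication by a character that is -1 at
  \<open>x\<close> permutes \<open>chars W\<close> and changes the sign of the sum. The value at 0
  follows by summing over all of \<open>W\<close> in two ways, so the number of characters need not
  be known beforehand.\<close>

lemma sum_chars:
  assumes W: "subgrp W" and x: "x \<in> W"
  shows "(\<Sum>\<chi>\<in>chars W. \<chi> x) = (if x = 0 then real (card W) else 0)"
proof -
  have nz: "(\<Sum>\<chi>\<in>chars W. \<chi> y) = 0" if y: "y \<in> W" "y \<noteq> 0" for y
  proof -
    obtain \<psi> where \<psi>: "\<psi> \<in> chars W" "\<psi> y = -1" using char_separates W y by blast
    have mem: "(\<lambda>u. \<psi> u * \<chi> u) \<in> chars W" if "\<chi> \<in> chars W" for \<chi>
      unfolding chars_def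
    proof (intro CollectI conjI ballI allI impI)
      fix u v assume uv: "u \<in> W" "v \<in> W"
      show "\<psi> (u + v) * \<chi> (u + v) = \<psi> u * \<chi> u * (\<psi> v * \<chi> v)"
        by (simp add: charsD(2)[OF \<psi>(1) uv] charsD(2)[OF that uv])
    next
      fix u assume u: "u \<in> W"
      show "\<psi> u * \<chi> u = 1 \<or> \<psi> u * \<chi> u = -1"
        using charsD(1)[OF \<psi>(1) u] charsD(1)[OF that u] by auto
    qed (simp add: charsD(4)[OF that])
    have inv: "(\<lambda>u. \<psi> u * (\<psi> u * \<chi> u)) = \<chi>" if "\<chi> \<in> chars W" for \<chi>
    proof
      fix u show "\<psi> u * (\<psi> u * \<chi> u) = \<chi> u"
        using charsD(3)[OF \<psi>(1), of u] charsD(4)[OF that, of u]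
        by (cases "u \<in> W") (auto simp: mult.assoc[symmetric])
    qed
    have "(\<Sum>\<chi>\<in>chars W. \<chi> y) = (\<Sum>\<chi>\<in>chars W. - \<chi> y)"
      by (rule sum.reindex_bij_witness[of _ "\<lambda>\<chi> u. \<psi> u * \<chi> u" "\<lambda>\<chi> u. \<psi> u * \<chi> u"])
         (use mem inv in \<open>simp_all add: \<psi>(2)\<close>)
    then show ?thesis by (simp add: sum_negf)
  qed
  have "(\<Sum>y\<in>W. \<Sum>\<chi>\<in>chars W. \<chi> y) = (\<Sum>\<chi>\<in>chars W. \<Sum>y\<in>W. \<chi> y)" by (rule sum.swap)
  also have "\<dots> = (\<Sum>\<chi>\<in>chars W. if \<chi> = triv W then real (card W) else 0)"
    by (rule sum.cong) (auto simp: sum_char W)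
  also have "\<dots> = card W"
    using finite_chars[of W] triv_chars[OF W] W by (simp add: sum.delta subgrpD)
  finally have *: "(\<Sum>y\<in>W. \<Sum>\<chi>\<in>chars W. \<chi> y) = card W" .
  have "(\<Sum>y\<in>W. \<Sum>\<chi>\<in>chars W. \<chi> y)
      = (\<Sum>\<chi>\<in>chars W. \<chi> 0) + (\<Sum>y\<in>W - {0}. \<Sum>\<chi>\<in>chars W. \<chi> y)"
    using W by (intro sum.remove) (auto simp: subgrp_def)
  also have "(\<Sum>y\<in>W - {0}. \<Sum>\<chi>\<in>chars W. \<chi> y) = 0" using nz by (intro sum.neutral) auto
  finally have "(\<Sum>\<chi>\<in>chars W. \<chi> 0) = card W" using * by simp
  then show ?thesis using nz x by auto
qed

definition fourier :: "'a::elementary_2_group set \<Rightarrow> ('a \<Rightarrow> real) \<Rightarrow> ('a \<Rightarrow> real) \<Rightarrow> real" where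
  "fourier W f \<chi> = (\<Sum>x\<in>W. f x * \<chi> x)"

lemma parseval:
  fixes f :: "'a::elementary_2_group \<Rightarrow> real"
  assumes W: "subgrp W"
  shows "(\<Sum>\<chi>\<in>chars W. (fourier W f \<chi>)\<^sup>2) = real (card W) * (\<Sum>x\<in>W. (f x)\<^sup>2)"
proof -
  have "(\<Sum>\<chi>\<in>chars W. (fourier W f \<chi>)\<^sup>2)
      = (\<Sum>\<chi>\<in>chars W. \<Sum>x\<in>W. \<Sum>y\<in>W. f x * f y * \<chi> (x + y))"
  proof (rule sum.cong[OF refl])
    fix \<chi> assume \<chi>: "\<chi> \<in> chars W"
    have "(fourier W f \<chi>)\<^sup>2 = (\<Sum>x\<in>W. \<Sum>y\<in>W. (f x * \<chi> x) * (f y * \<chi> y))"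
      unfolding fourier_def power2_eq_square sum_product ..
    also have "\<dots> = (\<Sum>x\<in>W. \<Sum>y\<in>W. f x * f y * \<chi> (x + y))"
      by (intro sum.cong refl) (simp add: charsD(2)[OF \<chi>])
    finally show "(fourier W f \<chi>)\<^sup>2 = (\<Sum>x\<in>W. \<Sum>y\<in>W. f x * f y * \<chi> (x + y))" .
  qed
  also have "\<dots> = (\<Sum>x\<in>W. \<Sum>\<chi>\<in>chars W. \<Sum>y\<in>W. f x * f y * \<chi> (x + y))"
    by (rule sum.swap)
  also have "\<dots> = (\<Sum>x\<in>W. \<Sum>y\<in>W. \<Sum>\<chi>\<in>chars W. f x * f y * \<chi> (x + y))"
    by (intro sum.cong refl sum.swap)
  also have "\<dots> = (\<Sum>x\<in>W. \<Sum>y\<in>W. if y = x then real (card W) * (f x)\<^sup>2 else 0)"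
  proof (intro sum.cong refl)
    fix x y assume xy: "x \<in> W" "y \<in> W"
    have "x + y = 0 \<longleftrightarrow> y = x" by (metis add_self add_self_left add_0_right)
    then show "(\<Sum>\<chi>\<in>chars W. f x * f y * \<chi> (x + y)) = (if y = x then real (card W) * (f x)\<^sup>2 else 0)"
      unfolding sum_distrib_left[symmetric]
      using sum_chars[OF W, of "x + y"] xy W by (auto simp: subgrp_def power2_eq_square)
  qed
  also have "\<dots> = real (card W) * (\<Sum>x\<in>W. (f x)\<^sup>2)"
    using W by (simp add: subgrpD sum_distrib_left)
  finally show ?thesis .
qed

lemma convolution_fourier:
  fixes f a b :: "'a::elementary_2_group \<Rightarrow> real"
  assumes W: "subgrp W"
  shows "real (card W) * (\<Sum>y\<in>W. \<Sum>z\<in>W. f (y + z) * a y * b z)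
    = (\<Sum>\<chi>\<in>chars W. fourier W f \<chi> * fourier W a \<chi> * fourier W b \<chi>)"
proof -
  have "(\<Sum>\<chi>\<in>chars W. fourier W f \<chi> * fourier W a \<chi> * fourier W b \<chi>)
      = (\<Sum>\<chi>\<in>chars W. \<Sum>y\<in>W. \<Sum>z\<in>W. \<Sum>x\<in>W. f x * a y * b z * \<chi> (x + y + z))"
  proof (intro sum.cong refl)
    fix \<chi> assume \<chi>: "\<chi> \<in> chars W"
    have "fourier W f \<chi> * fourier W a \<chi> * fourier W b \<chi>
        = (\<Sum>y\<in>W. \<Sum>z\<in>W. \<Sum>x\<in>W. (f x * \<chi> x) * ((a y * \<chi> y) * (b z * \<chi> z)))"
      by (simp only: fourier_def sum_distrib_left[symmetric] sum_distrib_right[symmetric])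
    also have "\<dots> = (\<Sum>y\<in>W. \<Sum>z\<in>W. \<Sum>x\<in>W. f x * a y * b z * \<chi> (x + y + z))"
      by (intro sum.cong refl) (simp add: charsD(2)[OF \<chi>] subgrpD(3)[OF W])
    finally show "fourier W f \<chi> * fourier W a \<chi> * fourier W b \<chi>
        = (\<Sum>y\<in>W. \<Sum>z\<in>W. \<Sum>x\<in>W. f x * a y * b z * \<chi> (x + y + z))" .
  qed
  also have "\<dots> = (\<Sum>y\<in>W. \<Sum>\<chi>\<in>chars W. \<Sum>z\<in>W. \<Sum>x\<in>W. f x * a y * b z * \<chi> (x + y + z))"
    by (rule sum.swap)
  also have "\<dots> = (\<Sum>y\<in>W. \<Sum>z\<in>W. \<Sum>\<chi>\<in>chars W. \<Sum>x\<in>W. f x * a y * b z * \<chi> (x + y + z))"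
    by (intro sum.cong refl sum.swap)
  also have "\<dots> = (\<Sum>y\<in>W. \<Sum>z\<in>W. \<Sum>x\<in>W. \<Sum>\<chi>\<in>chars W. f x * a y * b z * \<chi> (x + y + z))"
    by (intro sum.cong refl sum.swap)
  also have "\<dots> = (\<Sum>y\<in>W. \<Sum>z\<in>W. real (card W) * (f (y + z) * a y * b z))"
  proof (intro sum.cong refl)
    fix y z assume yz: "y \<in> W" "z \<in> W"
    have yzW: "y + z \<in> W" using yz W by (simp add: subgrpD)
    have "(\<Sum>x\<in>W. \<Sum>\<chi>\<in>chars W. f x * a y * b z * \<chi> (x + y + z))
        = (\<Sum>x\<in>W. if x = y + z then real (card W) * (f (y + z) * a y * b z) else 0)"
    proof (intro sum.cong refl)
      fix x assume x: "x \<in> W"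
      have eq: "x + y + z = 0 \<longleftrightarrow> x = y + z"
        by (metis add_self add_self_left add_0_right add.assoc)
      have "x + y + z \<in> W" using x yz W by (simp add: subgrpD)
      then show "(\<Sum>\<chi>\<in>chars W. f x * a y * b z * \<chi> (x + y + z))
          = (if x = y + z then real (card W) * (f (y + z) * a y * b z) else 0)"
        unfolding sum_distrib_left[symmetric] sum_chars[OF W \<open>x + y + z \<in> W\<close>] eq
        by simp
    qed
    then show "(\<Sum>x\<in>W. \<Sum>\<chi>\<in>chars W. f x * a y * b z * \<chi> (x + y + z))
        = real (card W) * (f (y + z) * a y * b z)"
      using yzW W by (simp add: subgrpD)
  qed
  finally show ?thesis by (simp add: sum_distrib_left)
qed

section \<open>Uniform sets\<close>

definition dens :: "'a set \<Rightarrow> 'a set \<Rightarrow> real" where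
  "dens W X = card X / card W"

text \<open>Uniformity is smallness of the cut norm of the Cayley graph; by the Fourier expansion it
  follows from smallness of all nontrivial Fourier coefficients.\<close>

definition uniform :: "'a::elementary_2_group set \<Rightarrow> real \<Rightarrow> 'a set \<Rightarrow> bool" where
  "uniform W \<eta> X \<longleftrightarrow> (\<forall>a b. (\<forall>y\<in>W. \<bar>a y\<bar> \<le> 1) \<longrightarrow> (\<forall>z\<in>W. \<bar>b z\<bar> \<le> 1) \<longrightarrow>
     \<bar>\<Sum>y\<in>W. \<Sum>z\<in>W. (of_bool (y + z \<in> X) - dens W X) * a y * b z\<bar> \<le> \<eta> * (real (card W))\<^sup>2)"

text \<open>The trivial character contributes exactly the main term with \<open>dens W X\<close>.
  For the others the coefficient of \<open>X\<close> is at most \<open>\<eta> * card W\<close> in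
  absolute value, and the remaining product of two coefficients is summed by the inequality of means
  and Parseval.\<close>

lemma uniform_if_fourier:
  fixes \<eta> :: real
  assumes W: "subgrp W" and X: "X \<subseteq> W" and \<eta>: "\<eta> \<ge> 0"
    and small: "\<And>\<chi>. \<chi> \<in> chars W \<Longrightarrow> \<chi> \<noteq> triv W \<Longrightarrow> \<bar>\<Sum>x\<in>X. \<chi> x\<bar> \<le> \<eta> * card W"
  shows "uniform W \<eta> X"
  unfolding uniform_def
proof (intro allI impI)
  fix a b :: "'a \<Rightarrow> real"
  assume a: "\<forall>y\<in>W. \<bar>a y\<bar> \<le> 1" and b: "\<forall>z\<in>W. \<bar>b z\<bar> \<le> 1"
  define N where "N = real (card W)"
  have N: "N > 0" using W by (simp add: N_def subgrpD)
  define f where "f x = (of_bool (x \<in> X) :: real)" for x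
  define F where "F \<chi> = fourier W f \<chi> * fourier W a \<chi> * fourier W b \<chi>" for \<chi>
  have fin: "finite W" "finite (chars W)" using W by (auto simp: subgrpD finite_chars)
  have fhat: "fourier W f \<chi> = (\<Sum>x\<in>X. \<chi> x)" for \<chi>
  proof -
    have "fourier W f \<chi> = (\<Sum>x\<in>W. if x \<in> X then \<chi> x else 0)"
      unfolding fourier_def f_def by (intro sum.cong) auto
    also have "\<dots> = (\<Sum>x\<in>X. \<chi> x)" using X fin by (simp add: sum.inter_restrict[symmetric] Int_absorb1)
    finally show ?thesis .
  qed
  have tr: "fourier W g (triv W) = (\<Sum>x\<in>W. g x)" for g
    unfolding fourier_def by (intro sum.cong) (auto simp: triv_def)
  have trX: "(\<Sum>x\<in>X. triv W x) = card X" using X by (simp add: triv_def subset_iff Int_absorb1 of_bool_def)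
  have "N * (\<Sum>y\<in>W. \<Sum>z\<in>W. f (y + z) * a y * b z) = (\<Sum>\<chi>\<in>chars W. F \<chi>)"
    unfolding N_def F_def by (rule convolution_fourier[OF W])
  also have "\<dots> = F (triv W) + (\<Sum>\<chi>\<in>chars W - {triv W}. F \<chi>)"
    using fin triv_chars[OF W] by (intro sum.remove) auto
  also have "F (triv W) = N * (\<Sum>y\<in>W. \<Sum>z\<in>W. dens W X * a y * b z)"
  proof -
    have "(\<Sum>y\<in>W. \<Sum>z\<in>W. dens W X * a y * b z) = dens W X * (sum a W * sum b W)"
      unfolding sum_product by (simp add: sum_distrib_left mult.assoc)
    moreover have "fourier W f (triv W) = card X" using fhat trX by simp
    ultimately show ?thesis
      using N by (simp add: F_def tr[of a] tr[of b] dens_def N_def)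
  qed
  finally have eq: "N * (\<Sum>y\<in>W. \<Sum>z\<in>W. (f (y + z) - dens W X) * a y * b z)
      = (\<Sum>\<chi>\<in>chars W - {triv W}. F \<chi>)"
    by (simp add: algebra_simps sum_subtractf)
  have ab: "(\<Sum>\<chi>\<in>chars W. (fourier W g \<chi>)\<^sup>2) \<le> N * N" if "\<forall>y\<in>W. \<bar>g y\<bar> \<le> 1" for g
  proof -
    have "(\<Sum>x\<in>W. (g x)\<^sup>2) \<le> (\<Sum>x\<in>W. 1)"
      using that by (intro sum_mono) (simp add: abs_square_le_1)
    then show ?thesis unfolding parseval[OF W] N_def by (intro mult_left_mono) auto
  qed
  have "\<bar>\<Sum>\<chi>\<in>chars W - {triv W}. F \<chi>\<bar> \<le> (\<Sum>\<chi>\<in>chars W - {triv W}. \<bar>F \<chi>\<bar>)" by (rule sum_abs)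
  also have "\<dots> \<le> (\<Sum>\<chi>\<in>chars W - {triv W}.
      \<eta> * N * (((fourier W a \<chi>)\<^sup>2 + (fourier W b \<chi>)\<^sup>2) / 2))"
  proof (intro sum_mono)
    fix \<chi> assume \<chi>: "\<chi> \<in> chars W - {triv W}"
    have am: "\<bar>u * v\<bar> \<le> (u\<^sup>2 + v\<^sup>2) / 2" for u v :: real
      using zero_le_power2[of "\<bar>u\<bar> - \<bar>v\<bar>"] by (simp add: power2_diff abs_mult)
    have "\<bar>F \<chi>\<bar> = \<bar>\<Sum>x\<in>X. \<chi> x\<bar> * \<bar>fourier W a \<chi> * fourier W b \<chi>\<bar>"
      by (simp add: F_def fhat abs_mult)
    also have "\<dots> \<le> (\<eta> * N) * (((fourier W a \<chi>)\<^sup>2 + (fourier W b \<chi>)\<^sup>2) / 2)"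
      using \<chi> small am \<eta> N by (intro mult_mono) (auto simp: N_def)
    finally show "\<bar>F \<chi>\<bar> \<le> \<eta> * N * (((fourier W a \<chi>)\<^sup>2 + (fourier W b \<chi>)\<^sup>2) / 2)" .
  qed
  also have "\<dots> \<le> (\<Sum>\<chi>\<in>chars W. \<eta> * N * (((fourier W a \<chi>)\<^sup>2 + (fourier W b \<chi>)\<^sup>2) / 2))"
    using fin \<eta> N by (intro sum_mono2) auto
  also have "\<dots> = \<eta> * N * (((\<Sum>\<chi>\<in>chars W. (fourier W a \<chi>)\<^sup>2)
      + (\<Sum>\<chi>\<in>chars W. (fourier W b \<chi>)\<^sup>2)) / 2)"
    by (simp add: sum_distrib_left[symmetric] sum_divide_distrib[symmetric] sum.distrib)
  also have "\<dots> \<le> \<eta> * N * (N * N)"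
    using ab[OF a] ab[OF b] \<eta> N by (intro mult_left_mono) auto
  finally have "\<bar>N * (\<Sum>y\<in>W. \<Sum>z\<in>W. (f (y + z) - dens W X) * a y * b z)\<bar> \<le> N * (\<eta> * N\<^sup>2)"
    unfolding eq by (simp add: power2_eq_square mult_ac)
  then have "N * \<bar>\<Sum>y\<in>W. \<Sum>z\<in>W. (f (y + z) - dens W X) * a y * b z\<bar> \<le> N * (\<eta> * N\<^sup>2)"
    using N by (simp add: abs_mult)
  then show "\<bar>\<Sum>y\<in>W. \<Sum>z\<in>W. (of_bool (y + z \<in> X) - dens W X) * a y * b z\<bar> \<le> \<eta> * (real (card W))\<^sup>2"
    using N by (simp add: f_def N_def)
qed

lemma sum_restrict2:
  fixes F :: "'a \<Rightarrow> 'b \<Rightarrow> real"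
  assumes "finite W" "finite W'" "S \<subseteq> W" "T \<subseteq> W'"
    and "\<And>y z. y \<notin> S \<or> z \<notin> T \<Longrightarrow> F y z = 0"
  shows "(\<Sum>y\<in>W. \<Sum>z\<in>W'. F y z) = (\<Sum>y\<in>S. \<Sum>z\<in>T. F y z)"
proof -
  have "(\<Sum>y\<in>W. \<Sum>z\<in>W'. F y z) = (\<Sum>y\<in>S. \<Sum>z\<in>W'. F y z)"
    using assms by (intro sum.mono_neutral_right) auto
  also have "\<dots> = (\<Sum>y\<in>S. \<Sum>z\<in>T. F y z)"
    using assms by (intro sum.cong refl sum.mono_neutral_right) auto
  finally show ?thesis .
qed

lemma uniform_eta_nonneg:
  assumes "uniform W \<eta> Z" "subgrp W"
  shows "\<eta> \<ge> 0"
proof -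
  have "0 \<le> \<eta> * (real (card W))\<^sup>2"
    using assms(1) unfolding uniform_def by (elim allE[of _ "\<lambda>_. 0"]) simp
  then show ?thesis using subgrpD(4)[OF assms(2)] by (simp add: zero_le_mult_iff)
qed

lemma uniform_bilinear:
  fixes a b :: "'a::elementary_2_group \<Rightarrow> real" and C D \<eta> :: real
  assumes U: "uniform W \<eta> Z" and W: "subgrp W" and ST: "S \<subseteq> W" "T \<subseteq> W"
    and a: "\<And>y. y \<in> S \<Longrightarrow> \<bar>a y\<bar> \<le> C" and b: "\<And>z. z \<in> T \<Longrightarrow> \<bar>b z\<bar> \<le> D"
    and CD: "0 \<le> C" "0 \<le> D"
  shows "\<bar>\<Sum>y\<in>S. \<Sum>z\<in>T. (of_bool (y + z \<in> Z) - dens W Z) * a y * b z\<bar>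
    \<le> \<eta> * (real (card W))\<^sup>2 * (C * D)"
proof (cases "C = 0 \<or> D = 0")
  case True
  then have "a y * b z = 0" if "y \<in> S" "z \<in> T" for y z
    using a[OF that(1)] b[OF that(2)] by auto
  then have "(\<Sum>y\<in>S. \<Sum>z\<in>T. (of_bool (y + z \<in> Z) - dens W Z) * a y * b z) = 0"
    by (intro sum.neutral ballI) (simp add: mult.assoc)
  then show ?thesis using True by auto
next
  case False
  then have pos: "C > 0" "D > 0" using CD by auto
  define a' where "a' y = (if y \<in> S then a y / C else 0)" for y
  define b' where "b' z = (if z \<in> T then b z / D else 0)" for z
  define F where "F y z = (of_bool (y + z \<in> Z) - dens W Z)" for y z
  have a': "\<forall>y\<in>W. \<bar>a' y\<bar> \<le> 1" and b': "\<forall>z\<in>W. \<bar>b' z\<bar> \<le> 1"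
    using a b pos by (auto simp: a'_def b'_def)
  have "(\<Sum>y\<in>W. \<Sum>z\<in>W. F y z * a' y * b' z) = (\<Sum>y\<in>S. \<Sum>z\<in>T. F y z * a' y * b' z)"
    using subgrpD(1)[OF W] ST by (intro sum_restrict2) (auto simp: a'_def b'_def)
  also have "\<dots> = (\<Sum>y\<in>S. \<Sum>z\<in>T. F y z * a y * b z) / (C * D)"
    by (simp add: sum_divide_distrib a'_def b'_def)
  finally have "(\<Sum>y\<in>S. \<Sum>z\<in>T. F y z * a y * b z)
      = (\<Sum>y\<in>W. \<Sum>z\<in>W. F y z * a' y * b' z) * (C * D)"
    using pos by (simp add: field_simps)
  moreover have "\<bar>\<Sum>y\<in>W. \<Sum>z\<in>W. F y z * a' y * b' z\<bar> \<le> \<eta> * (real (card W))\<^sup>2"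
    using U a' b' unfolding uniform_def F_def by blast
  ultimately show ?thesis
    using pos unfolding F_def by (simp add: abs_mult mult_right_mono)
qed

lemma uniform_count:
  fixes a :: "'a::elementary_2_group \<Rightarrow> real" and \<eta> :: real
  assumes U: "uniform W \<eta> Z" and W: "subgrp W" and ST: "S \<subseteq> W" "T \<subseteq> W"
    and a: "\<And>y. y \<in> S \<Longrightarrow> 0 \<le> a y \<and> a y \<le> 1"
  shows "(\<Sum>z\<in>T. \<Sum>y\<in>S. a y * of_bool (y + z \<in> Z))
    \<le> dens W Z * sum a S * card T + \<eta> * (real (card W))\<^sup>2"
proof -
  have "\<bar>\<Sum>y\<in>S. \<Sum>z\<in>T. (of_bool (y + z \<in> Z) - dens W Z) * a y * 1\<bar>
      \<le> \<eta> * (real (card W))\<^sup>2 * (1 * 1)"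
    using a by (intro uniform_bilinear[OF U W ST]) auto
  moreover have "(\<Sum>y\<in>S. \<Sum>z\<in>T. (of_bool (y + z \<in> Z) - dens W Z) * a y * 1)
      = (\<Sum>z\<in>T. \<Sum>y\<in>S. a y * of_bool (y + z \<in> Z)) - dens W Z * sum a S * card T"
    by (subst sum.swap[of _ T S])
       (simp add: algebra_simps sum_subtractf sum_distrib_left sum_distrib_right)
  ultimately show ?thesis by linarith
qed

text \<open>Summed over \<open>T\<close>, the excess \<open>\<delta>\<close> per vertex cannot
  exceed the cut norm error. In a sparse graph this replaces the trivial upper bound on degrees,
  which would be far too weak.\<close>

lemma uniform_exceptional:
  fixes a :: "'a::elementary_2_group \<Rightarrow> real" and \<eta> \<delta> :: real
  assumes U: "uniform W \<eta> Z" and W: "subgrp W" and ST: "S \<subseteq> W" "T \<subseteq> W"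
    and a: "\<And>y. y \<in> S \<Longrightarrow> 0 \<le> a y \<and> a y \<le> 1"
    and ex: "\<And>z. z \<in> T \<Longrightarrow> dens W Z * sum a S + \<delta> \<le> (\<Sum>y\<in>S. a y * of_bool (y + z \<in> Z))"
  shows "card T * \<delta> \<le> \<eta> * (real (card W))\<^sup>2"
proof -
  have "(\<Sum>z\<in>T. dens W Z * sum a S + \<delta>) \<le> (\<Sum>z\<in>T. \<Sum>y\<in>S. a y * of_bool (y + z \<in> Z))"
    using ex by (rule sum_mono)
  then show ?thesis
    using uniform_count[where a = a, OF U W ST a] by (simp add: algebra_simps)
qed

text \<open>Each factor of the power is an average over \<open>i\<close> of products of a function
  of \<open>y\<close> and a function of \<open>z\<close>. The induction removes one factor and, for
  fixed \<open>i\<close>, absorbs it into the weights \<open>a\<close> and \<open>b\<close>; hence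
  arbitrary weights in the statement. The price is \<open>G * H\<close> per factor, to be paid by a
  small \<open>\<eta>\<close>.\<close>

lemma uniform_kernel_power:
  fixes a b :: "'a::elementary_2_group \<Rightarrow> real" and g h :: "'i \<Rightarrow> 'a \<Rightarrow> real" and C D G H \<eta> :: real
  assumes U: "uniform W \<eta> Z" and W: "subgrp W" and ST: "S \<subseteq> W" "T \<subseteq> W"
    and g: "\<And>i y. i \<in> I \<Longrightarrow> y \<in> S \<Longrightarrow> \<bar>g i y\<bar> \<le> G"
    and h: "\<And>i z. i \<in> I \<Longrightarrow> z \<in> T \<Longrightarrow> \<bar>h i z\<bar> \<le> H"
    and GH: "0 \<le> G" "0 \<le> H"
    and a: "\<And>y. y \<in> S \<Longrightarrow> \<bar>a y\<bar> \<le> C" and b: "\<And>z. z \<in> T \<Longrightarrow> \<bar>b z\<bar> \<le> D"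
    and CD: "0 \<le> C" "0 \<le> D"
  shows "\<bar>\<Sum>y\<in>S. \<Sum>z\<in>T. (of_bool (y + z \<in> Z) - dens W Z) * a y * b z
      * ((\<Sum>i\<in>I. g i y * h i z) / card I) ^ k\<bar>
    \<le> \<eta> * (real (card W))\<^sup>2 * (C * D) * (G * H) ^ k"
  using a b CD
proof (induction k arbitrary: a b C D)
  case 0
  then show ?case using uniform_bilinear[OF U W ST, of a C b D] by simp
next
  case (Suc k)
  define F where "F y z = (of_bool (y + z \<in> Z) - dens W Z)" for y z
  define r where "r y z = (\<Sum>i\<in>I. g i y * h i z) / card I" for y z
  define B where "B = \<eta> * (real (card W))\<^sup>2 * (C * D) * (G * H) ^ Suc k"
  have B: "B \<ge> 0"
    using Suc.prems GH uniform_eta_nonneg[OF U W] by (simp add: B_def)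
  have step: "\<bar>\<Sum>y\<in>S. \<Sum>z\<in>T. F y z * (a y * g i y) * (b z * h i z) * r y z ^ k\<bar> \<le> B"
    if i: "i \<in> I" for i
  proof -
    have "\<bar>\<Sum>y\<in>S. \<Sum>z\<in>T. F y z * (a y * g i y) * (b z * h i z) * r y z ^ k\<bar>
      \<le> \<eta> * (real (card W))\<^sup>2 * ((C * G) * (D * H)) * (G * H) ^ k"
      unfolding F_def r_def
      using Suc.prems g h i GH
      by (intro Suc.IH) (auto simp: abs_mult intro!: mult_mono)
    then show ?thesis by (simp add: B_def mult_ac)
  qed
  have "(\<Sum>y\<in>S. \<Sum>z\<in>T. F y z * a y * b z * r y z ^ Suc k)
      = (\<Sum>y\<in>S. \<Sum>z\<in>T. \<Sum>i\<in>I. F y z * (a y * g i y) * (b z * h i z) * r y z ^ k / card I)"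
  proof (intro sum.cong refl)
    fix y z
    have "F y z * a y * b z * r y z ^ Suc k
        = (F y z * a y * b z * r y z ^ k / card I) * (\<Sum>i\<in>I. g i y * h i z)"
      by (simp add: r_def)
    also have "\<dots> = (\<Sum>i\<in>I. F y z * (a y * g i y) * (b z * h i z) * r y z ^ k / card I)"
      unfolding sum_distrib_left by (intro sum.cong refl) (simp add: mult_ac)
    finally show "F y z * a y * b z * r y z ^ Suc k
        = (\<Sum>i\<in>I. F y z * (a y * g i y) * (b z * h i z) * r y z ^ k / card I)" .
  qed
  also have "\<dots> = (\<Sum>y\<in>S. \<Sum>i\<in>I. \<Sum>z\<in>T. F y z * (a y * g i y) * (b z * h i z) * r y z ^ k / card I)"
    by (intro sum.cong refl sum.swap)
  also have "\<dots> = (\<Sum>i\<in>I. \<Sum>y\<in>S. \<Sum>z\<in>T. F y z * (a y * g i y) * (b z * h i z) * r y z ^ k / card I)"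
    by (rule sum.swap)
  also have "\<bar>\<dots>\<bar> \<le> (\<Sum>i\<in>I. B / card I)"
    by (rule order_trans[OF sum_abs sum_mono])
       (use step in \<open>simp add: sum_divide_distrib[symmetric] abs_divide divide_right_mono\<close>)
  also have "\<dots> \<le> B" using B by (cases "card I = 0") auto
  finally show ?case unfolding F_def r_def B_def .
qed

text \<open>Positive semidefiniteness of Schur powers of the Gram kernel of the joint family
  \<open>(g, h)\<close>, written in block form.\<close>

lemma gram_power_nonneg:
  fixes u :: "'b \<Rightarrow> real" and v :: "'c \<Rightarrow> real" and g :: "'i \<Rightarrow> 'b \<Rightarrow> real" and h :: "'i \<Rightarrow> 'c \<Rightarrow> real"
  shows "0 \<le> (\<Sum>y\<in>S. \<Sum>y'\<in>S. u y * u y' * ((\<Sum>i\<in>I. g i y * g i y') / card I) ^ k)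
    + 2 * (\<Sum>y\<in>S. \<Sum>z\<in>T. u y * v z * ((\<Sum>i\<in>I. g i y * h i z) / card I) ^ k)
    + (\<Sum>z\<in>T. \<Sum>z'\<in>T. v z * v z' * ((\<Sum>i\<in>I. h i z * h i z') / card I) ^ k)"
proof (induction k arbitrary: u v)
  case 0
  have "(\<Sum>y\<in>S. \<Sum>y'\<in>S. u y * u y') + 2 * (\<Sum>y\<in>S. \<Sum>z\<in>T. u y * v z) + (\<Sum>z\<in>T. \<Sum>z'\<in>T. v z * v z')
      = (sum u S + sum v T)\<^sup>2"
    by (simp add: sum_product[symmetric] power2_eq_square algebra_simps)
  then show ?case by simp
next
  case (Suc k)
  \<comment> \<open>Stated for two arbitrary index sets because all three blocks have this shape:
    extracting one factor replaces \<open>u\<close> by \<open>u * g i\<close> and \<open>v\<close>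
    by \<open>v * h i\<close>, and the induction hypothesis applies for each
    \<open>i\<close>.\<close>
  have exp: "(\<Sum>y\<in>P. \<Sum>z\<in>Q. p y * q z * ((\<Sum>i\<in>I. f i y * f' i z) / card I) ^ Suc k)
      = (\<Sum>i\<in>I. (\<Sum>y\<in>P. \<Sum>z\<in>Q. (p y * f i y) * (q z * f' i z) * ((\<Sum>i\<in>I. f i y * f' i z) / card I) ^ k)) / card I"
    for P :: "'x set" and Q :: "'y set" and p q and f :: "'i \<Rightarrow> 'x \<Rightarrow> real" and f' :: "'i \<Rightarrow> 'y \<Rightarrow> real"
  proof -
    define r where "r y z = (\<Sum>i\<in>I. f i y * f' i z) / card I" for y z
    have "(\<Sum>y\<in>P. \<Sum>z\<in>Q. p y * q z * r y z ^ Suc k)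
        = (\<Sum>y\<in>P. \<Sum>z\<in>Q. \<Sum>i\<in>I. (p y * f i y) * (q z * f' i z) * r y z ^ k / card I)"
    proof (intro sum.cong refl)
      fix y z
      have "p y * q z * r y z ^ Suc k = (p y * q z * r y z ^ k / card I) * (\<Sum>i\<in>I. f i y * f' i z)"
        by (simp add: r_def)
      also have "\<dots> = (\<Sum>i\<in>I. (p y * f i y) * (q z * f' i z) * r y z ^ k / card I)"
        unfolding sum_distrib_left by (intro sum.cong refl) (simp add: mult_ac)
      finally show "p y * q z * r y z ^ Suc k
          = (\<Sum>i\<in>I. (p y * f i y) * (q z * f' i z) * r y z ^ k / card I)" .
    qed
    also have "\<dots> = (\<Sum>y\<in>P. \<Sum>i\<in>I. \<Sum>z\<in>Q. (p y * f i y) * (q z * f' i z) * r y z ^ k / card I)"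
      by (intro sum.cong refl sum.swap)
    also have "\<dots> = (\<Sum>i\<in>I. \<Sum>y\<in>P. \<Sum>z\<in>Q. (p y * f i y) * (q z * f' i z) * r y z ^ k / card I)"
      by (rule sum.swap)
    finally show ?thesis unfolding r_def by (simp add: sum_divide_distrib)
  qed
  have comb: "sum P I / n + 2 * (sum Q I / n) + sum R I / n = (\<Sum>i\<in>I. P i + 2 * Q i + R i) / n"
    for P Q R :: "'i \<Rightarrow> real" and n
    by (simp add: sum.distrib sum_distrib_left[symmetric] add_divide_distrib)
  show ?case
    unfolding exp comb using Suc.IH by (intro divide_nonneg_nonneg sum_nonneg) auto
qed

section \<open>Bipartite graphs without density increment\<close>

text \<open>The graph lies in the Cayley graph of \<open>Z\<close>, and \<open>\<alpha>\<close> is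
  its density relative to what a random-like \<open>Z\<close> would leave available.
  \<open>increment\<close> interprets the locale twice, for \<open>A\<close> and for its shear, in
  which \<open>Y\<close> and \<open>Z\<close> trade places.\<close>

locale incrementless =
  fixes W X Y Z :: "'a::elementary_2_group set" and A :: "'a \<Rightarrow> 'a \<Rightarrow> real"
    and \<eta> \<sigma> \<alpha> \<rho> :: real
  assumes W: "subgrp W" and sub: "X \<subseteq> W" "Y \<subseteq> W" "Z \<subseteq> W"
    and U: "uniform W \<eta> Z"
    and sigma: "0 < \<sigma>" "\<sigma> \<le> dens W X" "\<sigma> \<le> dens W Y" "\<sigma> \<le> dens W Z"
    and A0: "0 \<le> A x y" and A1: "A x y \<le> of_bool (x + y \<in> Z)"
    and alpha: "0 < \<alpha>"
    and mass: "(\<Sum>y\<in>Y. \<Sum>x\<in>X. A x y) = \<alpha> * dens W Z * card X * card Y"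
    and rho: "0 < \<rho>"
    and no_increment: "\<lbrakk>S \<subseteq> X; T \<subseteq> Y; \<rho> * card X \<le> card S; \<rho> * card Y \<le> card T\<rbrakk>
      \<Longrightarrow> (\<Sum>y\<in>T. \<Sum>x\<in>S. A x y) < 1.01 * \<alpha> * dens W Z * card S * card T"
begin

abbreviation "N \<equiv> real (card W)"
abbreviation "zd \<equiv> dens W Z"

lemma fin: "finite X" "finite Y" "finite Z" "finite W"
  using subgrpD(1)[OF W] sub finite_subset by auto

lemma N_pos: "N > 0" using subgrpD(4)[OF W] by simp

lemma card_bounds: "\<sigma> * N \<le> card X" "\<sigma> * N \<le> card Y" "card X \<le> N" "card Y \<le> N"
  using sigma N_pos card_mono[OF fin(4) sub(1)] card_mono[OF fin(4) sub(2)]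
  by (auto simp: dens_def pos_le_divide_eq)

lemma card_pos: "real (card X) > 0" "real (card Y) > 0"
  using card_bounds sigma(1) N_pos by (smt (verit) mult_pos_pos)+

lemma zd: "0 < zd" "\<sigma> \<le> zd" "zd \<le> 1" "\<sigma> \<le> 1"
proof -
  show "zd \<le> 1" using N_pos card_mono[OF fin(4) sub(3)] by (simp add: dens_def divide_le_eq)
  then show "0 < zd" "\<sigma> \<le> zd" "\<sigma> \<le> 1" using sigma by auto
qed

lemma eta: "\<eta> \<ge> 0" using uniform_eta_nonneg[OF U W] .

lemma A_le1: "A x y \<le> 1" using A1[of x y] by (simp add: of_bool_def split: if_splits)

text \<open>Degrees, codegrees and the averages \<open>\<phi>\<close> below are divided by the density of \<open>Z\<close> once for each
  edge, so that they are comparable to \<open>\<alpha>\<close>, \<open>\<alpha>\<^sup>2\<close> and \<open>\<alpha>\<close>, although the graph \<open>x + y \<in> Z\<close> containing \<open>A\<close>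
  may be sparse.\<close>

definition d :: "'a \<Rightarrow> real" where "d y = (\<Sum>x\<in>X. A x y) / (zd * card X)"

definition K :: "'a \<Rightarrow> 'a \<Rightarrow> real" where
  "K y y' = (\<Sum>x\<in>X. A x y * A x y') / (zd\<^sup>2 * card X)"

lemma d_nonneg: "0 \<le> d y" and K_nonneg: "0 \<le> K y y'"
  using A0 zd by (auto simp: d_def K_def intro!: divide_nonneg_nonneg sum_nonneg)

lemma sum_A: "(\<Sum>x\<in>X. A x y) = d y * (zd * card X)"
  using zd card_pos by (simp add: d_def)

lemma sum_AA: "(\<Sum>x\<in>X. A x y * A x y') = K y y' * (zd\<^sup>2 * card X)"
  using zd card_pos by (simp add: K_def)

lemma K_sym: "K y y' = K y' y" by (simp add: K_def mult.commute)

lemma sum_d: "(\<Sum>y\<in>Y. d y) = \<alpha> * card Y"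
proof -
  have "(\<Sum>y\<in>Y. d y) * (zd * card X) = \<alpha> * card Y * (zd * card X)"
    using mass unfolding sum_distrib_right sum_A by (simp only: mult_ac)
  moreover have "zd * card X \<noteq> 0" using zd card_pos by simp
  ultimately show ?thesis using mult_right_cancel by blast
qed

text \<open>The excess is measured in the unit of codegrees. Of the four factors
  \<open>\<sigma>\<close>, two bound \<open>zd\<^sup>2\<close>, one bounds \<open>card X\<close>
  against \<open>card W\<close>, and one converts \<open>card W\<close> to
  \<open>card Y\<close>.\<close>

lemma count_exceptional:
  assumes "T \<subseteq> Y" "\<delta> > 0" and a: "\<And>x. x \<in> X \<Longrightarrow> 0 \<le> a x \<and> a x \<le> 1"
    and ex: "\<And>z. z \<in> T \<Longrightarrow> zd * sum a X + \<delta> * (zd\<^sup>2 * card X) \<le> (\<Sum>x\<in>X. a x * of_bool (x + z \<in> Z))"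
  shows "card T \<le> \<eta> * card Y / (\<delta> * \<sigma> ^ 4)"
proof -
  have "card T * (\<delta> * (zd\<^sup>2 * card X)) \<le> \<eta> * N\<^sup>2"
    using assms sub by (intro uniform_exceptional[OF U W sub(1), where a = a]) auto
  moreover have "\<delta> * (\<sigma>\<^sup>2 * (\<sigma> * N)) \<le> \<delta> * (zd\<^sup>2 * card X)"
    using zd sigma(1) card_bounds N_pos assms(2) by (intro mult_left_mono mult_mono power_mono) auto
  ultimately have "card T * (\<delta> * (\<sigma>\<^sup>2 * (\<sigma> * N))) \<le> \<eta> * N\<^sup>2"
    by (meson mult_left_mono of_nat_0_le_iff order_trans)
  then have "(card T * (\<delta> * \<sigma> ^ 3)) * N \<le> (\<eta> * N) * N"
    by (simp add: power2_eq_square power3_eq_cube mult_ac)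
  then have "card T * (\<delta> * \<sigma> ^ 3) \<le> \<eta> * N" using N_pos by (simp only: mult_le_cancel_right_pos)
  then have "card T * (\<delta> * \<sigma> ^ 3) * \<sigma> \<le> \<eta> * (\<sigma> * N)"
    using sigma(1) by (simp add: mult_right_mono mult.commute mult.left_commute)
  also have "\<dots> \<le> \<eta> * card Y" using card_bounds eta by (intro mult_left_mono) auto
  finally show ?thesis
    using assms(2) sigma(1) by (simp add: pos_le_divide_eq mult_ac power4_eq_xxxx power3_eq_cube)
qed

text \<open>These vertices and all of \<open>X\<close> span a rectangle of density at least
  \<open>1.01 * \<alpha>\<close>, so \<open>no_increment\<close> forces them to be few. If
  \<open>\<rho> > 1\<close>, even \<open>X\<close> is too small for that hypothesis, but then the
  bound is trivial.\<close>

lemma card_high_degree: "card {y\<in>Y. 1.01 * \<alpha> \<le> d y} < \<rho> * card Y"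
proof (cases "\<rho> \<le> 1")
  case True
  let ?T = "{y\<in>Y. 1.01 * \<alpha> \<le> d y}"
  show ?thesis
  proof (rule ccontr)
    assume "\<not> ?thesis"
    then have "(\<Sum>y\<in>?T. \<Sum>x\<in>X. A x y) < 1.01 * \<alpha> * zd * card X * card ?T"
      using True card_pos by (intro no_increment) auto
    moreover have "(\<Sum>y\<in>?T. 1.01 * \<alpha> * (zd * card X)) \<le> (\<Sum>y\<in>?T. \<Sum>x\<in>X. A x y)"
      unfolding sum_A using zd by (intro sum_mono mult_right_mono) auto
    ultimately show False by (simp add: mult_ac)
  qed
next
  case False
  have "real (card {y\<in>Y. 1.01 * \<alpha> \<le> d y}) \<le> card Y"
    using fin by (intro of_nat_mono card_mono) auto
  also have "real (card Y) < \<rho> * card Y" using False card_pos by simp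
  finally show ?thesis .
qed

text \<open>Degrees average to \<open>\<alpha>\<close> and are at most
  \<open>1.01 * \<alpha>\<close> outside the small set \<open>E\<close>, so a proportion b of
  vertices in \<open>B\<close> satisfies 1 <= 1.01 (1 - b) + 0.001 + 0.9 b, that is b <= 0.1; their
  mass is then at most 0.9 * 0.1. Being few does not bound the mass of \<open>E\<close>, as a single
  degree may be huge after normalisation; uniformity of \<open>Z\<close> does.\<close>

lemma low_degree_mass:
  assumes small: "\<rho> + \<eta> / \<sigma> ^ 3 \<le> 0.001 * \<alpha>"
  shows "(\<Sum>y\<in>{y\<in>Y. d y < 0.9 * \<alpha>}. d y) \<le> 0.09 * \<alpha> * card Y"
proof -
  define E where "E = {y\<in>Y. 1.01 * \<alpha> \<le> d y}"
  define B where "B = {y\<in>Y. d y < 0.9 * \<alpha>}"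
  define M where "M = Y - E - B"
  have EBY: "E \<subseteq> Y" "B \<subseteq> Y" "M \<subseteq> Y" "finite M" "finite B" "M \<inter> B = {}"
    using fin by (auto simp: E_def B_def M_def)
  have "(\<Sum>y\<in>E. \<Sum>x\<in>X. A x y) \<le> (\<Sum>y\<in>E. \<Sum>x\<in>X. 1 * of_bool (x + y \<in> Z))"
    using A1 by (intro sum_mono) simp
  also have "\<dots> \<le> zd * (\<Sum>x\<in>X. 1) * card E + \<eta> * N\<^sup>2"
    using sub EBY by (intro uniform_count[OF U W]) auto
  finally have "(\<Sum>y\<in>E. d y) * (zd * card X) \<le> card E * (zd * card X) + \<eta> * N\<^sup>2"
    unfolding sum_A sum_distrib_right[symmetric] by (simp add: mult_ac)
  also have "\<eta> * N\<^sup>2 \<le> \<eta> / \<sigma> ^ 3 * card Y * (zd * card X)"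
  proof -
    have "(\<sigma> * N) * (\<sigma> * (\<sigma> * N)) \<le> card Y * (zd * card X)"
      using card_bounds zd sigma(1) N_pos by (intro mult_mono) auto
    then have "\<eta> / \<sigma> ^ 3 * ((\<sigma> * N) * (\<sigma> * (\<sigma> * N))) \<le> \<eta> / \<sigma> ^ 3 * (card Y * (zd * card X))"
      using eta sigma(1) by (intro mult_left_mono) auto
    then show ?thesis using sigma(1) by (simp add: power2_eq_square power3_eq_cube mult_ac)
  qed
  finally have "(\<Sum>y\<in>E. d y) * (zd * card X) \<le> (card E + \<eta> / \<sigma> ^ 3 * card Y) * (zd * card X)"
    by (simp add: algebra_simps)
  then have "(\<Sum>y\<in>E. d y) \<le> card E + \<eta> / \<sigma> ^ 3 * card Y"
    using zd card_pos by (simp add: mult_le_cancel_right)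
  also have "\<dots> \<le> (\<rho> + \<eta> / \<sigma> ^ 3) * card Y" using card_high_degree by (simp add: E_def algebra_simps)
  also have "\<dots> \<le> 0.001 * \<alpha> * card Y" using small by (intro mult_right_mono) auto
  finally have sE: "(\<Sum>y\<in>E. d y) \<le> 0.001 * \<alpha> * card Y" .
  have sB: "(\<Sum>y\<in>B. d y) \<le> 0.9 * \<alpha> * card B"
    using sum_bounded_above[of B d "0.9 * \<alpha>"] by (simp add: B_def mult_ac)
  have sM: "(\<Sum>y\<in>M. d y) \<le> 1.01 * \<alpha> * card M"
  proof -
    have "d y \<le> 1.01 * \<alpha>" if "y \<in> M" for y using that by (auto simp: M_def E_def)
    then show ?thesis using sum_bounded_above[of M d "1.01 * \<alpha>"] by (simp add: mult_ac)
  qed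
  have dis: "E \<inter> B = {}" using alpha by (auto simp: E_def B_def)
  have "(\<Sum>y\<in>Y. d y) = (\<Sum>y\<in>M. d y) + (\<Sum>y\<in>E. d y) + (\<Sum>y\<in>B. d y)"
  proof -
    have "(\<Sum>y\<in>Y. d y) = (\<Sum>y\<in>Y - E. d y) + (\<Sum>y\<in>E. d y)"
      using fin EBY by (intro sum.subset_diff) auto
    also have "(\<Sum>y\<in>Y - E. d y) = (\<Sum>y\<in>M. d y) + (\<Sum>y\<in>B. d y)"
      using fin dis EBY unfolding M_def by (intro sum.subset_diff) auto
    finally show ?thesis by simp
  qed
  moreover have "card M + card B \<le> card Y"
  proof -
    have "card M + card B = card (M \<union> B)" using EBY by (intro card_Un_disjoint[symmetric]) auto
    also have "\<dots> \<le> card Y" using fin EBY by (intro card_mono) auto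
    finally show ?thesis .
  qed
  then have "1.01 * \<alpha> * card M \<le> 1.01 * \<alpha> * (card Y - real (card B))"
    using alpha by (intro mult_left_mono) auto
  ultimately have "\<alpha> * card Y \<le> 1.01 * \<alpha> * (card Y - real (card B)) + 0.001 * \<alpha> * card Y + 0.9 * \<alpha> * card B"
    using sE sB sM sum_d by linarith
  then have "\<alpha> * card Y \<le> 1.01 * (\<alpha> * card Y) - 1.01 * (\<alpha> * card B)
      + 0.001 * (\<alpha> * card Y) + 0.9 * (\<alpha> * card B)"
    by (simp only: right_diff_distrib mult.assoc)
  then have "\<alpha> * card B \<le> 0.1 * (\<alpha> * card Y)" by simp
  then show ?thesis using sB unfolding B_def by simp
qed

lemma K_le: "K y y' \<le> 1 / \<sigma>\<^sup>2"
proof -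
  have "(\<Sum>x\<in>X. A x y * A x y') \<le> (\<Sum>x\<in>X. 1)"
    using A0 A_le1 by (intro sum_mono mult_le_one) auto
  then have "K y y' \<le> card X / (zd\<^sup>2 * card X)"
    unfolding K_def using zd by (intro divide_right_mono) auto
  also have "\<dots> = 1 / zd\<^sup>2" using card_pos by simp
  also have "\<dots> \<le> 1 / \<sigma>\<^sup>2" using zd sigma(1) by (intro divide_left_mono power_mono) auto
  finally show ?thesis .
qed

text \<open>Two exceptional counts: few \<open>y\<close> have normalised degree above 2, twice the
  degree in a random-like \<open>Z\<close>; for the others, the weight \<open>A x y\<close> predicts
  codegrees of at most about \<open>d y \<le> 2\<close>, so values above 3 are rare again.\<close>

lemma card_large_K:
  "(\<Sum>y\<in>Y. real (card {y'\<in>Y. K y y' > 3})) \<le> 2 * \<eta> / \<sigma> ^ 4 * (card Y)\<^sup>2"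
proof -
  let ?c = "\<eta> * card Y / \<sigma> ^ 4"
  have c0: "?c \<ge> 0" using eta sigma(1) by simp
  have d2: "card {y\<in>Y. d y > 2} \<le> ?c"
  proof -
    have "card {y\<in>Y. d y > 2} \<le> \<eta> * card Y / (1 * \<sigma> ^ 4)"
    proof (rule count_exceptional[where a = "\<lambda>_. 1"])
      fix z assume z: "z \<in> {y\<in>Y. d y > 2}"
      have "zd * (\<Sum>x\<in>X. 1) + 1 * (zd\<^sup>2 * card X) \<le> 2 * (zd * card X)"
      proof -
        have "zd * (zd * card X) \<le> 1 * (zd * card X)" using zd by (intro mult_right_mono) auto
        then show ?thesis by (simp add: power2_eq_square mult_ac)
      qed
      also have "\<dots> \<le> d z * (zd * card X)" using z zd by (intro mult_right_mono) auto
      also have "\<dots> = (\<Sum>x\<in>X. A x z)" by (simp add: sum_A)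
      also have "\<dots> \<le> (\<Sum>x\<in>X. 1 * of_bool (x + z \<in> Z))" using A1 by (intro sum_mono) simp
      finally show "zd * (\<Sum>x\<in>X. 1) + 1 * (zd\<^sup>2 * card X) \<le> (\<Sum>x\<in>X. 1 * of_bool (x + z \<in> Z))" .
    qed auto
    then show ?thesis by simp
  qed
  have each: "card {y'\<in>Y. K y y' > 3} \<le> ?c" if y: "d y \<le> 2" for y
  proof -
    have "card {y'\<in>Y. K y y' > 3} \<le> \<eta> * card Y / (1 * \<sigma> ^ 4)"
    proof (rule count_exceptional[where a = "\<lambda>x. A x y"])
      fix z assume z: "z \<in> {y'\<in>Y. K y y' > 3}"
      have "zd * (\<Sum>x\<in>X. A x y) + 1 * (zd\<^sup>2 * card X) = (d y + 1) * (zd\<^sup>2 * card X)"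
        by (simp add: sum_A power2_eq_square algebra_simps)
      also have "\<dots> \<le> K y z * (zd\<^sup>2 * card X)" using z y zd by (intro mult_right_mono) auto
      also have "\<dots> = (\<Sum>x\<in>X. A x y * A x z)" by (simp add: sum_AA)
      also have "\<dots> \<le> (\<Sum>x\<in>X. A x y * of_bool (x + z \<in> Z))"
        using A0 A1 by (intro sum_mono mult_left_mono) auto
      finally show "zd * (\<Sum>x\<in>X. A x y) + 1 * (zd\<^sup>2 * card X) \<le> (\<Sum>x\<in>X. A x y * of_bool (x + z \<in> Z))" .
    qed (use A0 A_le1 in auto)
    then show ?thesis by simp
  qed
  have "(\<Sum>y\<in>Y. real (card {y'\<in>Y. K y y' > 3}))
      \<le> (\<Sum>y\<in>Y. ?c + (if d y > 2 then real (card Y) else 0))"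
  proof (rule sum_mono)
    fix y assume "y \<in> Y"
    have "card {y'\<in>Y. K y y' > 3} \<le> card Y" using fin by (intro card_mono) auto
    then show "real (card {y'\<in>Y. K y y' > 3}) \<le> ?c + (if d y > 2 then real (card Y) else 0)"
      using each[of y] c0 by (cases "d y > 2") (auto simp del: of_nat_le_iff simp flip: of_nat_le_iff[where 'a = real])
  qed
  also have "\<dots> = card Y * ?c + card {y\<in>Y. d y > 2} * real (card Y)"
    using fin by (simp add: sum.distrib sum.If_cases Int_def)
  also have "\<dots> \<le> card Y * ?c + ?c * card Y" using d2 by (intro add_left_mono mult_right_mono) auto
  finally show ?thesis by (simp add: power2_eq_square mult_ac)
qed

end

text \<open>Separates the levels 1.5 and 1.4 in \<open>many_large_K\<close>: one of the two units
  absorbs the codegrees above 3, the other survives as the lower bound.\<close>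

lemma power_gap:
  shows "8 \<le> k \<Longrightarrow> (1.4::real) ^ (2 * k) + 2 \<le> 1.5 ^ (2 * k)"
proof (induction k rule: dec_induct)
  case base
  show ?case by (simp add: power_divide)
next
  case (step k)
  have "(1.4::real) ^ (2 * Suc k) + 2 \<le> 1.96 * (1.4 ^ (2 * k) + 2)" by simp
  also have "\<dots> \<le> 1.96 * 1.5 ^ (2 * k)" using step by (intro mult_left_mono) auto
  also have "\<dots> \<le> 1.5 ^ (2 * Suc k)" by simp
  finally show ?case .
qed

section \<open>Moments of codegrees\<close>

context incrementless
begin

text \<open>Neighbourhoods in \<open>A\<close> are as sparse as \<open>Z\<close>, and cutting down to them would square the density of
  the sides at every step. The relative size of the sets \<open>V y'\<close> of vertices with large codegree is
  bounded below in terms of \<open>\<alpha>\<close> alone, and so is that of the level sets of \<open>\<phi> y'\<close>.\<close>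

definition V :: "'a \<Rightarrow> 'a set" where "V y' = {y\<in>Y. 1.4 * \<alpha>\<^sup>2 \<le> K y y'}"

text \<open>Column \<open>y\<close> divided by \<open>zd * d y\<close> has mean 1 over
  \<open>X\<close>, so the centred codegree is a covariance. This is the Gram form that
  \<open>gram_power_nonneg\<close> needs.\<close>

lemma normalised_codegree:
  assumes dd: "d y \<noteq> 0" "d y' \<noteq> 0"
  shows "K y y' / (d y * d y') - 1
    = (\<Sum>x\<in>X. (A x y / (zd * d y) - 1) * (A x y' / (zd * d y') - 1)) / card X"
proof -
  have "(\<Sum>x\<in>X. (A x y / (zd * d y) - 1) * (A x y' / (zd * d y') - 1))
      = (\<Sum>x\<in>X. A x y * A x y') / (zd * d y * (zd * d y'))
      - (\<Sum>x\<in>X. A x y) / (zd * d y) - (\<Sum>x\<in>X. A x y') / (zd * d y') + card X"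
    by (simp add: algebra_simps sum.distrib sum_subtractf sum_divide_distrib)
  also have "\<dots> = card X * (K y y' / (d y * d y') - 1)"
    unfolding sum_A sum_AA using dd zd by (simp add: field_simps power2_eq_square)
  finally show ?thesis using card_pos by simp
qed

text \<open>All power sums of the centred kernel \<open>h\<close> are nonnegative, so the expansion
  of \<open>(1 + h y y') ^ (2 * k)\<close> is bounded below by its middle term, whose coefficient is
  at least \<open>4 ^ k / (2 * k)\<close>. A \<open>k\<close>-th moment that is merely not small
  thus gives \<open>1 + h\<close> a norm close to 2.\<close>

lemma K_power_lower:
  assumes C1: "real k \<le> 1.08 ^ (2 * k) * (0.15 * \<alpha>)" and k: "k > 0"
    and big: "0.3 * \<alpha> * (card Y)\<^sup>2 \<le> (\<Sum>y\<in>{y\<in>Y. 0.9 * \<alpha> \<le> d y}. \<Sum>y'\<in>{y\<in>Y. 0.9 * \<alpha> \<le> d y}.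
        (K y y' / (d y * d y') - 1) ^ k)"
  shows "(1.5 * \<alpha>\<^sup>2) ^ (2 * k) * (card Y)\<^sup>2 \<le> (\<Sum>y\<in>Y. \<Sum>y'\<in>Y. K y y' ^ (2 * k))"
proof -
  define S where "S = {y\<in>Y. 0.9 * \<alpha> \<le> d y}"
  have S: "S \<subseteq> Y" "\<And>y. y \<in> S \<Longrightarrow> 0.9 * \<alpha> \<le> d y" by (auto simp: S_def)
  have dpos: "0 < d y" if "y \<in> S" for y using S(2)[OF that] alpha by simp
  define h where "h y y' = K y y' / (d y * d y') - 1" for y y'
  define g where "g x y = A x y / (zd * d y) - 1" for x y
  have gram: "h y y' = (\<Sum>x\<in>X. g x y * g x y') / card X" if "y \<in> S" "y' \<in> S" for y y'
    unfolding h_def g_def using dpos that by (intro normalised_codegree) fastforce+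
  have nn: "0 \<le> (\<Sum>y\<in>S. \<Sum>y'\<in>S. h y y' ^ j)" for j
  proof -
    have "0 \<le> (\<Sum>y\<in>S. \<Sum>y'\<in>S. 1 * 1 * ((\<Sum>x\<in>X. g x y * g x y') / card X) ^ j)"
      using gram_power_nonneg[where u = "\<lambda>_. 1" and S = S and g = g and I = X and k = j and T = "{}"] by simp
    then show ?thesis by (simp add: gram cong: sum.cong)
  qed
  have "(\<Sum>y\<in>S. \<Sum>y'\<in>S. (1 + h y y') ^ (2 * k))
      = (\<Sum>y\<in>S. \<Sum>y'\<in>S. \<Sum>j\<le>2 * k. real (2 * k choose j) * h y y' ^ j)"
    by (intro sum.cong refl) (simp add: binomial_ring add.commute[of 1])
  also have "\<dots> = (\<Sum>y\<in>S. \<Sum>j\<le>2 * k. \<Sum>y'\<in>S. real (2 * k choose j) * h y y' ^ j)"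
    by (intro sum.cong refl sum.swap)
  also have "\<dots> = (\<Sum>j\<le>2 * k. \<Sum>y\<in>S. \<Sum>y'\<in>S. real (2 * k choose j) * h y y' ^ j)"
    by (rule sum.swap)
  also have "\<dots> = (\<Sum>j\<le>2 * k. real (2 * k choose j) * (\<Sum>y\<in>S. \<Sum>y'\<in>S. h y y' ^ j))"
    by (simp add: sum_distrib_left)
  also have "\<dots> \<ge> real (2 * k choose k) * (\<Sum>y\<in>S. \<Sum>y'\<in>S. h y y' ^ k)"
    using nn by (intro member_le_sum) auto
  finally have exp: "real (2 * k choose k) * (\<Sum>y\<in>S. \<Sum>y'\<in>S. h y y' ^ k)
      \<le> (\<Sum>y\<in>S. \<Sum>y'\<in>S. (1 + h y y') ^ (2 * k))" .
  have "(1.5 * \<alpha>\<^sup>2) ^ (2 * k) * (card Y)\<^sup>2 * k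
      \<le> (1.5 * \<alpha>\<^sup>2) ^ (2 * k) * (card Y)\<^sup>2 * (1.08 ^ (2 * k) * (0.15 * \<alpha>))"
    using C1 by (intro mult_left_mono) auto
  also have "\<dots> = ((1.5 * 1.08) ^ (2 * k) * (\<alpha>\<^sup>2) ^ (2 * k)) * (0.15 * \<alpha> * (card Y)\<^sup>2)"
    by (simp only: power_mult_distrib mult_ac)
  \<comment> \<open>Here 0.81 comes from two degrees of at least \<open>0.9 * \<alpha>\<close> and 2
    from the central binomial coefficient. The surplus of 1.62 over 1.5 is the factor 1.08 that pays
    for \<open>k\<close> and \<open>0.15 * \<alpha>\<close> in \<open>C1\<close>.\<close>
  also have "(1.5 * 1.08 :: real) ^ (2 * k) = 0.81 ^ (2 * k) * 4 ^ k"
  proof -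
    have "(1.5 * 1.08 :: real) ^ (2 * k) = (0.81 * 2) ^ (2 * k)" by simp
    also have "\<dots> = 0.81 ^ (2 * k) * 2 ^ (2 * k)" by (rule power_mult_distrib)
    also have "(2::real) ^ (2 * k) = 4 ^ k" by (simp add: power_mult)
    finally show ?thesis .
  qed
  finally have "(1.5 * \<alpha>\<^sup>2) ^ (2 * k) * (card Y)\<^sup>2
      \<le> (0.81 * \<alpha>\<^sup>2) ^ (2 * k) * ((4 ^ k / (2 * k)) * (0.3 * \<alpha> * (card Y)\<^sup>2))"
    using k by (simp add: field_simps power_mult_distrib)
  also have "\<dots> \<le> (0.81 * \<alpha>\<^sup>2) ^ (2 * k) * (real (2 * k choose k) * (\<Sum>y\<in>S. \<Sum>y'\<in>S. h y y' ^ k))"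
    using big central_binomial_lower_bound[OF k] alpha unfolding S_def h_def
    by (intro mult_left_mono mult_mono) auto
  also have "\<dots> \<le> (0.81 * \<alpha>\<^sup>2) ^ (2 * k) * (\<Sum>y\<in>S. \<Sum>y'\<in>S. (1 + h y y') ^ (2 * k))"
    using exp by (intro mult_left_mono) auto
  also have "\<dots> \<le> (\<Sum>y\<in>S. \<Sum>y'\<in>S. K y y' ^ (2 * k))"
    unfolding sum_distrib_left
  proof (intro sum_mono)
    fix y y' assume y: "y \<in> S" "y' \<in> S"
    have "(0.9 * \<alpha>) * (0.9 * \<alpha>) \<le> d y * d y'"
      using S(2) y alpha by (intro mult_mono) (auto intro: d_nonneg)
    then have dd: "0.81 * \<alpha>\<^sup>2 \<le> d y * d y'" by (simp add: power2_eq_square)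
    have "(0.81 * \<alpha>\<^sup>2) * (1 + h y y') \<le> (d y * d y') * (1 + h y y')"
      using dd K_nonneg d_nonneg by (intro mult_right_mono) (auto simp: h_def)
    also have "\<dots> = K y y'" using dpos[OF y(1)] dpos[OF y(2)] by (simp add: h_def)
    finally have "((0.81 * \<alpha>\<^sup>2) * (1 + h y y')) ^ (2 * k) \<le> K y y' ^ (2 * k)"
      using K_nonneg d_nonneg by (intro power_mono) (auto simp: h_def)
    then show "(0.81 * \<alpha>\<^sup>2) ^ (2 * k) * (1 + h y y') ^ (2 * k) \<le> K y y' ^ (2 * k)"
      by (simp only: power_mult_distrib)
  qed
  also have "\<dots> \<le> (\<Sum>y\<in>Y. \<Sum>y'\<in>Y. K y y' ^ (2 * k))"
  proof -
    have "(\<Sum>y\<in>S. \<Sum>y'\<in>S. K y y' ^ (2 * k)) \<le> (\<Sum>y\<in>S. \<Sum>y'\<in>Y. K y y' ^ (2 * k))"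
      using S(1) fin K_nonneg by (intro sum_mono sum_mono2) auto
    also have "\<dots> \<le> (\<Sum>y\<in>Y. \<Sum>y'\<in>Y. K y y' ^ (2 * k))"
      using S(1) fin K_nonneg by (intro sum_mono2 sum_nonneg) auto
    finally show ?thesis .
  qed
  finally show ?thesis .
qed

text \<open>The moment is truncated at \<open>1.4 * \<alpha>\<^sup>2\<close> and at 3. Smaller
  values contribute too little; values above 3 are rare, so the trivial bound \<open>K_le\<close>
  suffices for them. What remains is at most \<open>3 ^ (2 * k)\<close> per pair, so the proportion
  of such pairs is bounded below without any dependence on \<open>\<sigma>\<close>.\<close>

lemma many_large_K:
  assumes k: "8 \<le> k" and C2: "2 * \<eta> \<le> \<sigma> ^ (4 * k + 4) * \<alpha> ^ (4 * k)"
    and big: "(1.5 * \<alpha>\<^sup>2) ^ (2 * k) * (card Y)\<^sup>2 \<le> (\<Sum>y\<in>Y. \<Sum>y'\<in>Y. K y y' ^ (2 * k))"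
  shows "(\<alpha>\<^sup>2 / 3) ^ (2 * k) * (card Y)\<^sup>2 \<le> (\<Sum>y'\<in>Y. real (card (V y')))"
proof -
  define c where "c = (1.4 * \<alpha>\<^sup>2) ^ (2 * k)"
  define s where "s = (1 / \<sigma>\<^sup>2) ^ (2 * k)"
  have cs: "c \<ge> 0" "s \<ge> 0" by (auto simp: c_def s_def)
  have pt: "K y y' ^ (2 * k) \<le> c + 3 ^ (2 * k) * of_bool (1.4 * \<alpha>\<^sup>2 \<le> K y y') + s * of_bool (K y y' > 3)"
    for y y'
  proof (cases "K y y' > 3")
    case True
    have "K y y' ^ (2 * k) \<le> s" unfolding s_def using K_le K_nonneg by (intro power_mono) auto
    then show ?thesis using True cs by (simp add: add_increasing)
  next
    case False
    show ?thesis
    proof (cases "1.4 * \<alpha>\<^sup>2 \<le> K y y'")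
      case True
      have "K y y' ^ (2 * k) \<le> 3 ^ (2 * k)" using False K_nonneg by (intro power_mono) auto
      then show ?thesis using True cs by (simp add: add_increasing)
    next
      case 2: False
      have "K y y' ^ (2 * k) \<le> c" unfolding c_def using 2 K_nonneg by (intro power_mono) auto
      then show ?thesis using 2 cs by (simp add: add_increasing2)
    qed
  qed
  have ind: "(\<Sum>y'\<in>Y. of_bool (P y')) = real (card {y'\<in>Y. P y'})" for P
    using fin by (simp add: of_bool_def sum.If_cases Int_def)
  have "(1.5 * \<alpha>\<^sup>2) ^ (2 * k) * (card Y)\<^sup>2
      \<le> (\<Sum>y\<in>Y. \<Sum>y'\<in>Y. c + 3 ^ (2 * k) * of_bool (1.4 * \<alpha>\<^sup>2 \<le> K y y') + s * of_bool (K y y' > 3))"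
    using pt by (intro order_trans[OF big] sum_mono) auto
  also have "\<dots> = c * (card Y)\<^sup>2 + 3 ^ (2 * k) * (\<Sum>y'\<in>Y. real (card (V y')))
      + s * (\<Sum>y\<in>Y. real (card {y'\<in>Y. K y y' > 3}))"
    unfolding V_def sum.distrib sum_distrib_left[symmetric] ind
    using K_sym by (simp add: power2_eq_square)
  also have "\<dots> \<le> c * (card Y)\<^sup>2 + 3 ^ (2 * k) * (\<Sum>y'\<in>Y. real (card (V y')))
      + s * (2 * \<eta> / \<sigma> ^ 4 * (card Y)\<^sup>2)"
    using card_large_K cs by (intro add_left_mono mult_left_mono) auto
  finally have 1: "((1.5 * \<alpha>\<^sup>2) ^ (2 * k) - c - s * (2 * \<eta> / \<sigma> ^ 4)) * (card Y)\<^sup>2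
      \<le> 3 ^ (2 * k) * (\<Sum>y'\<in>Y. real (card (V y')))"
    by (simp add: algebra_simps)
  have "s * (2 * \<eta> / \<sigma> ^ 4) = 2 * \<eta> / \<sigma> ^ (4 * k + 4)"
    by (simp add: s_def power_add power_divide power_mult[symmetric] mult.commute)
  also have "\<dots> \<le> \<alpha> ^ (4 * k)" using C2 sigma(1) by (simp add: pos_divide_le_eq mult.commute)
  finally have s: "s * (2 * \<eta> / \<sigma> ^ 4) \<le> \<alpha> ^ (4 * k)" .
  have a: "(\<alpha>\<^sup>2) ^ (2 * k) = \<alpha> ^ (4 * k)" by (simp add: power_mult[symmetric])
  have "(1.4 ^ (2 * k) + 2) * \<alpha> ^ (4 * k) \<le> 1.5 ^ (2 * k) * \<alpha> ^ (4 * k)"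
    using power_gap[OF k] alpha by (intro mult_right_mono) auto
  then have "\<alpha> ^ (4 * k) \<le> (1.5 * \<alpha>\<^sup>2) ^ (2 * k) - c - s * (2 * \<eta> / \<sigma> ^ 4)"
    using s unfolding c_def power_mult_distrib a by (simp only: distrib_right)
  then have "\<alpha> ^ (4 * k) * (card Y)\<^sup>2 \<le> 3 ^ (2 * k) * (\<Sum>y'\<in>Y. real (card (V y')))"
    by (intro order_trans[OF mult_right_mono 1]) auto
  then show ?thesis
    unfolding power_divide a by (simp add: pos_divide_le_eq mult.commute)
qed

end

section \<open>Sifting\<close>

context incrementless
begin

definition \<phi> :: "'a \<Rightarrow> 'a \<Rightarrow> real" where
  "\<phi> y' x = (\<Sum>y\<in>V y'. A x y) / (zd * card (V y'))"

lemma V_sub: "V y' \<subseteq> Y" "finite (V y')"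
  using fin by (auto simp: V_def)

lemma phi_nonneg: "0 \<le> \<phi> y' x"
  using A0 zd by (auto simp: \<phi>_def intro!: divide_nonneg_nonneg sum_nonneg)

lemma phi_le: "\<phi> y' x \<le> 1 / \<sigma>"
proof (cases "card (V y') = 0")
  case True
  then show ?thesis using sigma(1) by (simp add: \<phi>_def)
next
  case False
  have "(\<Sum>y\<in>V y'. A x y) \<le> card (V y')" using A_le1 sum_bounded_above[of "V y'" "A x" 1] by simp
  then have "\<phi> y' x \<le> card (V y') / (zd * card (V y'))"
    unfolding \<phi>_def using zd by (intro divide_right_mono) auto
  also have "\<dots> = 1 / zd" using False by simp
  also have "\<dots> \<le> 1 / \<sigma>" using zd sigma(1) by (intro divide_left_mono) auto
  finally show ?thesis .
qed

text \<open>Exchanging summations turns the right-hand side into the average of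
  \<open>K y y'\<close> over \<open>y\<close> in \<open>V y'\<close>, up to normalisation.\<close>

lemma correlation_with_phi:
  assumes "V y' \<noteq> {}"
  shows "1.4 * \<alpha>\<^sup>2 * (zd * card X) \<le> (\<Sum>x\<in>X. A x y' * \<phi> y' x)"
proof -
  have c: "real (card (V y')) > 0" using assms V_sub by (simp add: card_gt_0_iff)
  have "(\<Sum>x\<in>X. A x y' * \<phi> y' x) = (\<Sum>x\<in>X. \<Sum>y\<in>V y'. A x y * A x y') / (zd * card (V y'))"
    by (simp add: \<phi>_def sum_distrib_left sum_divide_distrib mult_ac)
  also have "(\<Sum>x\<in>X. \<Sum>y\<in>V y'. A x y * A x y') = (\<Sum>y\<in>V y'. K y y' * (zd\<^sup>2 * card X))"
    by (subst sum.swap) (simp add: sum_AA)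
  finally have "(\<Sum>x\<in>X. A x y' * \<phi> y' x)
      = (\<Sum>y\<in>V y'. K y y' * (zd\<^sup>2 * card X)) / (zd * card (V y'))" .
  moreover have "(\<Sum>y\<in>V y'. 1.4 * \<alpha>\<^sup>2 * (zd\<^sup>2 * card X)) / (zd * card (V y'))
      \<le> (\<Sum>y\<in>V y'. K y y' * (zd\<^sup>2 * card X)) / (zd * card (V y'))"
    using zd by (intro divide_right_mono sum_mono mult_right_mono) (auto simp: V_def)
  moreover have "(\<Sum>y\<in>V y'. 1.4 * \<alpha>\<^sup>2 * (zd\<^sup>2 * card X)) / (zd * card (V y')) = 1.4 * \<alpha>\<^sup>2 * (zd * card X)"
    using zd c by (simp add: power2_eq_square field_simps)
  ultimately show ?thesis by (simp only:)
qed

text \<open>The edges at \<open>y'\<close> have normalised weight at most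
  \<open>1.01 * \<alpha>\<close>, so along them the mean of \<open>\<phi> y'\<close> is at least 1.4
  / 1.01 times \<open>\<alpha>\<close>, above \<open>1.3 * \<alpha>\<close>; the constant is 0.087 =
  1.4 - 1.3 * 1.01. Replacing these edges by all edges of \<open>Z\<close> loses about a factor
  \<open>\<alpha>\<close>, which is harmless after a high power has been taken.\<close>

lemma moment_along_edges:
  assumes "V y' \<noteq> {}" "d y' \<le> 1.01 * \<alpha>"
  shows "(1.3 * \<alpha>) ^ j * (0.087 * \<alpha>\<^sup>2 * (zd * card X))
    \<le> (\<Sum>x\<in>X. of_bool (x + y' \<in> Z) * \<phi> y' x ^ Suc j)"
proof -
  have pt: "(1.3 * \<alpha>) ^ j * (\<phi> y' x - 1.3 * \<alpha>) \<le> \<phi> y' x ^ Suc j" for x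
  proof (cases "1.3 * \<alpha> \<le> \<phi> y' x")
    case True
    have "(1.3 * \<alpha>) ^ j * (\<phi> y' x - 1.3 * \<alpha>) \<le> \<phi> y' x ^ j * \<phi> y' x"
      using True alpha phi_nonneg by (intro mult_mono power_mono) auto
    then show ?thesis by (simp add: mult.commute)
  next
    case False
    then have "(1.3 * \<alpha>) ^ j * (\<phi> y' x - 1.3 * \<alpha>) \<le> 0"
      using alpha by (intro mult_nonneg_nonpos) auto
    also have "0 \<le> \<phi> y' x ^ Suc j" using phi_nonneg by simp
    finally show ?thesis .
  qed
  have "(\<Sum>x\<in>X. A x y') \<le> 1.01 * \<alpha> * (zd * card X)"
    unfolding sum_A using assms zd by (intro mult_right_mono) auto
  then have "1.3 * \<alpha> * (\<Sum>x\<in>X. A x y') \<le> 1.3 * \<alpha> * (1.01 * \<alpha> * (zd * card X))"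
    using alpha by (intro mult_left_mono) auto
  also have "\<dots> = 1.313 * (\<alpha>\<^sup>2 * (zd * card X))" by (simp add: power2_eq_square)
  finally have "1.3 * \<alpha> * (\<Sum>x\<in>X. A x y') \<le> 1.313 * (\<alpha>\<^sup>2 * (zd * card X))" .
  moreover have "1.4 * (\<alpha>\<^sup>2 * (zd * card X)) \<le> (\<Sum>x\<in>X. A x y' * \<phi> y' x)"
    using correlation_with_phi[OF assms(1)] by (simp only: mult.assoc)
  ultimately have "0.087 * (\<alpha>\<^sup>2 * (zd * card X))
      \<le> (\<Sum>x\<in>X. A x y' * \<phi> y' x) - 1.3 * \<alpha> * (\<Sum>x\<in>X. A x y')"
  proof -
    have "1.3 * (\<alpha> * s) \<le> 1.313 * p \<Longrightarrow> 1.4 * p \<le> q \<Longrightarrow> 0.087 * p \<le> q - 1.3 * (\<alpha> * s)"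
      for p q s :: real by simp
    then show "1.3 * \<alpha> * (\<Sum>x\<in>X. A x y') \<le> 1.313 * (\<alpha>\<^sup>2 * (zd * card X)) \<Longrightarrow>
      1.4 * (\<alpha>\<^sup>2 * (zd * card X)) \<le> (\<Sum>x\<in>X. A x y' * \<phi> y' x) \<Longrightarrow> ?thesis"
      by (simp only: mult.assoc)
  qed
  then have "0.087 * \<alpha>\<^sup>2 * (zd * card X) \<le> (\<Sum>x\<in>X. A x y' * \<phi> y' x) - 1.3 * \<alpha> * (\<Sum>x\<in>X. A x y')"
    by (simp only: mult.assoc)
  also have "\<dots> = (\<Sum>x\<in>X. A x y' * (\<phi> y' x - 1.3 * \<alpha>))"
    by (simp add: sum_distrib_left sum_subtractf right_diff_distrib mult_ac)
  finally have "(1.3 * \<alpha>) ^ j * (0.087 * \<alpha>\<^sup>2 * (zd * card X))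
      \<le> (1.3 * \<alpha>) ^ j * (\<Sum>x\<in>X. A x y' * (\<phi> y' x - 1.3 * \<alpha>))"
    using alpha by (intro mult_left_mono) auto
  also have "\<dots> = (\<Sum>x\<in>X. A x y' * ((1.3 * \<alpha>) ^ j * (\<phi> y' x - 1.3 * \<alpha>)))"
    by (simp add: sum_distrib_left mult_ac)
  also have "\<dots> \<le> (\<Sum>x\<in>X. A x y' * \<phi> y' x ^ Suc j)"
    using A0 pt by (intro sum_mono mult_left_mono) auto
  also have "\<dots> \<le> (\<Sum>x\<in>X. of_bool (x + y' \<in> Z) * \<phi> y' x ^ Suc j)"
    using A1 phi_nonneg by (intro sum_mono mult_right_mono) auto
  finally show ?thesis .
qed

text \<open>The exceptional count with the sides exchanged: \<open>V y'\<close> is now the weighted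
  side, and its size enters the error as 1 / \<open>r\<close>.\<close>

lemma card_large_phi:
  assumes r: "0 < r" and Vr: "r / 2 * card Y \<le> card (V y')"
  shows "card {x\<in>X. \<phi> y' x > 2} \<le> 2 * \<eta> / (\<sigma> ^ 3 * r) * card X"
proof -
  let ?T = "{x\<in>X. \<phi> y' x > 2}"
  have c: "real (card (V y')) > 0" using Vr r card_pos by (smt (verit) half_gt_zero mult_pos_pos)
  have "card ?T * (zd * card (V y')) \<le> \<eta> * N\<^sup>2"
  proof (rule uniform_exceptional[OF U W, where S = "V y'" and a = "\<lambda>_. 1"])
    fix x assume x: "x \<in> ?T"
    have "zd * (\<Sum>y\<in>V y'. 1) + zd * card (V y') = 2 * (zd * card (V y'))" by simp
    also have "\<dots> \<le> \<phi> y' x * (zd * card (V y'))" using x zd by (intro mult_right_mono) auto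
    also have "\<dots> = (\<Sum>y\<in>V y'. A x y)" using zd c by (simp add: \<phi>_def)
    also have "\<dots> \<le> (\<Sum>y\<in>V y'. 1 * of_bool (y + x \<in> Z))"
    proof (rule sum_mono)
      fix y show "A x y \<le> 1 * of_bool (y + x \<in> Z)" using A1[of x y] by (simp add: add.commute)
    qed
    finally show "zd * (\<Sum>y\<in>V y'. 1) + zd * card (V y') \<le> (\<Sum>y\<in>V y'. 1 * of_bool (y + x \<in> Z))" .
  qed (use V_sub(1)[of y'] sub in auto)
  moreover have "\<sigma> * (r / 2 * (\<sigma> * N)) \<le> zd * card (V y')"
  proof (intro mult_mono)
    show "r / 2 * (\<sigma> * N) \<le> card (V y')"
      using Vr card_bounds(2) r by (meson half_gt_zero less_imp_le mult_left_mono order_trans)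
  qed (use zd sigma(1) r in auto)
  ultimately have "card ?T * (\<sigma> * (r / 2 * (\<sigma> * N))) \<le> \<eta> * N\<^sup>2"
    by (meson mult_left_mono of_nat_0_le_iff order_trans)
  then have "(card ?T * (\<sigma>\<^sup>2 * r)) * N \<le> (2 * \<eta> * N) * N"
    by (simp add: power2_eq_square mult_ac)
  then have "card ?T * (\<sigma>\<^sup>2 * r) \<le> 2 * \<eta> * N" using N_pos by (simp only: mult_le_cancel_right_pos)
  then have "card ?T * (\<sigma>\<^sup>2 * r) * \<sigma> \<le> 2 * \<eta> * N * \<sigma>" using sigma(1) by (intro mult_right_mono) auto
  also have "\<dots> = 2 * \<eta> * (\<sigma> * N)" by simp
  also have "\<dots> \<le> 2 * \<eta> * card X" using card_bounds eta by (intro mult_left_mono) auto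
  finally show ?thesis
    using sigma(1) r by (simp add: pos_le_divide_eq mult_ac power2_eq_square power3_eq_cube)
qed

text \<open>The three-level truncation of \<open>many_large_K\<close> again, at
  \<open>1.2 * \<alpha>\<close> and 2, with \<open>phi_le\<close> above 2.\<close>

lemma moment_upper:
  assumes r: "0 < r" and Vr: "r / 2 * card Y \<le> card (V y')"
    and C5b: "2 * \<eta> \<le> \<alpha> ^ m * \<sigma> ^ (m + 3) * r"
  shows "(\<Sum>x\<in>X. \<phi> y' x ^ m) \<le> (1.2 * \<alpha>) ^ m * card X
    + 2 ^ m * real (card {x\<in>X. 1.2 * \<alpha> \<le> \<phi> y' x}) + \<alpha> ^ m * card X"
proof -
  define c s where "c = (1.2 * \<alpha>) ^ m" and "s = (1 / \<sigma>) ^ m"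
  have cs: "c \<ge> 0" "s \<ge> 0" using alpha sigma(1) by (auto simp: c_def s_def)
  have pt: "\<phi> y' x ^ m \<le> c + 2 ^ m * of_bool (1.2 * \<alpha> \<le> \<phi> y' x) + s * of_bool (\<phi> y' x > 2)" for x
  proof (cases "\<phi> y' x > 2")
    case True
    have "\<phi> y' x ^ m \<le> s" unfolding s_def using phi_le phi_nonneg by (intro power_mono) auto
    then show ?thesis using True cs by (simp add: add_increasing)
  next
    case False
    show ?thesis
    proof (cases "1.2 * \<alpha> \<le> \<phi> y' x")
      case True
      have "\<phi> y' x ^ m \<le> 2 ^ m" using False phi_nonneg by (intro power_mono) auto
      then show ?thesis using True cs by (simp add: add_increasing)
    next
      case 2: False
      have "\<phi> y' x ^ m \<le> c" unfolding c_def using 2 phi_nonneg by (intro power_mono) auto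
      then show ?thesis using 2 cs by (simp add: add_increasing2)
    qed
  qed
  have ind: "(\<Sum>x\<in>X. of_bool (P x)) = real (card {x\<in>X. P x})" for P
    using fin by (simp add: of_bool_def sum.If_cases Int_def)
  have "(\<Sum>x\<in>X. \<phi> y' x ^ m)
      \<le> (\<Sum>x\<in>X. c + 2 ^ m * of_bool (1.2 * \<alpha> \<le> \<phi> y' x) + s * of_bool (\<phi> y' x > 2))"
    using pt by (rule sum_mono)
  also have "\<dots> = c * card X + 2 ^ m * real (card {x\<in>X. 1.2 * \<alpha> \<le> \<phi> y' x}) + s * card {x\<in>X. \<phi> y' x > 2}"
    unfolding sum.distrib sum_distrib_left[symmetric] ind by simp
  also have "\<dots> \<le> c * card X + 2 ^ m * real (card {x\<in>X. 1.2 * \<alpha> \<le> \<phi> y' x}) + s * (2 * \<eta> / (\<sigma> ^ 3 * r) * card X)"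
    using card_large_phi[OF r Vr] cs by (intro add_left_mono mult_left_mono) auto
  also have "s * (2 * \<eta> / (\<sigma> ^ 3 * r) * card X) = 2 * \<eta> / (\<sigma> ^ (m + 3) * r) * card X"
    by (simp add: s_def power_add power_divide)
  also have "\<dots> \<le> \<alpha> ^ m * card X"
    using C5b sigma(1) r by (intro mult_right_mono) (auto simp: pos_divide_le_eq mult_ac)
  finally show ?thesis by (simp add: c_def)
qed

text \<open>The edges at \<open>y'\<close> see a large value of \<open>\<phi> y'\<close> on average. Taking a high moment, which uniformity of
  \<open>Z\<close> transfers from the edges at \<open>y'\<close> to all of \<open>X\<close>, shows that \<open>\<phi> y'\<close> is large on a set \<open>T\<close> that is
  not too small, and then \<open>T \<times> V y'\<close> is a density increment.\<close>

lemma sift: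
  fixes k j :: nat
  defines "r \<equiv> (\<alpha>\<^sup>2 / 3) ^ (2 * k)"
  assumes k: "8 \<le> k" and C1: "real k \<le> 1.08 ^ (2 * k) * (0.15 * \<alpha>)"
    and C2: "2 * \<eta> \<le> \<sigma> ^ (4 * k + 4) * \<alpha> ^ (4 * k)"
    and C3: "\<rho> \<le> r / 4"
    and C4: "\<eta> * (2 / (\<sigma> * r)) ^ Suc j \<le> 0.001 * \<alpha> ^ (j + 2) * \<sigma> ^ 3 * r"
    and C5a: "1.2 ^ Suc j + 2 \<le> 1.3 ^ j * (0.08 * \<alpha>)"
    and C5b: "2 * \<eta> \<le> \<alpha> ^ Suc j * \<sigma> ^ (Suc j + 3) * r"
    and C5c: "\<rho> * 2 ^ Suc j \<le> \<alpha> ^ Suc j"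
  shows "(\<Sum>y\<in>{y\<in>Y. 0.9 * \<alpha> \<le> d y}. \<Sum>y'\<in>{y\<in>Y. 0.9 * \<alpha> \<le> d y}.
        (K y y' / (d y * d y') - 1) ^ k) < 0.3 * \<alpha> * (card Y)\<^sup>2"
proof (rule ccontr)
  assume "\<not> ?thesis"
  then have sumV: "r * (card Y)\<^sup>2 \<le> (\<Sum>y'\<in>Y. real (card (V y')))"
    unfolding r_def using k by (intro many_large_K k C2 K_power_lower C1) auto
  have r: "r > 0" using alpha by (simp add: r_def)
  \<comment> \<open>By averaging, \<open>V y'\<close> has relative size at least
    \<open>r / 2\<close> for a proportion at least \<open>r / 2\<close> of the \<open>y'\<close>,
    and high degrees remove at most \<open>r / 4\<close>. Many \<open>y'\<close> are needed because
    uniformity of \<open>Z\<close> transfers an average over \<open>y'\<close>, not the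
    neighbourhood of a single one.\<close>
  define Y2 where "Y2 = {y'\<in>Y. r / 2 * card Y \<le> card (V y') \<and> d y' < 1.01 * \<alpha>}"
  have Y2: "Y2 \<subseteq> Y" "finite Y2" using fin by (auto simp: Y2_def)
  have Y2_card: "r / 4 * card Y \<le> card Y2"
  proof -
    let ?P = "{y'\<in>Y. r / 2 * card Y \<le> card (V y')}" and ?Q = "{y\<in>Y. 1.01 * \<alpha> \<le> d y}"
    have "(\<Sum>y'\<in>Y. real (card (V y'))) \<le> (\<Sum>y'\<in>Y. r / 2 * card Y + real (card Y) * of_bool (r / 2 * card Y \<le> card (V y')))"
    proof (rule sum_mono)
      fix y' assume "y' \<in> Y"
      have "real (card (V y')) \<le> card Y" using V_sub fin by (simp add: card_mono)
      then show "real (card (V y')) \<le> r / 2 * card Y + real (card Y) * of_bool (r / 2 * card Y \<le> card (V y'))"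
        using r by (auto simp: add_increasing)
    qed
    also have "\<dots> = card Y * (r / 2 * card Y) + real (card Y) * card ?P"
    proof -
      have ind: "(\<Sum>x\<in>Y. of_bool (P x)) = real (card {x\<in>Y. P x})" for P
        using fin by (simp add: of_bool_def sum.If_cases Int_def)
      show ?thesis
        unfolding sum.distrib sum_distrib_left[symmetric] ind by (simp only: sum_constant mult_ac)
    qed
    finally have "card Y * (r * card Y) \<le> card Y * (r / 2 * card Y + card ?P)"
      using sumV by (simp add: power2_eq_square algebra_simps)
    then have "r / 2 * card Y \<le> card ?P" using card_pos by (simp add: mult_le_cancel_left)
    moreover have "card ?P \<le> card Y2 + card ?Q"
    proof -
      have "?P \<subseteq> Y2 \<union> ?Q" by (auto simp: Y2_def)
      then have "card ?P \<le> card (Y2 \<union> ?Q)" using Y2 fin by (intro card_mono) auto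
      also have "\<dots> \<le> card Y2 + card ?Q" by (rule card_Un_le)
      finally show ?thesis .
    qed
    moreover have "card ?Q \<le> r / 4 * card Y"
      using card_high_degree C3 card_pos by (smt (verit) mult_right_mono)
    ultimately show ?thesis by linarith
  qed
  have Vr: "r / 2 * card Y \<le> card (V y')" "d y' \<le> 1.01 * \<alpha>" "V y' \<noteq> {}" if "y' \<in> Y2" for y'
  proof -
    show *: "r / 2 * card Y \<le> card (V y')" "d y' \<le> 1.01 * \<alpha>" using that by (auto simp: Y2_def)
    have "0 < r / 2 * card Y" using r card_pos by simp
    then show "V y' \<noteq> {}" using *(1) by auto
  qed
  define M where "M = (1.3 * \<alpha>) ^ j * \<alpha>\<^sup>2 * (zd * card X)"
  have M0: "M \<ge> 0" using alpha zd by (simp add: M_def)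
  have "card Y2 * (0.087 * M) = (\<Sum>y'\<in>Y2. (1.3 * \<alpha>) ^ j * (0.087 * \<alpha>\<^sup>2 * (zd * card X)))"
    by (simp add: M_def)
  also have "\<dots> \<le> (\<Sum>y'\<in>Y2. \<Sum>x\<in>X. of_bool (x + y' \<in> Z) * \<phi> y' x ^ Suc j)"
    using moment_along_edges Vr by (intro sum_mono) blast
  also have "\<dots> = (\<Sum>x\<in>X. \<Sum>y'\<in>Y2. of_bool (x + y' \<in> Z) * \<phi> y' x ^ Suc j)" by (rule sum.swap)
  also have "\<dots> = (\<Sum>x\<in>X. \<Sum>y'\<in>Y2. (of_bool (x + y' \<in> Z) - zd) * 1 * 1 * \<phi> y' x ^ Suc j)
      + zd * (\<Sum>x\<in>X. \<Sum>y'\<in>Y2. \<phi> y' x ^ Suc j)"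
    by (simp add: algebra_simps sum_subtractf sum_distrib_left)
  also have "\<dots> \<le> \<eta> * N\<^sup>2 * (2 / (\<sigma> * r)) ^ Suc j + zd * (\<Sum>x\<in>X. \<Sum>y'\<in>Y2. \<phi> y' x ^ Suc j)"
  proof -
    \<comment> \<open>This writes \<open>\<phi>\<close> as an average over \<open>y\<close> of a
      function of \<open>x\<close> times a function of \<open>y'\<close>, the form that
      \<open>uniform_kernel_power\<close> requires. The lower bound on \<open>card (V y')\<close>
      bounds the second function by \<open>2 / (\<sigma> * r)\<close>.\<close>
    define h where "h y y' = card Y * of_bool (y \<in> V y') / (zd * card (V y'))" for y y'
    have ker: "\<phi> y' x = (\<Sum>y\<in>Y. A x y * h y y') / card Y" for x y'
    proof -
      have "(\<Sum>y\<in>Y. A x y * h y y') = (\<Sum>y\<in>Y. if y \<in> V y' then A x y * (card Y / (zd * card (V y'))) else 0)"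
        by (intro sum.cong) (auto simp: h_def)
      also have "\<dots> = (\<Sum>y\<in>V y'. A x y) * (card Y / (zd * card (V y')))"
        using V_sub fin by (simp add: sum.inter_restrict[symmetric] Int_absorb1 sum_distrib_right sum_divide_distrib)
      finally show ?thesis using card_pos by (simp add: \<phi>_def)
    qed
    have "\<bar>\<Sum>x\<in>X. \<Sum>y'\<in>Y2. (of_bool (x + y' \<in> Z) - zd) * 1 * 1 * ((\<Sum>y\<in>Y. A x y * h y y') / card Y) ^ Suc j\<bar>
        \<le> \<eta> * N\<^sup>2 * (1 * 1) * (1 * (2 / (\<sigma> * r))) ^ Suc j"
    proof (intro uniform_kernel_power[where g = "\<lambda>y x. A x y", OF U W])
      show "X \<subseteq> W" "Y2 \<subseteq> W" using sub Y2 by auto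
      fix y y' assume y: "y \<in> Y" "y' \<in> Y2"
      have "\<sigma> * (r / 2 * card Y) \<le> zd * card (V y')"
        using Vr[OF y(2)] zd sigma(1) r by (intro mult_mono) auto
      moreover have "0 < \<sigma> * (r / 2 * card Y)" using sigma(1) r card_pos by simp
      ultimately have "h y y' \<le> card Y / (\<sigma> * (r / 2 * card Y))"
        unfolding h_def by (intro frac_le) auto
      also have "\<dots> = 2 / (\<sigma> * r)" using card_pos by simp
      finally show "\<bar>h y y'\<bar> \<le> 2 / (\<sigma> * r)" using zd by (simp add: h_def)
    qed (use A0 A_le1 sigma(1) r in auto)
    then show ?thesis unfolding ker by simp
  qed
  also have "\<eta> * N\<^sup>2 * (2 / (\<sigma> * r)) ^ Suc j \<le> card Y2 * (0.007 * M)"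
  proof -
    have "\<eta> * N\<^sup>2 * (2 / (\<sigma> * r)) ^ Suc j = (\<eta> * (2 / (\<sigma> * r)) ^ Suc j) * N\<^sup>2" by simp
    also have "\<dots> \<le> (0.001 * \<alpha> ^ (j + 2) * \<sigma> ^ 3 * r) * N\<^sup>2" using C4 by (intro mult_right_mono) auto
    also have "\<dots> = (0.004 * \<alpha> ^ (j + 2)) * ((r / 4 * (\<sigma> * N)) * (\<sigma> * (\<sigma> * N)))"
      by (simp add: power2_eq_square power3_eq_cube)
    also have "\<dots> \<le> (0.007 * (1.3 ^ j * \<alpha> ^ (j + 2))) * (card Y2 * (zd * card X))"
    proof (rule mult_mono)
      have "1 * \<alpha> ^ (j + 2) \<le> 1.3 ^ j * \<alpha> ^ (j + 2)"
        using alpha by (intro mult_right_mono one_le_power) auto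
      moreover have "0 \<le> \<alpha> ^ (j + 2)" using alpha by simp
      ultimately show "0.004 * \<alpha> ^ (j + 2) \<le> 0.007 * (1.3 ^ j * \<alpha> ^ (j + 2))" by simp
      have "r / 4 * (\<sigma> * N) \<le> r / 4 * card Y" using card_bounds r by (intro mult_left_mono) auto
      then have "r / 4 * (\<sigma> * N) \<le> card Y2" using Y2_card by linarith
      then show "(r / 4 * (\<sigma> * N)) * (\<sigma> * (\<sigma> * N)) \<le> card Y2 * (zd * card X)"
        using zd card_bounds sigma(1) by (intro mult_mono) auto
    qed (use zd card_bounds sigma(1) r alpha N_pos in auto)
    also have "\<dots> = card Y2 * (0.007 * M)"
      unfolding M_def power_mult_distrib power_add by (simp only: mult_ac)
    finally show ?thesis .
  qed
  finally have "card Y2 * (0.08 * M) \<le> zd * (\<Sum>x\<in>X. \<Sum>y'\<in>Y2. \<phi> y' x ^ Suc j)"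
    by (simp add: mult_ac)
  also have "\<dots> = (\<Sum>y'\<in>Y2. zd * (\<Sum>x\<in>X. \<phi> y' x ^ Suc j))"
    by (subst sum.swap) (simp add: sum_distrib_left)
  finally have avg: "(\<Sum>y'\<in>Y2. 0.08 * M) \<le> (\<Sum>y'\<in>Y2. zd * (\<Sum>x\<in>X. \<phi> y' x ^ Suc j))" by simp
  have "Y2 \<noteq> {}"
  proof
    assume "Y2 = {}"
    moreover have "0 < r / 4 * card Y" using r card_pos by simp
    ultimately show False using Y2_card by simp
  qed
  then obtain y' where y': "y' \<in> Y2" "0.08 * M \<le> zd * (\<Sum>x\<in>X. \<phi> y' x ^ Suc j)"
    using avg sum_strict_mono[OF Y2(2), of "\<lambda>y'. zd * (\<Sum>x\<in>X. \<phi> y' x ^ Suc j)" "\<lambda>_. 0.08 * M"]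
    by (meson not_le)
  \<comment> \<open>The level 1.2 is below 1.3, so \<open>C5a\<close> makes the moment below it
    negligible and \<open>T\<close> cannot be small, and above 1.01, so \<open>T\<close> and
    \<open>V y'\<close> contradict \<open>no_increment\<close>.\<close>
  define T where "T = {x\<in>X. 1.2 * \<alpha> \<le> \<phi> y' x}"
  have "zd * (0.08 * ((1.3 * \<alpha>) ^ j * \<alpha>\<^sup>2 * card X)) \<le> zd * (\<Sum>x\<in>X. \<phi> y' x ^ Suc j)"
    using y'(2) by (simp add: M_def mult_ac)
  then have "0.08 * ((1.3 * \<alpha>) ^ j * \<alpha>\<^sup>2 * card X) \<le> (\<Sum>x\<in>X. \<phi> y' x ^ Suc j)"
    using zd by (simp only: mult_le_cancel_left_pos)
  also have "\<dots> \<le> (1.2 * \<alpha>) ^ Suc j * card X + 2 ^ Suc j * real (card T) + \<alpha> ^ Suc j * card X"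
    unfolding T_def by (rule moment_upper[OF r Vr(1)[OF y'(1)] C5b])
  finally have 0: "0.08 * ((1.3 * \<alpha>) ^ j * \<alpha>\<^sup>2 * card X)
      \<le> (1.2 * \<alpha>) ^ Suc j * card X + 2 ^ Suc j * real (card T) + \<alpha> ^ Suc j * card X" .
  have e1: "0.08 * ((1.3 * \<alpha>) ^ j * \<alpha>\<^sup>2 * card X) = 1.3 ^ j * (0.08 * \<alpha>) * (\<alpha> ^ Suc j * card X)"
    by (simp only: power_mult_distrib power2_eq_square power_Suc mult_ac)
  have e2: "(1.2 * \<alpha>) ^ Suc j = 1.2 ^ Suc j * \<alpha> ^ Suc j" by (rule power_mult_distrib)
  have 1: "1.3 ^ j * (0.08 * \<alpha>) * (\<alpha> ^ Suc j * card X)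
      \<le> (1.2 ^ Suc j + 1) * (\<alpha> ^ Suc j * card X) + 2 ^ Suc j * real (card T)"
    using 0 unfolding e1 e2 by (simp only: distrib_right mult_1_left mult.assoc add_ac)
  have "(1.2 ^ Suc j + 2) * (\<alpha> ^ Suc j * card X) \<le> 1.3 ^ j * (0.08 * \<alpha>) * (\<alpha> ^ Suc j * card X)"
    using C5a alpha by (intro mult_right_mono) auto
  then have "(1.2 ^ Suc j + 2) * (\<alpha> ^ Suc j * card X)
      \<le> (1.2 ^ Suc j + 1) * (\<alpha> ^ Suc j * card X) + 2 ^ Suc j * real (card T)"
    using 1 by (rule order_trans)
  then have "\<alpha> ^ Suc j * card X \<le> 2 ^ Suc j * real (card T)" by (simp only: distrib_right)
  moreover have "(\<rho> * 2 ^ Suc j) * card X \<le> \<alpha> ^ Suc j * card X" using C5c by (intro mult_right_mono) auto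
  ultimately have "(\<rho> * 2 ^ Suc j) * card X \<le> 2 ^ Suc j * real (card T)" by linarith
  then have "2 ^ Suc j * (\<rho> * card X) \<le> 2 ^ Suc j * real (card T)" by (simp only: mult_ac)
  moreover have "(0::real) < 2 ^ Suc j" by simp
  ultimately have T1: "\<rho> * card X \<le> card T" by (simp only: mult_le_cancel_left_pos)
  have "\<rho> * card Y \<le> r / 2 * card Y" using C3 r by (intro mult_right_mono) auto
  then have V1: "\<rho> * card Y \<le> card (V y')" using Vr(1)[OF y'(1)] by linarith
  have "(\<Sum>y\<in>V y'. \<Sum>x\<in>T. A x y) < 1.01 * \<alpha> * zd * card T * card (V y')"
    using T1 V1 V_sub by (intro no_increment) (auto simp: T_def)
  also have "\<dots> \<le> (\<Sum>x\<in>T. 1.2 * \<alpha> * (zd * card (V y')))" using alpha zd by simp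
  also have "\<dots> \<le> (\<Sum>x\<in>T. \<phi> y' x * (zd * card (V y')))"
    using zd by (intro sum_mono mult_right_mono) (auto simp: T_def)
  also have "\<dots> = (\<Sum>x\<in>T. \<Sum>y\<in>V y'. A x y)"
    using zd Vr(3)[OF y'(1)] V_sub by (simp add: \<phi>_def)
  also have "\<dots> = (\<Sum>y\<in>V y'. \<Sum>x\<in>T. A x y)" by (rule sum.swap)
  finally show False by simp
qed

end

section \<open>Density increment for corner-free sets\<close>

text \<open>\<open>X\<close>, \<open>Y\<close> and \<open>Z\<close> contain the coordinates
  \<open>x\<close>, \<open>y\<close> and \<open>x + y\<close> of the points of \<open>A\<close>;
  they are the vertex classes of the tripartite graph. Although \<open>e\<close> ranges over the
  whole type, membership in \<open>A\<close> confines it to \<open>W\<close>.\<close>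

definition config :: "'a::elementary_2_group set \<Rightarrow> 'a set \<Rightarrow> 'a set \<Rightarrow> 'a set \<Rightarrow> ('a \<times> 'a) set \<Rightarrow> bool" where
  "config W X Y Z A \<longleftrightarrow> subgrp W \<and> X \<subseteq> W \<and> Y \<subseteq> W \<and> Z \<subseteq> W \<and>
     (\<forall>x y. (x, y) \<in> A \<longrightarrow> x \<in> X \<and> y \<in> Y \<and> x + y \<in> Z) \<and>
     (\<forall>x y e. (x, y) \<in> A \<longrightarrow> (x + e, y) \<in> A \<longrightarrow> (x, y + e) \<in> A \<longrightarrow> e = 0)"

text \<open>The change to coordinates \<open>x\<close> and \<open>z = x + y\<close>, an involution
  in characteristic 2. It exchanges the roles of \<open>Y\<close> and \<open>Z\<close> and respects
  corners.\<close>

definition shear :: "('a::elementary_2_group \<times> 'a) set \<Rightarrow> ('a \<times> 'a) set" where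
  "shear A = {(x, z). (x, x + z) \<in> A}"

lemma card_shear: "card (shear A) = card A"
proof (rule bij_betw_same_card)
  show "bij_betw (\<lambda>(x, z). (x, x + z)) (shear A) A"
    by (rule bij_betw_byWitness[where f' = "\<lambda>(x, z). (x, x + z)"]) (auto simp: shear_def)
qed

lemma config_shear:
  assumes "config W X Y Z A"
  shows "config W X Z Y (shear A)"
  unfolding config_def
proof (intro conjI allI impI)
  fix x z e
  assume a: "(x, z) \<in> shear A" "(x + e, z) \<in> shear A" "(x, z + e) \<in> shear A"
  \<comment> \<open>The corner of \<open>A\<close> is based at the image of
    \<open>(x, z + e)\<close>; the image of \<open>(x, z)\<close> is its vertical point.\<close>
  have "(x, x + z + e) \<in> A" "(x + e, x + z + e) \<in> A" "(x, (x + z + e) + e) \<in> A"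
    using a by (simp_all add: shear_def ac_simps)
  then show "e = 0" using assms unfolding config_def by blast
next
  fix x z assume "(x, z) \<in> shear A"
  then have "(x, x + z) \<in> A" by (simp add: shear_def)
  then have "x \<in> X \<and> x + z \<in> Y \<and> x + (x + z) \<in> Z" using assms unfolding config_def by blast
  then show "x \<in> X" "z \<in> Z" "x + z \<in> Y" by simp_all
qed (use assms in \<open>auto simp: config_def\<close>)

lemma card_eq_sum_of_bool:
  assumes "finite S" "finite T"
  shows "(\<Sum>y\<in>T. \<Sum>x\<in>S. of_bool ((x, y) \<in> A)) = real (card (A \<inter> S \<times> T))"
proof -
  have "(\<Sum>y\<in>T. \<Sum>x\<in>S. of_bool ((x, y) \<in> A)) = (\<Sum>p\<in>S \<times> T. of_bool (p \<in> A) :: real)"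
    by (subst sum.swap) (simp add: sum.cartesian_product)
  also have "\<dots> = card (A \<inter> S \<times> T)"
    using assms by (simp add: of_bool_def sum.If_cases Int_def conj_commute)
  finally show ?thesis .
qed

lemma incrementless_config:
  fixes \<eta> \<sigma> \<alpha> \<rho> :: real
  assumes c: "config W X Y Z A" and U: "uniform W \<eta> Z"
    and s: "0 < \<sigma>" "\<sigma> \<le> dens W X" "\<sigma> \<le> dens W Y" "\<sigma> \<le> dens W Z"
    and m: "0 < \<alpha>" "real (card A) = \<alpha> * dens W Z * card X * card Y" and \<rho>: "0 < \<rho>"
    and no: "\<not> (\<exists>S T. S \<subseteq> X \<and> T \<subseteq> Y \<and> \<rho> * card X \<le> card S \<and> \<rho> * card Y \<le> card T \<and>
      1.01 * \<alpha> * dens W Z * card S * card T \<le> card (A \<inter> S \<times> T))"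
  shows "incrementless W X Y Z (\<lambda>x y. of_bool ((x, y) \<in> A)) \<eta> \<sigma> \<alpha> \<rho>"
proof
  have W: "subgrp W" and sub: "X \<subseteq> W" "Y \<subseteq> W" "Z \<subseteq> W" using c by (auto simp: config_def)
  show "subgrp W" "X \<subseteq> W" "Y \<subseteq> W" "Z \<subseteq> W" by fact+
  have fin: "finite X" "finite Y" using sub subgrpD(1)[OF W] by (auto intro: finite_subset)
  have "A \<inter> X \<times> Y = A" using c by (auto simp: config_def)
  then show "(\<Sum>y\<in>Y. \<Sum>x\<in>X. of_bool ((x, y) \<in> A)) = \<alpha> * dens W Z * card X * card Y"
    using m card_eq_sum_of_bool[OF fin] by simp
  show "of_bool ((x, y) \<in> A) \<le> (of_bool (x + y \<in> Z) :: real)" for x y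
    using c by (auto simp: config_def)
  fix S T assume ST: "S \<subseteq> X" "T \<subseteq> Y" "\<rho> * card X \<le> card S" "\<rho> * card Y \<le> card T"
  have "(\<Sum>y\<in>T. \<Sum>x\<in>S. of_bool ((x, y) \<in> A)) = real (card (A \<inter> S \<times> T))"
    using ST fin by (intro card_eq_sum_of_bool finite_subset[OF _ fin(1)] finite_subset[OF _ fin(2)])
  moreover have "\<not> 1.01 * \<alpha> * dens W Z * card S * card T \<le> card (A \<inter> S \<times> T)"
    using no ST by blast
  ultimately show "(\<Sum>y\<in>T. \<Sum>x\<in>S. of_bool ((x, y) \<in> A)) < 1.01 * \<alpha> * dens W Z * card S * card T"
    by (simp only: not_le)
qed (use U s m \<rho> in auto)

text \<open>An edge \<open>(y, z)\<close> of the third graph lies in at most one triangle, so the normalised codegree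
  \<open>r\<close> is close to \<open>-1\<close> on all edges of that graph. Its \<open>k\<close>-th moment is transferred from the sparse
  graph to the complete bipartite one by uniformity of \<open>X\<close>, and decouples into moments of the two
  Gram kernels.\<close>

lemma increment:
  fixes \<eta> \<sigma> \<alpha> \<rho> :: real and k j :: nat
  defines "pair_density \<equiv> (\<alpha>\<^sup>2 / 3) ^ (2 * k)"
  assumes c: "config W X Y Z A" and U: "uniform W \<eta> X" "uniform W \<eta> Y" "uniform W \<eta> Z"
    and s: "0 < \<sigma>" "\<sigma> \<le> dens W X" "\<sigma> \<le> dens W Y" "\<sigma> \<le> dens W Z"
    and m: "0 < \<alpha>" "\<alpha> \<le> 2" "real (card A) * card W = \<alpha> * card X * card Y * card Z" and \<rho>: "0 < \<rho>"
    and k: "8 \<le> k" "even k" and C1: "real k \<le> 1.08 ^ (2 * k) * (0.15 * \<alpha>)"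
    and C2: "2 * \<eta> \<le> \<sigma> ^ (4 * k + 4) * \<alpha> ^ (4 * k)"
    and C3: "\<rho> \<le> pair_density / 4"
    and C4: "\<eta> * (2 / (\<sigma> * pair_density)) ^ Suc j \<le> 0.001 * \<alpha> ^ (j + 2) * \<sigma> ^ 3 * pair_density"
    and C5a: "1.2 ^ Suc j + 2 \<le> 1.3 ^ j * (0.08 * \<alpha>)"
    and C5b: "2 * \<eta> \<le> \<alpha> ^ Suc j * \<sigma> ^ (Suc j + 3) * pair_density"
    and C5c: "\<rho> * 2 ^ Suc j \<le> \<alpha> ^ Suc j"
    and C6: "2 * real k \<le> 0.81 * \<alpha>\<^sup>2 * \<sigma> ^ 3 * card W"
    and C7: "\<eta> * (2 / (\<alpha> * \<sigma>)) ^ (2 * k) \<le> 0.1 * \<alpha> * \<sigma> ^ 3"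
    and C8: "\<rho> + \<eta> / \<sigma> ^ 3 \<le> 0.001 * \<alpha>"
  obtains Y' Z' A' S T where "(Y', Z', A') = (Y, Z, A) \<or> (Y', Z', A') = (Z, Y, shear A)"
    "S \<subseteq> X" "T \<subseteq> Y'" "\<rho> * card X \<le> card S" "\<rho> * card Y' \<le> card T"
    "1.01 * \<alpha> * dens W Z' * card S * card T \<le> card (A' \<inter> S \<times> T)"
proof (rule ccontr)
  assume neg: "\<not> thesis"
  define N where "N = real (card W)"
  have W: "subgrp W" and sub: "X \<subseteq> W" "Y \<subseteq> W" "Z \<subseteq> W" using c by (auto simp: config_def)
  have fin: "finite X" "finite Y" "finite Z" "finite W"
    using subgrpD(1)[OF W] sub finite_subset by auto
  have N: "N > 0" using subgrpD(4)[OF W] by (simp add: N_def)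
  \<comment> \<open>Each point \<open>(x, y)\<close> of \<open>A\<close> with
    \<open>z = x + y\<close> is an edge of all three graphs at once. Hence all three have the same
    number of edges and, by the symmetric normalisation, the same relative density
    \<open>\<alpha>\<close>.\<close>
  define A1 :: "'a \<Rightarrow> 'a \<Rightarrow> real" where "A1 x y = of_bool ((x, y) \<in> A)" for x y
  define A3 :: "'a \<Rightarrow> 'a \<Rightarrow> real" where "A3 x z = of_bool ((x, z) \<in> shear A)" for x z
  define A2 :: "'a \<Rightarrow> 'a \<Rightarrow> real" where "A2 y z = of_bool ((y + z, y) \<in> A)" for y z
  have mA: "real (card A) = \<alpha> * dens W Z * card X * card Y" "real (card A) = \<alpha> * dens W Y * card X * card Z"
    "real (card A) = \<alpha> * dens W X * card Y * card Z"
    using m(3) N by (auto simp: dens_def N_def field_simps)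
  interpret B1: incrementless W X Y Z A1 \<eta> \<sigma> \<alpha> \<rho>
    unfolding A1_def using neg that[of Y Z A]
    by (intro incrementless_config[OF c U(3) s m(1) mA(1) \<rho>]) blast
  interpret B3: incrementless W X Z Y A3 \<eta> \<sigma> \<alpha> \<rho>
    unfolding A3_def using neg that[of Z Y "shear A"]
    by (intro incrementless_config[OF config_shear[OF c] U(2) s(1,2,4,3) m(1)])
       (use mA(2) \<rho> in \<open>auto simp: card_shear\<close>)
  define Y1 where "Y1 = {y\<in>Y. 0.9 * \<alpha> \<le> B1.d y}"
  define Z1 where "Z1 = {z\<in>Z. 0.9 * \<alpha> \<le> B3.d z}"
  have Y1: "Y1 \<subseteq> Y" "finite Y1" and Z1: "Z1 \<subseteq> Z" "finite Z1"
    using fin by (auto simp: Y1_def Z1_def)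
  have dY: "0.9 * \<alpha> \<le> B1.d y" "0 < B1.d y" if "y \<in> Y1" for y
    using that m(1) by (auto simp: Y1_def elim: less_le_trans[rotated])
  have dZ: "0.9 * \<alpha> \<le> B3.d z" "0 < B3.d z" if "z \<in> Z1" for z
    using that m(1) by (auto simp: Z1_def elim: less_le_trans[rotated])

  have supp: "x \<in> X" "y \<in> Y" "x + y \<in> Z" if "(x, y) \<in> A" for x y
    using c that unfolding config_def by blast+
  have supp2: "y \<in> Y" "z \<in> Z" if "(y + z, y) \<in> A" for y z
    using supp[OF that] by (simp_all add: add.commute)
  \<comment> \<open>Degrees in the third graph are those of the first at \<open>y\<close> and of the
    second at \<open>z\<close>. Discarding low degrees there loses 0.09 on each side, so at least
    0.8 of the third graph is left in \<open>main\<close>.\<close>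
  have marg2y: "(\<Sum>z\<in>Z. A2 y z) = B1.d y * (dens W Z * card X)" if "y \<in> Y" for y
  proof -
    have "(\<Sum>z\<in>Z. A2 y z) = (\<Sum>z\<in>W. A2 y z)"
      using fin sub supp2 by (intro sum.mono_neutral_left) (auto simp: A2_def)
    also have "\<dots> = (\<Sum>x\<in>W. A1 x y)"
      using sum_translate[OF W, of y "\<lambda>x. A1 x y"] that sub by (auto simp: A2_def A1_def add.commute)
    also have "\<dots> = (\<Sum>x\<in>X. A1 x y)"
      using fin sub c by (intro sum.mono_neutral_right) (auto simp: A1_def dest: supp)
    finally show ?thesis by (simp only: B1.sum_A)
  qed
  have marg2z: "(\<Sum>y\<in>Y. A2 y z) = B3.d z * (dens W Y * card X)" if "z \<in> Z" for z
  proof -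
    have "(\<Sum>y\<in>Y. A2 y z) = (\<Sum>y\<in>W. A2 y z)"
      using fin sub supp2 by (intro sum.mono_neutral_left) (auto simp: A2_def)
    also have "\<dots> = (\<Sum>x\<in>W. A3 x z)"
      using sum_translate[OF W, of z "\<lambda>x. A3 x z"] that sub
      by (auto simp: A2_def A3_def shear_def)
    also have "\<dots> = (\<Sum>x\<in>X. A3 x z)"
      using fin sub c by (intro sum.mono_neutral_right) (auto simp: A3_def shear_def dest: supp)
    finally show ?thesis by (simp only: B3.sum_A)
  qed
  have total: "(\<Sum>y\<in>Y. \<Sum>z\<in>Z. A2 y z) = card A"
  proof -
    have "(\<Sum>y\<in>Y. \<Sum>z\<in>Z. A2 y z) = (\<Sum>y\<in>Y. B1.d y) * (dens W Z * card X)"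
      unfolding sum_distrib_right by (rule sum.cong) (use marg2y in auto)
    then show ?thesis unfolding B1.sum_d using mA(1) by (simp add: mult_ac)
  qed
  have lowY: "(\<Sum>y\<in>Y - Y1. \<Sum>z\<in>Z. A2 y z) \<le> 0.09 * card A"
  proof -
    have "(\<Sum>y\<in>Y - Y1. \<Sum>z\<in>Z. A2 y z) = (\<Sum>y\<in>Y - Y1. B1.d y) * (dens W Z * card X)"
      using marg2y by (simp add: sum_distrib_right)
    also have "(\<Sum>y\<in>Y - Y1. B1.d y) = (\<Sum>y\<in>{y\<in>Y. B1.d y < 0.9 * \<alpha>}. B1.d y)"
      by (rule sum.cong) (auto simp: Y1_def)
    also have "(\<Sum>y\<in>{y\<in>Y. B1.d y < 0.9 * \<alpha>}. B1.d y) * (dens W Z * card X)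
        \<le> (0.09 * \<alpha> * card Y) * (dens W Z * card X)"
      using B1.low_degree_mass[OF C8] B1.zd by (intro mult_right_mono) auto
    finally show ?thesis using mA(1) by (simp add: mult_ac)
  qed
  have lowZ: "(\<Sum>z\<in>Z - Z1. \<Sum>y\<in>Y. A2 y z) \<le> 0.09 * card A"
  proof -
    have "(\<Sum>z\<in>Z - Z1. \<Sum>y\<in>Y. A2 y z) = (\<Sum>z\<in>Z - Z1. B3.d z) * (dens W Y * card X)"
      using marg2z by (simp add: sum_distrib_right)
    also have "(\<Sum>z\<in>Z - Z1. B3.d z) = (\<Sum>z\<in>{z\<in>Z. B3.d z < 0.9 * \<alpha>}. B3.d z)"
      by (rule sum.cong) (auto simp: Z1_def)
    also have "(\<Sum>z\<in>{z\<in>Z. B3.d z < 0.9 * \<alpha>}. B3.d z) * (dens W Y * card X)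
        \<le> (0.09 * \<alpha> * card Z) * (dens W Y * card X)"
      using B3.low_degree_mass[OF C8] B3.zd by (intro mult_right_mono) auto
    finally show ?thesis using mA(2) by (simp add: mult_ac)
  qed
  have main: "0.8 * card A \<le> (\<Sum>y\<in>Y1. \<Sum>z\<in>Z1. A2 y z)"
  proof -
    have "(\<Sum>y\<in>Y. \<Sum>z\<in>Z. A2 y z) = (\<Sum>y\<in>Y - Y1. \<Sum>z\<in>Z. A2 y z) + (\<Sum>y\<in>Y1. \<Sum>z\<in>Z. A2 y z)"
      using fin Y1 by (intro sum.subset_diff) auto
    moreover have "(\<Sum>y\<in>Y1. \<Sum>z\<in>Z. A2 y z) = (\<Sum>y\<in>Y1. \<Sum>z\<in>Z - Z1. A2 y z) + (\<Sum>y\<in>Y1. \<Sum>z\<in>Z1. A2 y z)"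
      unfolding sum.distrib[symmetric] using fin Z1 by (intro sum.cong refl sum.subset_diff) auto
    moreover have "(\<Sum>y\<in>Y1. \<Sum>z\<in>Z - Z1. A2 y z) \<le> (\<Sum>y\<in>Y. \<Sum>z\<in>Z - Z1. A2 y z)"
      using fin Y1 by (intro sum_mono2 sum_nonneg) (auto simp: A2_def)
    moreover have "(\<Sum>y\<in>Y. \<Sum>z\<in>Z - Z1. A2 y z) = (\<Sum>z\<in>Z - Z1. \<Sum>y\<in>Y. A2 y z)" by (rule sum.swap)
    ultimately show ?thesis using total lowY lowZ by simp
  qed

  define g1 where "g1 x y = A1 x y / (dens W Z * B1.d y) - 1" for x y
  define g3 where "g3 x z = A3 x z / (dens W Y * B3.d z) - 1" for x z
  define r where "r y z = (\<Sum>x\<in>X. g1 x y * g3 x z) / card X" for y z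
  have r_eq: "r y z = (\<Sum>x\<in>X. A1 x y * A3 x z) / (card X * (dens W Z * B1.d y) * (dens W Y * B3.d z)) - 1"
    if "y \<in> Y1" "z \<in> Z1" for y z
  proof -
    have "(\<Sum>x\<in>X. g1 x y * g3 x z)
        = (\<Sum>x\<in>X. A1 x y * A3 x z) / ((dens W Z * B1.d y) * (dens W Y * B3.d z))
        - (\<Sum>x\<in>X. A1 x y) / (dens W Z * B1.d y) - (\<Sum>x\<in>X. A3 x z) / (dens W Y * B3.d z) + card X"
      by (simp add: g1_def g3_def algebra_simps sum.distrib sum_subtractf sum_divide_distrib)
    also have "\<dots> = (\<Sum>x\<in>X. A1 x y * A3 x z) / ((dens W Z * B1.d y) * (dens W Y * B3.d z)) - card X"
      unfolding B1.sum_A B3.sum_A using dY[OF that(1)] dZ[OF that(2)] B1.zd B3.zd by simp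
    finally show ?thesis using B1.card_pos by (simp add: r_def diff_divide_distrib mult_ac)
  qed
  \<comment> \<open>A triangle over the edge \<open>(y, z)\<close> with apex \<open>x\<close> gives
    a corner of difference \<open>x + y + z\<close>, so \<open>x = y + z\<close> and the codegree is
    at most 1. By \<open>C6\<close> its expected value \<open>q\<close> is at least
    \<open>2 * k\<close>; so \<open>r y z\<close> is at most -1 + 1 / (2 \<open>k\<close>), and
    Bernoulli applies as \<open>k\<close> is even.\<close>
  have edge: "1 / 2 \<le> r y z ^ k" if yz: "y \<in> Y1" "z \<in> Z1" and e: "(y + z, y) \<in> A" for y z
  proof -
    define v where "v = (\<Sum>x\<in>X. A1 x y * A3 x z)"
    define q where "q = card X * (dens W Z * B1.d y) * (dens W Y * B3.d z)"
    have "v \<le> (\<Sum>x\<in>X. if x = y + z then 1 else 0)"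
      unfolding v_def
    proof (rule sum_mono)
      fix x assume "x \<in> X"
      have "x = y + z" if "(x, y) \<in> A" "(x, x + z) \<in> A"
      proof -
        have "(x + (x + y + z), y) \<in> A" "(x, y + (x + y + z)) \<in> A"
          using e that by (simp_all add: ac_simps)
        then have "x + y + z = 0" using c that(1) unfolding config_def by blast
        then show ?thesis by (metis add.assoc add_self_left add_0_right)
      qed
      then show "A1 x y * A3 x z \<le> (if x = y + z then 1 else 0)"
        by (auto simp: A1_def A3_def shear_def)
    qed
    also have "\<dots> \<le> 1" using fin by simp
    finally have v: "v \<le> 1" "0 \<le> v" by (auto simp: v_def A1_def A3_def intro: sum_nonneg)
    have "(\<sigma> * N) * (\<sigma> * (0.9 * \<alpha>)) * (\<sigma> * (0.9 * \<alpha>)) \<le> q"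
      unfolding q_def using B1.card_bounds B1.zd B3.zd dY[OF yz(1)] dZ[OF yz(2)] s(1) m(1) N
      by (intro mult_mono) (auto simp: N_def)
    moreover have "(\<sigma> * N) * (\<sigma> * (0.9 * \<alpha>)) * (\<sigma> * (0.9 * \<alpha>)) = 0.81 * \<alpha>\<^sup>2 * \<sigma> ^ 3 * N"
      by (simp add: power2_eq_square power3_eq_cube)
    ultimately have "0.81 * \<alpha>\<^sup>2 * \<sigma> ^ 3 * N \<le> q" by (simp only:)
    then have q: "2 * real k \<le> q" using C6 unfolding N_def by (rule order_trans[rotated])
    have "v / q \<le> 1 / (2 * real k)" using v q k by (intro frac_le) auto
    then have "1 + real k * (-1 / (2 * real k)) \<le> (1 + (-1 / (2 * real k))) ^ k"
      using k by (intro Bernoulli_inequality) (simp add: field_simps)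
    also have "\<dots> \<le> (1 - v / q) ^ k"
      using \<open>v / q \<le> _\<close> k by (intro power_mono) (auto simp: field_simps)
    also have "\<dots> = r y z ^ k"
      unfolding r_eq[OF yz] v_def[symmetric] q_def[symmetric]
      using k(2) by (metis minus_diff_eq power_minus_even)
    finally show ?thesis using k by simp
  qed
  have "0.4 * card A \<le> (\<Sum>y\<in>Y1. \<Sum>z\<in>Z1. A2 y z * (1 / 2))"
    using main unfolding sum_distrib_right[symmetric] by simp
  also have "\<dots> \<le> (\<Sum>y\<in>Y1. \<Sum>z\<in>Z1. of_bool (y + z \<in> X) * r y z ^ k)"
  proof (intro sum_mono)
    fix y z assume yz: "y \<in> Y1" "z \<in> Z1"
    have "(y + z, y) \<in> A \<Longrightarrow> y + z \<in> X" using c by (auto simp: config_def)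
    then show "A2 y z * (1 / 2) \<le> of_bool (y + z \<in> X) * r y z ^ k"
      using edge[OF yz] k(2) by (auto simp: A2_def zero_le_even_power)
  qed
  also have "\<dots> = (\<Sum>y\<in>Y1. \<Sum>z\<in>Z1. (of_bool (y + z \<in> X) - dens W X) * 1 * 1 * r y z ^ k)
      + dens W X * (\<Sum>y\<in>Y1. \<Sum>z\<in>Z1. r y z ^ k)"
    by (simp add: algebra_simps sum_subtractf sum_distrib_left)
  also have "\<dots> \<le> 0.1 * card A + dens W X * (\<Sum>y\<in>Y1. \<Sum>z\<in>Z1. r y z ^ k)"
  proof -
    let ?G = "2 / (\<alpha> * \<sigma>)"
    have G: "1 \<le> ?G" using m(1,2) s(1) B1.zd mult_mono[of \<alpha> 2 \<sigma> 1] by (simp add: le_divide_eq)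
    have bound: "\<bar>u / (dd * e) - 1\<bar> \<le> ?G"
      if "0 \<le> u" "u \<le> 1" "\<sigma> \<le> dd" "0.9 * \<alpha> \<le> e" for u dd e :: real
    proof -
      have "\<sigma> * (0.9 * \<alpha>) \<le> dd * e" using that s(1) m(1) by (intro mult_mono) auto
      then have "u / (dd * e) \<le> 1 / (\<sigma> * (0.9 * \<alpha>))" using that s(1) m(1) by (intro frac_le) auto
      also have "\<dots> \<le> ?G" using s(1) m(1) by (simp add: field_simps)
      finally have "u / (dd * e) \<le> ?G" .
      moreover have "0 \<le> u / (dd * e)" using that s(1) m(1) by simp
      ultimately show ?thesis using G by simp
    qed
    have "\<bar>\<Sum>y\<in>Y1. \<Sum>z\<in>Z1. (of_bool (y + z \<in> X) - dens W X) * 1 * 1 * r y z ^ k\<bar>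
        \<le> \<eta> * (real (card W))\<^sup>2 * (1 * 1) * (?G * ?G) ^ k"
      unfolding r_def
    proof (rule uniform_kernel_power[OF U(1) W])
      show "\<bar>g1 x y\<bar> \<le> ?G" if "x \<in> X" "y \<in> Y1" for x y
        unfolding g1_def using dY[OF that(2)] B1.zd by (intro bound) (auto simp: A1_def)
      show "\<bar>g3 x z\<bar> \<le> ?G" if "x \<in> X" "z \<in> Z1" for x z
        unfolding g3_def using dZ[OF that(2)] B3.zd by (intro bound) (auto simp: A3_def)
    qed (use Y1 Z1 sub m(1) s(1) in auto)
    also have "\<dots> = (\<eta> * ?G ^ (2 * k)) * N\<^sup>2"
      by (simp add: N_def power_mult power2_eq_square power_mult_distrib)
    also have "\<dots> \<le> (0.1 * \<alpha> * \<sigma> ^ 3) * N\<^sup>2" using C7 by (intro mult_right_mono) auto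
    also have "\<dots> = 0.1 * \<alpha> * (\<sigma> * (\<sigma> * N) * (\<sigma> * N))"
      by (simp add: power2_eq_square power3_eq_cube)
    also have "\<dots> \<le> 0.1 * \<alpha> * (dens W X * card Y * card Z)"
      using s B1.card_bounds B3.card_bounds m(1) N by (intro mult_left_mono mult_mono) (auto simp: N_def)
    also have "\<dots> = 0.1 * card A" using mA(3) by simp
    finally show ?thesis by linarith
  qed
  finally have "0.3 * card A \<le> dens W X * (\<Sum>y\<in>Y1. \<Sum>z\<in>Z1. r y z ^ k)" by simp
  then have "dens W X * (0.3 * \<alpha> * (real (card Y) * card Z)) \<le> dens W X * (\<Sum>y\<in>Y1. \<Sum>z\<in>Z1. r y z ^ k)"
    using mA(3) by (simp add: mult_ac)
  then have Q: "0.3 * \<alpha> * (real (card Y) * card Z) \<le> (\<Sum>y\<in>Y1. \<Sum>z\<in>Z1. r y z ^ k)"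
    using s by (simp only: mult_le_cancel_left_pos[OF less_le_trans[OF s(1,2)]])
  define h1 where "h1 y y' = (\<Sum>x\<in>X. g1 x y * g1 x y') / card X" for y y'
  define h3 where "h3 z z' = (\<Sum>x\<in>X. g3 x z * g3 x z') / card X" for z z'
  have P: "(\<Sum>y\<in>Y1. \<Sum>y'\<in>Y1. h1 y y' ^ k) < 0.3 * \<alpha> * (card Y)\<^sup>2"
  proof -
    have "(\<Sum>y\<in>Y1. \<Sum>y'\<in>Y1. h1 y y' ^ k) = (\<Sum>y\<in>Y1. \<Sum>y'\<in>Y1. (B1.K y y' / (B1.d y * B1.d y') - 1) ^ k)"
    proof (intro sum.cong refl)
      fix y y' assume "y \<in> Y1" "y' \<in> Y1"
      then show "h1 y y' ^ k = (B1.K y y' / (B1.d y * B1.d y') - 1) ^ k"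
        unfolding h1_def g1_def using dY(2) by (subst B1.normalised_codegree) fastforce+
    qed
    also have "\<dots> < 0.3 * \<alpha> * (card Y)\<^sup>2"
      unfolding Y1_def by (rule B1.sift[OF k(1) C1 C2 C3[unfolded pair_density_def] C4[unfolded pair_density_def] C5a C5b[unfolded pair_density_def] C5c])
    finally show ?thesis .
  qed
  have R: "(\<Sum>z\<in>Z1. \<Sum>z'\<in>Z1. h3 z z' ^ k) < 0.3 * \<alpha> * (card Z)\<^sup>2"
  proof -
    have "(\<Sum>z\<in>Z1. \<Sum>z'\<in>Z1. h3 z z' ^ k) = (\<Sum>z\<in>Z1. \<Sum>z'\<in>Z1. (B3.K z z' / (B3.d z * B3.d z') - 1) ^ k)"
    proof (intro sum.cong refl)
      fix z z' assume "z \<in> Z1" "z' \<in> Z1"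
      then show "h3 z z' ^ k = (B3.K z z' / (B3.d z * B3.d z') - 1) ^ k"
        unfolding h3_def g3_def using dZ(2) by (subst B3.normalised_codegree) fastforce+
    qed
    also have "\<dots> < 0.3 * \<alpha> * (card Z)\<^sup>2"
      unfolding Z1_def by (rule B3.sift[OF k(1) C1 C2 C3[unfolded pair_density_def] C4[unfolded pair_density_def] C5a C5b[unfolded pair_density_def] C5c])
    finally show ?thesis .
  qed
  have cY: "real (card Y) > 0" and cZ: "real (card Z) > 0" using B1.card_pos B3.card_pos by auto
  \<comment> \<open>Semidefiniteness is tested on the vector 1 / \<open>card Y\<close> on
    \<open>Y1\<close> and -1 / \<open>card Z\<close> on \<open>Z1\<close>: twice the normalised
    mixed moment is at most the sum of the two diagonal ones, against \<open>P\<close>,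
    \<open>Q\<close> and \<open>R\<close>.\<close>
  have "0 \<le> (\<Sum>y\<in>Y1. \<Sum>y'\<in>Y1. (1 / card Y) * (1 / card Y) * h1 y y' ^ k)
      + 2 * (\<Sum>y\<in>Y1. \<Sum>z\<in>Z1. (1 / card Y) * (- 1 / card Z) * r y z ^ k)
      + (\<Sum>z\<in>Z1. \<Sum>z'\<in>Z1. (- 1 / card Z) * (- 1 / card Z) * h3 z z' ^ k)"
    unfolding h1_def h3_def r_def by (rule gram_power_nonneg)
  also have "\<dots> = (\<Sum>y\<in>Y1. \<Sum>y'\<in>Y1. h1 y y' ^ k) / (card Y)\<^sup>2
      - 2 * ((\<Sum>y\<in>Y1. \<Sum>z\<in>Z1. r y z ^ k) / (real (card Y) * card Z))
      + (\<Sum>z\<in>Z1. \<Sum>z'\<in>Z1. h3 z z' ^ k) / (card Z)\<^sup>2"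
    unfolding sum_distrib_left[symmetric] using cY cZ by (simp add: power2_eq_square field_simps)
  also have "\<dots> < 0.3 * \<alpha> - 2 * (0.3 * \<alpha>) + 0.3 * \<alpha>"
  proof -
    have "(\<Sum>y\<in>Y1. \<Sum>y'\<in>Y1. h1 y y' ^ k) / (card Y)\<^sup>2 < 0.3 * \<alpha>"
      using P cY by (simp add: pos_divide_less_eq)
    moreover have "(\<Sum>z\<in>Z1. \<Sum>z'\<in>Z1. h3 z z' ^ k) / (card Z)\<^sup>2 < 0.3 * \<alpha>"
      using R cZ by (simp add: pos_divide_less_eq)
    moreover have "0.3 * \<alpha> \<le> (\<Sum>y\<in>Y1. \<Sum>z\<in>Z1. r y z ^ k) / (real (card Y) * card Z)"
      using Q cY cZ by (simp add: pos_le_divide_eq)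
    ultimately show ?thesis by linarith
  qed
  finally show False by simp
qed

section \<open>Uniformisation\<close>

text \<open>The part of \<open>X\<close> in the coset of \<open>i\<close>, translated back into
  \<open>H\<close>. Corners do not change under translation, and shifts \<open>i\<close> and
  \<open>j\<close> of the coordinates shift their sum by \<open>i + j\<close>.\<close>

definition slice :: "'a::elementary_2_group set \<Rightarrow> 'a \<Rightarrow> 'a set \<Rightarrow> 'a set" where
  "slice H i X = {x\<in>H. x + i \<in> X}"

definition slice2 :: "'a::elementary_2_group set \<Rightarrow> 'a \<Rightarrow> 'a \<Rightarrow> ('a \<times> 'a) set \<Rightarrow> ('a \<times> 'a) set" where
  "slice2 H i j A = {(x, y). x \<in> H \<and> y \<in> H \<and> (x + i, y + j) \<in> A}"

definition schur_triples :: "'a::elementary_2_group set \<Rightarrow> 'a set \<Rightarrow> 'a set \<Rightarrow> ('a \<times> 'a) set" where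
  "schur_triples X Y Z = {(x, y). x \<in> X \<and> y \<in> Y \<and> x + y \<in> Z}"

lemma slice2_schur_triples:
  assumes "subgrp H"
  shows "slice2 H i j (schur_triples X Y Z) = schur_triples (slice H i X) (slice H j Y) (slice H (i + j) Z)"
  using subgrpD(3)[OF assms] by (auto simp: slice2_def schur_triples_def slice_def ac_simps)

lemma config_slice:
  assumes c: "config W X Y Z A" and H: "subgrp H"
  shows "config H (slice H i X) (slice H j Y) (slice H (i + j) Z) (slice2 H i j A)"
  unfolding config_def
proof (intro conjI allI impI)
  fix x y e
  assume a: "(x, y) \<in> slice2 H i j A" "(x + e, y) \<in> slice2 H i j A" "(x, y + e) \<in> slice2 H i j A"
  have "(x + i, y + j) \<in> A" "(x + i + e, y + j) \<in> A" "(x + i, y + j + e) \<in> A"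
    using a by (simp_all add: slice2_def ac_simps)
  then show "e = 0" using c unfolding config_def by blast
next
  fix x y assume a: "(x, y) \<in> slice2 H i j A"
  then have "x + i \<in> X \<and> y + j \<in> Y \<and> (x + i) + (y + j) \<in> Z"
    using c unfolding config_def slice2_def by blast
  then show "x \<in> slice H i X" "y \<in> slice H j Y" "x + y \<in> slice H (i + j) Z"
    using a subgrpD(3)[OF H] by (auto simp: slice_def slice2_def ac_simps)
qed (use H in \<open>auto simp: slice_def\<close>)

section \<open>Cutting along a subgroup of index two\<close>

locale index_two =
  fixes W H :: "'a::elementary_2_group set" and \<chi> :: "'a \<Rightarrow> real" and g :: 'a
  assumes W: "subgrp W" and chi: "\<chi> \<in> chars W" and g: "g \<in> W" "\<chi> g = -1"
    and H_def: "H = {x\<in>W. \<chi> x = 1}"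
begin

lemma subgrp_H: "subgrp H"
proof -
  have "\<chi> 0 = \<chi> 0 * \<chi> 0" using charsD(2)[OF chi, of 0 0] subgrpD(2)[OF W] by simp
  then have "\<chi> 0 = 1" using charsD(1)[OF chi, of 0] subgrpD(2)[OF W] by auto
  then show ?thesis
    using W charsD(2)[OF chi] by (auto simp: subgrp_def H_def)
qed

lemma sum_split:
  fixes f :: "'a \<Rightarrow> 'b::comm_monoid_add"
  shows "(\<Sum>x\<in>W. f x) = (\<Sum>x\<in>H. f x) + (\<Sum>x\<in>H. f (x + g))"
proof -
  have "(\<Sum>x\<in>W. f x) = (\<Sum>x\<in>W - H. f x) + (\<Sum>x\<in>H. f x)"
    using subgrpD(1)[OF W] by (intro sum.subset_diff) (auto simp: H_def)
  also have "(\<Sum>x\<in>W - H. f x) = (\<Sum>x\<in>H. f (x + g))"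
    by (rule sum.reindex_bij_witness[of _ "\<lambda>x. x + g" "\<lambda>x. x + g"])
       (use g subgrpD(3)[OF W] charsD(1,2)[OF chi] in \<open>auto simp: H_def\<close>)
  finally show ?thesis by (simp add: add.commute)
qed

lemma card_W: "card W = 2 * card H"
  using sum_split[of "\<lambda>_. 1::nat"] by simp

lemma card_slice_sum: "real (card (slice H i X)) = (\<Sum>x\<in>H. of_bool (x + i \<in> X))"
  using subgrpD(1)[OF subgrp_H] by (simp add: slice_def of_bool_def sum.If_cases Int_def)

lemma card_slices:
  assumes "X \<subseteq> W"
  shows "real (card X) = real (card (slice H 0 X)) + real (card (slice H g X))"
proof -
  have "real (card X) = (\<Sum>x\<in>W. of_bool (x \<in> X))"
    using assms subgrpD(1)[OF W] by (simp add: of_bool_def sum.If_cases Int_absorb1)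
  then show ?thesis unfolding card_slice_sum by (simp add: sum_split)
qed

lemma char_slices:
  assumes "X \<subseteq> W"
  shows "(\<Sum>x\<in>X. \<chi> x) = real (card (slice H 0 X)) - card (slice H g X)"
proof -
  have "(\<Sum>x\<in>X. \<chi> x) = (\<Sum>x\<in>W. if x \<in> X then \<chi> x else 0)"
    using assms subgrpD(1)[OF W] by (simp add: sum.inter_restrict[symmetric] Int_absorb1)
  also have "\<dots> = (\<Sum>x\<in>H. of_bool (x + 0 \<in> X)) + (\<Sum>x\<in>H. - of_bool (x + g \<in> X))"
    unfolding sum_split using g charsD(2)[OF chi] by (intro arg_cong2[of _ _ _ _ "(+)"] sum.cong) (auto simp: H_def)
  finally show ?thesis unfolding card_slice_sum by (simp add: sum_negf)
qed

lemma card_slices2: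
  assumes "A \<subseteq> W \<times> W"
  shows "real (card A) = real (card (slice2 H 0 0 A)) + real (card (slice2 H 0 g A))
    + real (card (slice2 H g 0 A)) + real (card (slice2 H g g A))"
proof -
  have fin: "finite W" "finite H" using subgrpD(1) W subgrp_H by auto
  have sl: "real (card (slice2 H i j A)) = (\<Sum>x\<in>H. \<Sum>y\<in>H. of_bool ((x + i, y + j) \<in> A))" for i j
  proof -
    have "real (card (slice2 H i j A)) = card ({p. (fst p + i, snd p + j) \<in> A} \<inter> H \<times> H)"
      by (rule arg_cong[where f = "\<lambda>S. real (card S)"]) (auto simp: slice2_def)
    also have "\<dots> = (\<Sum>y\<in>H. \<Sum>x\<in>H. of_bool ((x + i, y + j) \<in> A))"
      using card_eq_sum_of_bool[OF fin(2) fin(2), of "{p. (fst p + i, snd p + j) \<in> A}"] by simp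
    finally show ?thesis by (subst sum.swap)
  qed
  have "real (card A) = (\<Sum>x\<in>W. \<Sum>y\<in>W. of_bool ((x, y) \<in> A))"
    using card_eq_sum_of_bool[OF fin(1) fin(1), of A] assms by (subst sum.swap) (simp add: Int_absorb2)
  then show ?thesis unfolding sl by (simp add: sum_split sum.distrib)
qed

end

definition good_cell where
  "good_cell \<eta> ux uy uz \<theta> W X Y Z A \<longleftrightarrow> config W X Y Z A \<and>
     uniform W \<eta> X \<and> uniform W \<eta> Y \<and> uniform W \<eta> Z \<and>
     ux \<le> dens W X \<and> uy \<le> dens W Y \<and> uz \<le> dens W Z \<and>
     \<theta> * (dens W X * dens W Y * dens W Z) * (real (card W))\<^sup>2 \<le> card A"

text \<open>Built from quantities that average exactly over the children: products of only two
  densities, and the number of pairs with sum in \<open>Z\<close> in place of the product of all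
  three densities, which would not average. The term \<open>2 * \<eta>\<close> pays for exchanging
  these in a uniform cell with \<open>\<theta> \<le> 2\<close>.\<close>

definition cell_bound :: "real \<Rightarrow> real \<Rightarrow> real \<Rightarrow> real \<Rightarrow> real \<Rightarrow> 'a::elementary_2_group set \<Rightarrow> 'a set \<Rightarrow> 'a set \<Rightarrow> 'a set \<Rightarrow> real" where
  "cell_bound \<eta> ux uy uz \<theta> W X Y Z = \<theta> * (card (schur_triples X Y Z) / (real (card W))\<^sup>2) + 2 * \<eta>
     + ux * (dens W Y * dens W Z) + uy * (dens W X * dens W Z) + uz * (dens W X * dens W Y)"

definition energy :: "'a set \<Rightarrow> 'a set \<Rightarrow> 'a set \<Rightarrow> 'a set \<Rightarrow> real" where
  "energy W X Y Z = (dens W X)\<^sup>2 + (dens W Y)\<^sup>2 + (dens W Z)\<^sup>2"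

lemma dens_le_1: "X \<subseteq> W \<Longrightarrow> finite W \<Longrightarrow> dens W X \<le> 1"
  by (simp add: dens_def divide_le_eq card_mono)

lemma dens_nonneg: "0 \<le> dens W X" by (simp add: dens_def)

lemma energy_le:
  assumes "config W X Y Z A"
  shows "energy W X Y Z \<le> 3"
proof -
  have "(dens W U)\<^sup>2 \<le> 1" if "U \<subseteq> W" for U
    using that assms dens_le_1[of U W] dens_nonneg[of W U]
    by (auto simp: config_def subgrp_def intro: power_le_one)
  from this[of X] this[of Y] this[of Z] show ?thesis
    using assms by (simp add: energy_def config_def)
qed

lemma schur_triples_uniform:
  assumes c: "config W X Y Z A" and U: "uniform W \<eta> Z"
  shows "\<bar>card (schur_triples X Y Z) / (real (card W))\<^sup>2 - dens W X * dens W Y * dens W Z\<bar> \<le> \<eta>"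
proof -
  have W: "subgrp W" and sub: "X \<subseteq> W" "Y \<subseteq> W" using c by (auto simp: config_def)
  have fin: "finite X" "finite Y" using sub subgrpD(1)[OF W] by (auto intro: finite_subset)
  define N where "N = real (card W)"
  have N: "N > 0" using subgrpD(4)[OF W] by (simp add: N_def)
  have "schur_triples X Y Z = {p. fst p + snd p \<in> Z} \<inter> X \<times> Y" by (auto simp: schur_triples_def)
  then have S: "real (card (schur_triples X Y Z)) = (\<Sum>x\<in>X. \<Sum>y\<in>Y. of_bool (x + y \<in> Z))"
    using card_eq_sum_of_bool[OF fin, of "{p. fst p + snd p \<in> Z}"] by (subst sum.swap) simp
  have "\<bar>\<Sum>x\<in>X. \<Sum>y\<in>Y. (of_bool (x + y \<in> Z) - dens W Z) * 1 * 1\<bar> \<le> \<eta> * (real (card W))\<^sup>2 * (1 * 1)"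
    by (rule uniform_bilinear[OF U W sub]) auto
  also have "(\<Sum>x\<in>X. \<Sum>y\<in>Y. (of_bool (x + y \<in> Z) - dens W Z) * 1 * 1)
      = card (schur_triples X Y Z) - dens W X * dens W Y * dens W Z * N\<^sup>2"
    using N unfolding S by (simp add: sum_subtractf dens_def N_def power2_eq_square)
  finally have "\<bar>card (schur_triples X Y Z) - dens W X * dens W Y * dens W Z * N\<^sup>2\<bar> / N\<^sup>2 \<le> \<eta>"
    using N by (simp add: divide_le_eq N_def)
  also have "\<bar>card (schur_triples X Y Z) - dens W X * dens W Y * dens W Z * N\<^sup>2\<bar> / N\<^sup>2
      = \<bar>(card (schur_triples X Y Z) - dens W X * dens W Y * dens W Z * N\<^sup>2) / N\<^sup>2\<bar>"
    by simp
  finally show ?thesis using N by (simp add: diff_divide_distrib N_def)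
qed

text \<open>A uniform cell that is not good has a thin side or few points of \<open>A\<close>. In
  the first case uniformity bounds even all pairs with sum in \<open>Z\<close>, and the term with
  \<open>ux\<close>, \<open>uy\<close> or \<open>uz\<close> covers them; in the second the term with
  \<open>\<theta>\<close> does.\<close>

lemma uniform_cell_bound:
  assumes c: "config W X Y Z A" and U: "uniform W \<eta> X" "uniform W \<eta> Y" "uniform W \<eta> Z"
    and \<theta>: "0 \<le> \<theta>" "\<theta> \<le> 2" and u: "0 \<le> ux" "0 \<le> uy" "0 \<le> uz"
    and no: "\<not> good_cell \<eta> ux uy uz \<theta> W X Y Z A"
  shows "card A / (real (card W))\<^sup>2 \<le> cell_bound \<eta> ux uy uz \<theta> W X Y Z"
proof -
  define N where "N = real (card W)"
  have W: "subgrp W" and sub: "X \<subseteq> W" "Y \<subseteq> W" using c by (auto simp: config_def)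
  have N: "N > 0" using subgrpD(4)[OF W] by (simp add: N_def)
  have \<eta>: "0 \<le> \<eta>" using uniform_eta_nonneg[OF U(1) W] .
  define x y z where "x = dens W X" and "y = dens W Y" and "z = dens W Z"
  have xyz: "0 \<le> x" "0 \<le> y" "0 \<le> z" by (auto simp: x_def y_def z_def dens_nonneg)
  define s where "s = card (schur_triples X Y Z) / N\<^sup>2"
  have s0: "0 \<le> s" by (simp add: s_def)
  have s: "\<bar>s - x * y * z\<bar> \<le> \<eta>"
    using schur_triples_uniform[OF c U(3)] by (simp add: s_def N_def x_def y_def z_def)
  have "A \<subseteq> schur_triples X Y Z" using c by (auto simp: config_def schur_triples_def)
  moreover have "finite (schur_triples X Y Z)"
    by (rule finite_subset[of _ "W \<times> W"]) (use sub subgrpD(1)[OF W] in \<open>auto simp: schur_triples_def\<close>)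
  ultimately have "card A \<le> card (schur_triples X Y Z)" by (rule card_mono[rotated])
  then have as: "card A / N\<^sup>2 \<le> s" using N by (simp add: s_def divide_right_mono)
  have B: "cell_bound \<eta> ux uy uz \<theta> W X Y Z = \<theta> * s + 2 * \<eta> + ux * (y * z) + uy * (x * z) + uz * (x * y)"
    by (simp add: cell_bound_def s_def N_def x_def y_def z_def)
  have nn: "0 \<le> \<theta> * s" "0 \<le> ux * (y * z)" "0 \<le> uy * (x * z)" "0 \<le> uz * (x * y)"
    using \<theta> u xyz s0 by auto
  consider "x < ux" | "y < uy" | "z < uz" | "card A < \<theta> * (x * y * z) * N\<^sup>2"
    using no c U unfolding good_cell_def x_def y_def z_def N_def by linarith
  then have "card A / N\<^sup>2 \<le> \<theta> * s + 2 * \<eta> + ux * (y * z) + uy * (x * z) + uz * (x * y)"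
  proof cases
    case 1
    then have "x * (y * z) \<le> ux * (y * z)" using xyz by (intro mult_right_mono) auto
    then show ?thesis using as s nn \<eta> by (simp add: mult.assoc)
  next
    case 2
    then have "y * (x * z) \<le> uy * (x * z)" using xyz by (intro mult_right_mono) auto
    then show ?thesis using as s nn \<eta> by (simp add: mult.assoc mult.left_commute)
  next
    case 3
    then have "z * (x * y) \<le> uz * (x * y)" using xyz by (intro mult_right_mono) auto
    then show ?thesis using as s nn \<eta> by (simp add: mult.commute)
  next
    case 4
    then have "card A / N\<^sup>2 \<le> \<theta> * (x * y * z)" using N by (simp add: pos_divide_le_eq)
    also have "\<dots> \<le> \<theta> * (s + \<eta>)" using s \<theta> by (intro mult_left_mono) auto
    also have "\<theta> * (s + \<eta>) \<le> \<theta> * s + 2 * \<eta>" using \<theta> \<eta> by (simp add: distrib_left mult_right_mono)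
    finally show ?thesis using nn by simp
  qed
  then show ?thesis unfolding B N_def .
qed

context index_two
begin

lemma dens_halves:
  assumes "U \<subseteq> W"
  shows "dens W U = (dens H (slice H 0 U) + dens H (slice H g U)) / 2"
  using card_slices[OF assms] by (simp add: dens_def card_W add_divide_distrib)

lemma char_bias:
  assumes "U \<subseteq> W"
  shows "(\<Sum>x\<in>U. \<chi> x) = (dens H (slice H 0 U) - dens H (slice H g U)) / 2 * card W"
  using char_slices[OF assms] subgrpD(4)[OF subgrp_H] by (simp add: dens_def card_W diff_divide_distrib[symmetric])

lemma schur_triples_children:
  assumes "config W X Y Z A"
  shows "card (schur_triples X Y Z) / (real (card W))\<^sup>2
    = (card (schur_triples (slice H 0 X) (slice H 0 Y) (slice H 0 Z)) / (real (card H))\<^sup>2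
     + card (schur_triples (slice H 0 X) (slice H g Y) (slice H g Z)) / (real (card H))\<^sup>2
     + card (schur_triples (slice H g X) (slice H 0 Y) (slice H g Z)) / (real (card H))\<^sup>2
     + card (schur_triples (slice H g X) (slice H g Y) (slice H 0 Z)) / (real (card H))\<^sup>2) / 4"
proof -
  have "schur_triples X Y Z \<subseteq> W \<times> W" using assms by (auto simp: config_def schur_triples_def)
  from card_slices2[OF this] show ?thesis
    unfolding slice2_schur_triples[OF subgrp_H] by (simp add: card_W power_mult_distrib add_divide_distrib)
qed

lemma card_children:
  assumes "config W X Y Z A"
  shows "card A / (real (card W))\<^sup>2
    = (card (slice2 H 0 0 A) / (real (card H))\<^sup>2 + card (slice2 H 0 g A) / (real (card H))\<^sup>2
     + card (slice2 H g 0 A) / (real (card H))\<^sup>2 + card (slice2 H g g A) / (real (card H))\<^sup>2) / 4"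
proof -
  have "A \<subseteq> W \<times> W" using assms by (auto simp: config_def)
  from card_slices2[OF this] show ?thesis
    by (simp add: card_W power_mult_distrib add_divide_distrib)
qed

text \<open>Any two of the three sides run through all four combinations of cosets exactly once, the
  third coset being determined; therefore products of two densities average to the product of the
  averages.\<close>

lemma cell_bound_children:
  assumes "config W X Y Z A"
  shows "cell_bound \<eta> ux uy uz \<theta> W X Y Z
    = (cell_bound \<eta> ux uy uz \<theta> H (slice H 0 X) (slice H 0 Y) (slice H 0 Z)
     + cell_bound \<eta> ux uy uz \<theta> H (slice H 0 X) (slice H g Y) (slice H g Z)
     + cell_bound \<eta> ux uy uz \<theta> H (slice H g X) (slice H 0 Y) (slice H g Z)
     + cell_bound \<eta> ux uy uz \<theta> H (slice H g X) (slice H g Y) (slice H 0 Z)) / 4"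
proof -
  have sub: "X \<subseteq> W" "Y \<subseteq> W" "Z \<subseteq> W" using assms by (auto simp: config_def)
  show ?thesis
    unfolding cell_bound_def schur_triples_children[OF assms] dens_halves[OF sub(1)]
      dens_halves[OF sub(2)] dens_halves[OF sub(3)]
    by (simp add: field_simps)
qed

text \<open>Each slice occurs in two of the four children, so the gain is given by the parallelogram
  identity: it is the square of half the difference of the two slice densities, which is the
  normalised character sum.\<close>

lemma energy_increment:
  fixes \<eta> :: real
  assumes c: "config W X Y Z A" and \<eta>: "0 < \<eta>"
    and bias: "\<eta> * card W < \<bar>\<Sum>x\<in>X. \<chi> x\<bar> \<or> \<eta> * card W < \<bar>\<Sum>x\<in>Y. \<chi> x\<bar> \<or> \<eta> * card W < \<bar>\<Sum>x\<in>Z. \<chi> x\<bar>"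
  shows "energy W X Y Z + \<eta>\<^sup>2
    \<le> (energy H (slice H 0 X) (slice H 0 Y) (slice H 0 Z)
     + energy H (slice H 0 X) (slice H g Y) (slice H g Z)
     + energy H (slice H g X) (slice H 0 Y) (slice H g Z)
     + energy H (slice H g X) (slice H g Y) (slice H 0 Z)) / 4"
proof -
  have sub: "X \<subseteq> W" "Y \<subseteq> W" "Z \<subseteq> W" using c by (auto simp: config_def)
  define b where "b U = (dens H (slice H 0 U) - dens H (slice H g U)) / 2" for U
  have e: "(dens H (slice H 0 U))\<^sup>2 + (dens H (slice H g U))\<^sup>2 = 2 * (dens W U)\<^sup>2 + 2 * (b U)\<^sup>2"
    if "U \<subseteq> W" for U
    unfolding dens_halves[OF that] b_def by (simp add: power2_eq_square field_simps)
  have big: "\<eta>\<^sup>2 \<le> (b U)\<^sup>2" if "U \<subseteq> W" "\<eta> * card W < \<bar>\<Sum>x\<in>U. \<chi> x\<bar>" for U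
  proof -
    have "\<eta> * card W < \<bar>b U\<bar> * card W"
      using that(2) unfolding char_bias[OF that(1)] b_def[symmetric] by (simp add: abs_mult)
    then have "\<eta> < \<bar>b U\<bar>" using subgrpD(4)[OF W] by simp
    then show ?thesis using \<eta> by (simp add: abs_le_square_iff[symmetric])
  qed
  have "\<eta>\<^sup>2 \<le> (b X)\<^sup>2 + (b Y)\<^sup>2 + (b Z)\<^sup>2"
    using bias big[OF sub(1)] big[OF sub(2)] big[OF sub(3)]
    by (smt (verit) zero_le_power2)
  then show ?thesis
    using e[OF sub(1)] e[OF sub(2)] e[OF sub(3)] unfolding energy_def by simp
qed

end

lemma nonuniform_char:
  fixes \<eta> :: real
  assumes "subgrp W" "X \<subseteq> W" "0 \<le> \<eta>" "\<not> uniform W \<eta> X"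
  obtains \<chi> where "\<chi> \<in> chars W" "\<chi> \<noteq> triv W" "\<eta> * card W < \<bar>\<Sum>x\<in>X. \<chi> x\<bar>"
  using uniform_if_fourier[OF assms(1-3)] assms(4) by (meson not_le)

text \<open>Arithmetic of one cut, with \<open>D\<close> for 3 minus the energy and \<open>h\<close>
  for \<open>\<eta>\<^sup>2\<close>: on average the children have at most \<open>D - h\<close> left
  and one cut fewer.\<close>

lemma min_step:
  fixes D h m :: real
  assumes "0 < h" "m \<le> 1" "m \<le> (D - h) / (h * (real R + 1))"
  shows "m \<le> min 1 (D / (h * (real R + 2)))"
proof (cases "h * (real R + 2) \<le> D")
  case True
  then have "1 \<le> D / (h * (real R + 2))" using assms(1) by (simp add: pos_le_divide_eq)
  then show ?thesis using assms(2) by linarith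
next
  case False
  have "(D - h) * (real R + 2) \<le> D * (real R + 1)" using False by (simp add: algebra_simps)
  then have "D - h \<le> D * (real R + 1) / (real R + 2)" by (simp add: pos_le_divide_eq)
  also have "\<dots> = D / (h * (real R + 2)) * (h * (real R + 1))" using assms(1) by simp
  finally have "(D - h) / (h * (real R + 1)) \<le> D / (h * (real R + 2))"
    using assms(1) by (subst pos_divide_le_eq) auto
  then show ?thesis using assms(2,3) by simp
qed

lemma uniform_cell:
  fixes \<eta> ux uy uz \<theta> :: real and W :: "'a::elementary_2_group set"
  assumes \<eta>: "0 < \<eta>" and \<theta>: "0 \<le> \<theta>" "\<theta> \<le> 2" and u: "0 \<le> ux" "0 \<le> uy" "0 \<le> uz"
    and c: "config W X Y Z A" and U: "uniform W \<eta> X" "uniform W \<eta> Y" "uniform W \<eta> Z"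
  shows "(\<exists>(W' :: 'a set) X' Y' Z' A'. good_cell \<eta> ux uy uz \<theta> W' X' Y' Z' A' \<and> card W \<le> 2 ^ R * card W') \<or>
    card A / (real (card W))\<^sup>2
      \<le> cell_bound \<eta> ux uy uz \<theta> W X Y Z + min 1 ((3 - energy W X Y Z) / (\<eta>\<^sup>2 * (real R + 1)))"
proof (cases "good_cell \<eta> ux uy uz \<theta> W X Y Z A")
  case True
  moreover have "card W \<le> 2 ^ R * card W" by simp
  ultimately show ?thesis by blast
next
  case False
  have "0 \<le> min 1 ((3 - energy W X Y Z) / (\<eta>\<^sup>2 * (real R + 1)))" using energy_le[OF c] by simp
  then show ?thesis using uniform_cell_bound[OF c U \<theta> u False] by linarith
qed

text \<open>A cell that is not uniform is cut into four by a biased character, and on average over the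
  four children the energy goes up by \<open>\<eta>\<^sup>2\<close>; so only a proportion \<open>3 / (\<eta>\<^sup>2 (R + 1))\<close> of the points
  lies in cells that are still not uniform after \<open>R\<close> cuts. All terms of \<open>cell_bound\<close> are
  preserved exactly by averaging over the children.\<close>

lemma uniformise:
  fixes \<eta> ux uy uz \<theta> :: real and W :: "'a::elementary_2_group set"
  assumes \<eta>: "0 < \<eta>" and \<theta>: "0 \<le> \<theta>" "\<theta> \<le> 2" and u: "0 \<le> ux" "0 \<le> uy" "0 \<le> uz"
    and c: "config W X Y Z A"
  shows "(\<exists>(W' :: 'a set) X' Y' Z' A'. good_cell \<eta> ux uy uz \<theta> W' X' Y' Z' A' \<and> card W \<le> 2 ^ R * card W') \<or>
    card A / (real (card W))\<^sup>2
      \<le> cell_bound \<eta> ux uy uz \<theta> W X Y Z + min 1 ((3 - energy W X Y Z) / (\<eta>\<^sup>2 * (real R + 1)))"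
  using c
proof (induction R arbitrary: W X Y Z A)
  case (0 W X Y Z A)
  have W: "subgrp W" and sub: "X \<subseteq> W" "Y \<subseteq> W" "Z \<subseteq> W" using 0 by (auto simp: config_def)
  show ?case
  proof (cases "uniform W \<eta> X \<and> uniform W \<eta> Y \<and> uniform W \<eta> Z")
    case True
    then show ?thesis using uniform_cell[OF \<eta> \<theta> u 0] by blast
  next
    case False
    then obtain \<chi> where \<chi>: "\<chi> \<in> chars W" "\<chi> \<noteq> triv W"
      and b: "\<eta> * card W < \<bar>\<Sum>x\<in>X. \<chi> x\<bar> \<or> \<eta> * card W < \<bar>\<Sum>x\<in>Y. \<chi> x\<bar> \<or> \<eta> * card W < \<bar>\<Sum>x\<in>Z. \<chi> x\<bar>"
      using nonuniform_char[OF W _ less_imp_le[OF \<eta>]] sub by metis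
    obtain g where g: "g \<in> W" "\<chi> g = -1" using char_nontriv[OF \<chi>] by blast
    define H where "H = {x\<in>W. \<chi> x = 1}"
    interpret index_two W H \<chi> g by unfold_locales (use W \<chi> g H_def in auto)
    note cs = config_slice[OF 0 subgrp_H]
    \<comment> \<open>A cut would raise the average energy, which is at most 3, so a non-uniform
      cell has at least \<open>\<eta>\<^sup>2\<close> left. The minimum is then 1, and the trivial
      density bound suffices when no cuts remain.\<close>
    have "energy W X Y Z + \<eta>\<^sup>2 \<le> 3"
      using energy_increment[OF 0 \<eta> b] energy_le[OF cs[of 0 0]] energy_le[OF cs[of 0 g]]
        energy_le[OF cs[of g 0]] energy_le[OF cs[of g g]] by simp
    then have t: "1 \<le> (3 - energy W X Y Z) / (\<eta>\<^sup>2 * (real 0 + 1))" using \<eta> by (simp add: pos_le_divide_eq)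
    have "A \<subseteq> W \<times> W" using 0 by (auto simp: config_def)
    then have "card A \<le> card (W \<times> W)" using subgrpD(1)[OF W] by (intro card_mono) auto
    then have "real (card A) \<le> (real (card W))\<^sup>2"
      by (simp add: card_cartesian_product power2_eq_square flip: of_nat_mult)
    then have "card A / (real (card W))\<^sup>2 \<le> 1" by (simp add: divide_le_eq)
    moreover have "0 \<le> cell_bound \<eta> ux uy uz \<theta> W X Y Z"
      using \<eta> \<theta> u by (simp add: cell_bound_def dens_nonneg)
    ultimately show ?thesis using t by linarith
  qed
next
  case (Suc R W X Y Z A)
  have W: "subgrp W" and sub: "X \<subseteq> W" "Y \<subseteq> W" "Z \<subseteq> W" using Suc.prems by (auto simp: config_def)
  show ?case
  proof (cases "uniform W \<eta> X \<and> uniform W \<eta> Y \<and> uniform W \<eta> Z")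
    case True
    then show ?thesis using uniform_cell[OF \<eta> \<theta> u Suc.prems] by blast
  next
    case False
    then obtain \<chi> where \<chi>: "\<chi> \<in> chars W" "\<chi> \<noteq> triv W"
      and b: "\<eta> * card W < \<bar>\<Sum>x\<in>X. \<chi> x\<bar> \<or> \<eta> * card W < \<bar>\<Sum>x\<in>Y. \<chi> x\<bar> \<or> \<eta> * card W < \<bar>\<Sum>x\<in>Z. \<chi> x\<bar>"
      using nonuniform_char[OF W _ less_imp_le[OF \<eta>]] sub by metis
    obtain g where g: "g \<in> W" "\<chi> g = -1" using char_nontriv[OF \<chi>] by blast
    define H where "H = {x\<in>W. \<chi> x = 1}"
    interpret index_two W H \<chi> g by unfold_locales (use W \<chi> g H_def in auto)
    note cs = config_slice[OF Suc.prems subgrp_H]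
    show ?thesis
    proof (subst disj_commute, rule disjCI)
      assume neg: "\<not> (\<exists>(W' :: 'a set) X' Y' Z' A'. good_cell \<eta> ux uy uz \<theta> W' X' Y' Z' A' \<and> card W \<le> 2 ^ Suc R * card W')"
      define t where "t i j = (3 - energy H (slice H i X) (slice H j Y) (slice H (i + j) Z)) / (\<eta>\<^sup>2 * (real R + 1))" for i j
      have child: "card (slice2 H i j A) / (real (card H))\<^sup>2
          \<le> cell_bound \<eta> ux uy uz \<theta> H (slice H i X) (slice H j Y) (slice H (i + j) Z) + min 1 (t i j)" for i j
      proof -
        have "card W \<le> 2 ^ Suc R * card W'" if "card H \<le> 2 ^ R * card W'" for W' :: "'a set"
          using that by (simp add: card_W)
        then show ?thesis using Suc.IH[OF cs[of i j]] neg unfolding t_def by blast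
      qed
      define m where "m = (min 1 (t 0 0) + min 1 (t 0 g) + min 1 (t g 0) + min 1 (t g g)) / 4"
      have "card A / (real (card W))\<^sup>2 \<le> cell_bound \<eta> ux uy uz \<theta> W X Y Z + m"
      proof -
        have avg: "a \<le> p + u \<Longrightarrow> b \<le> q + v \<Longrightarrow> c \<le> r + w \<Longrightarrow> d \<le> s + x \<Longrightarrow>
            (a + b + c + d) / 4 \<le> (p + q + r + s) / 4 + (u + v + w + x) / 4"
          for a b c d p q r s u v w x :: real by argo
        show ?thesis
          using child[of 0 0] child[of 0 g] child[of g 0] child[of g g]
          unfolding card_children[OF Suc.prems] cell_bound_children[OF Suc.prems] m_def
            add_0_left add_0_right add_self
          by (rule avg)
      qed
      moreover have "m \<le> min 1 ((3 - energy W X Y Z) / (\<eta>\<^sup>2 * (real R + 2)))"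
      proof (rule min_step)
        show "m \<le> 1" by (simp add: m_def)
        have "m \<le> (t 0 0 + t 0 g + t g 0 + t g g) / 4" by (simp add: m_def)
        also have "\<dots> = (3 - (energy H (slice H 0 X) (slice H 0 Y) (slice H 0 Z)
            + energy H (slice H 0 X) (slice H g Y) (slice H g Z)
            + energy H (slice H g X) (slice H 0 Y) (slice H g Z)
            + energy H (slice H g X) (slice H g Y) (slice H 0 Z)) / 4) / (\<eta>\<^sup>2 * (real R + 1))"
        proof -
          have "((3 - a) / q + (3 - b) / q + (3 - c) / q + (3 - d) / q) / 4 = (3 - (a + b + c + d) / 4) / q"
            for a b c d q :: real by (simp add: diff_divide_distrib add_divide_distrib)
          then show ?thesis unfolding t_def add_0_left add_0_right add_self .
        qed
        also have "\<dots> \<le> (3 - energy W X Y Z - \<eta>\<^sup>2) / (\<eta>\<^sup>2 * (real R + 1))"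
          using energy_increment[OF Suc.prems \<eta> b] by (intro divide_right_mono) (linarith, simp)
        finally show "m \<le> (3 - energy W X Y Z - \<eta>\<^sup>2) / (\<eta>\<^sup>2 * (real R + 1))" .
      qed (use \<eta> in auto)
      ultimately show "card A / (real (card W))\<^sup>2 \<le> cell_bound \<eta> ux uy uz \<theta> W X Y Z
          + min 1 ((3 - energy W X Y Z) / (\<eta>\<^sup>2 * (real (Suc R) + 1)))"
      proof -
        have "real (Suc R) + 1 = real R + 2" by simp
        then show "card A / (real (card W))\<^sup>2 \<le> cell_bound \<eta> ux uy uz \<theta> W X Y Z + m \<Longrightarrow>
          m \<le> min 1 ((3 - energy W X Y Z) / (\<eta>\<^sup>2 * (real R + 2))) \<Longrightarrow> ?thesis"
          by (simp only:)
      qed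
    qed
  qed
qed

section \<open>Parameters and iteration\<close>

lemma half_power_le:
  fixes m n :: nat
  shows "m \<le> n \<Longrightarrow> (1 / 2 :: real) ^ n \<le> (1 / 2) ^ m"
  by (rule power_decreasing) auto

section \<open>Numerical conditions with \<open>k = 64 * t\<close> and
  \<open>j = 64 * t - 1\<close>\<close>

context
  fixes t :: nat and \<alpha> \<rho> \<sigma> \<eta> :: real
  assumes t: "1 \<le> t" and \<alpha>: "(1 / 2) ^ t \<le> \<alpha>"
    and \<rho>: "\<rho> = (1 / 2) ^ (600 * t\<^sup>2)" and \<sigma>: "0 < \<sigma>" "\<sigma> \<le> 1"
    and \<eta>: "\<eta> = (\<rho> * \<sigma>) ^ (400 * t)"
begin

lemma parameters_pos: "0 < \<alpha>" "0 < \<rho>" "\<rho> \<le> 1" "0 < \<eta>"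
proof -
  show "0 < \<alpha>" using \<alpha> by (rule less_le_trans[rotated]) simp
  show "0 < \<rho>" "\<rho> \<le> 1" by (simp_all add: \<rho> power_le_one)
  then show "0 < \<eta>" using \<sigma> by (simp add: \<eta>)
qed

lemma t_sq: "t \<le> t\<^sup>2" "1 \<le> t\<^sup>2" using t by (auto simp: power2_eq_square)

lemma alpha_power: "(1 / 2) ^ (t * n) \<le> \<alpha> ^ n"
  unfolding power_mult using \<alpha> by (intro power_mono) auto

text \<open>The exponent \<open>400 * t\<close> exceeds all exponents of \<open>\<sigma>\<close> in
  the conditions, the largest being \<open>4 * (64 * t) + 4\<close>.\<close>

lemma eta_le:
  assumes "n \<le> 400 * t" "l \<le> 400 * t"
  shows "\<eta> \<le> \<rho> ^ l * \<sigma> ^ n"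
  unfolding \<eta> power_mult_distrib
  using assms parameters_pos \<sigma> by (intro mult_mono power_decreasing) auto

lemma rho_le: "n \<le> 600 * t\<^sup>2 \<Longrightarrow> \<rho> \<le> (1 / 2) ^ n"
  unfolding \<rho> by (rule half_power_le)

text \<open>The proportion \<open>r\<close> of pairs with large codegree in
  \<open>sift\<close>.\<close>

definition "pair_density = (\<alpha>\<^sup>2 / 3) ^ (2 * (64 * t))"

text \<open>As \<open>\<alpha>\<^sup>2 / 3\<close> is at least 2^-(2t + 2), the exponent required is
  256 t^2 + 256 t + 2, at most 514 t^2. This is the heaviest demand on the exponent
  \<open>600 * t\<^sup>2\<close> of \<open>\<rho>\<close>.\<close>

lemma pair_density_ge: "4 * \<rho> \<le> pair_density"
proof -
  define q where "q = 600 * t\<^sup>2 - 2"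
  have q: "600 * t\<^sup>2 = q + 2" using t_sq by (simp add: q_def)
  have "4 * \<rho> = (1 / 2) ^ q"
    unfolding \<rho> q power_add by (simp add: power2_eq_square)
  also have "\<dots> \<le> (1 / 2) ^ ((2 * t + 2) * (2 * (64 * t)))"
  proof (rule half_power_le)
    have "(2 * t + 2) * (2 * (64 * t)) = 256 * t\<^sup>2 + 256 * t" by (simp add: algebra_simps power2_eq_square)
    then show "(2 * t + 2) * (2 * (64 * t)) \<le> q" using t_sq q by linarith
  qed
  also have "\<dots> = ((1 / 2) ^ (t * 2) / 4) ^ (2 * (64 * t))"
    unfolding power_mult[of _ "2 * t + 2"] by (simp add: power_add mult.commute)
  also have "\<dots> \<le> pair_density"
    unfolding pair_density_def using alpha_power[of 2] parameters_pos by (intro power_mono frac_le) auto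
  finally show ?thesis .
qed

lemma pair_density_pos: "0 < pair_density" using pair_density_ge parameters_pos by linarith

lemma binomial_condition: "real (64 * t) \<le> 1.08 ^ (2 * (64 * t)) * (0.15 * \<alpha>)"
proof -
  have "real t \<le> 2 ^ t" by (simp add: less_imp_le)
  then have "real (64 * t) * 8 * 2 ^ t \<le> 2 ^ 9 * 2 ^ t * 2 ^ t" by simp
  also have "\<dots> = 2 ^ (9 + t + t)" by (simp only: power_add)
  also have "\<dots> \<le> 2 ^ (14 * t)" using t by (intro power_increasing) auto
  also have "\<dots> = (2 ^ 14) ^ t" by (rule power_mult)
  also have "\<dots> \<le> (1.08 ^ 128) ^ t" by (intro power_mono) (simp_all add: power_divide)
  also have "\<dots> = 1.08 ^ (2 * (64 * t))" by (simp only: power_mult[symmetric]) simp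
  finally have "real (64 * t) \<le> 1.08 ^ (2 * (64 * t)) * (1 / 8 * (1 / 2) ^ t)"
    by (simp add: field_simps power_divide)
  also have "\<dots> \<le> 1.08 ^ (2 * (64 * t)) * (0.15 * \<alpha>)"
    using \<alpha> parameters_pos by (intro mult_left_mono mult_mono) auto
  finally show ?thesis .
qed

lemma codegree_condition: "2 * \<eta> \<le> \<sigma> ^ (4 * (64 * t) + 4) * \<alpha> ^ (4 * (64 * t))"
proof -
  have "2 * \<eta> \<le> 2 * (\<rho> ^ 1 * \<sigma> ^ (4 * (64 * t) + 4))" using t by (intro mult_left_mono eta_le) auto
  also have "\<dots> = \<sigma> ^ (4 * (64 * t) + 4) * (2 * \<rho>)" by simp
  also have "\<dots> \<le> \<sigma> ^ (4 * (64 * t) + 4) * \<alpha> ^ (4 * (64 * t))"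
  proof (intro mult_left_mono)
    have "2 * \<rho> \<le> 2 * (1 / 2) ^ Suc (t * (4 * (64 * t)))"
      using t_sq by (intro mult_left_mono rho_le) (auto simp: power2_eq_square)
    also have "\<dots> \<le> \<alpha> ^ (4 * (64 * t))" using alpha_power[of "4 * (64 * t)"] by simp
    finally show "2 * \<rho> \<le> \<alpha> ^ (4 * (64 * t))" .
  qed (use \<sigma> in auto)
  finally show ?thesis .
qed

lemma transfer_condition:
  "\<eta> * (2 / (\<sigma> * pair_density)) ^ (64 * t) \<le> 0.001 * \<alpha> ^ (64 * t + 1) * \<sigma> ^ 3 * pair_density"
proof -
  define m where "m = 64 * t"
  have "\<eta> * 2 ^ m \<le> (\<rho> ^ (m + 2) * \<sigma> ^ (m + 3)) * 2 ^ m"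
    using t by (intro mult_right_mono eta_le) (auto simp: m_def)
  also have "\<dots> = (\<rho> * 2 ^ m) * (\<rho> ^ (m + 1) * \<sigma> ^ (m + 3))" by (simp add: power_add)
  also have "\<dots> \<le> (0.001 * \<alpha> ^ (m + 1)) * (pair_density ^ (m + 1) * \<sigma> ^ (m + 3))"
  proof (rule mult_mono)
    have "10 + t * (m + 1) + m = 10 + 64 * t\<^sup>2 + 65 * t"
      by (simp add: m_def algebra_simps power2_eq_square)
    then have "10 + t * (m + 1) + m \<le> 600 * t\<^sup>2" using t_sq by linarith
    then have "\<rho> * 2 ^ m \<le> (1 / 2) ^ (10 + t * (m + 1) + m) * 2 ^ m"
      by (intro mult_right_mono rho_le) auto
    also have "\<dots> = (1 / 2) ^ 10 * (1 / 2) ^ (t * (m + 1)) * ((1 / 2) ^ m * 2 ^ m)" by (simp add: power_add)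
    also have "\<dots> = (1 / 2) ^ 10 * (1 / 2) ^ (t * (m + 1))" by (simp add: power_mult_distrib[symmetric])
    also have "\<dots> \<le> 0.001 * \<alpha> ^ (m + 1)"
      using parameters_pos by (intro mult_mono alpha_power) (auto simp: power_divide)
    finally show "\<rho> * 2 ^ m \<le> 0.001 * \<alpha> ^ (m + 1)" .
    have "\<rho> \<le> pair_density" using pair_density_ge parameters_pos by simp
    then show "\<rho> ^ (m + 1) * \<sigma> ^ (m + 3) \<le> pair_density ^ (m + 1) * \<sigma> ^ (m + 3)"
      using parameters_pos \<sigma> by (intro mult_right_mono power_mono) auto
  qed (use parameters_pos \<sigma> in auto)
  finally have "\<eta> * 2 ^ m \<le> (0.001 * \<alpha> ^ (m + 1) * \<sigma> ^ 3 * pair_density) * (\<sigma> * pair_density) ^ m"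
    by (simp add: power_add power_mult_distrib mult_ac)
  then show ?thesis
    unfolding m_def[symmetric] power_divide times_divide_eq_right
    using \<sigma> pair_density_pos by (subst pos_divide_le_eq) auto
qed

text \<open>Only the ratio 13 / 12 of 1.3 to 1.2 matters: its 64th power exceeds 128 = 64 * 2, where
  the powers of 2 cover 1 / \<open>\<alpha>\<close> and 64 covers the constants.\<close>

lemma moment_condition: "1.2 ^ (64 * t) + 2 \<le> 1.3 ^ (64 * t - 1) * (0.08 * \<alpha>)"
proof -
  define m where "m = 64 * t"
  have m: "m = Suc (m - 1)" using t by (simp add: m_def)
  have b: "(2::real) \<le> 1.2 ^ m"
  proof -
    have "(2::real) \<le> 1.2 ^ 64" by (simp add: power_divide)
    also have "\<dots> \<le> 1.2 ^ m" using t by (intro power_increasing) (auto simp: m_def)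
    finally show ?thesis .
  qed
  have "(64::real) \<le> 64 ^ t" using power_increasing[of 1 t "64::real"] t by simp
  then have "(64::real) * 2 ^ t \<le> 64 ^ t * 2 ^ t" by simp
  also have "\<dots> = (128::real) ^ t" by (simp add: power_mult_distrib[symmetric])
  also have "\<dots> \<le> ((13 / 12) ^ 64) ^ t" by (intro power_mono) (simp_all add: power_divide)
  also have "\<dots> = (13 / 12) ^ m" by (simp add: m_def power_mult)
  finally have "64 * 1.2 ^ m \<le> ((13 / 12) ^ m * 1.2 ^ m) * (1 / 2 :: real) ^ t"
    by (simp add: field_simps power_divide)
  also have "(13 / 12) ^ m * 1.2 ^ m = (1.3::real) ^ m" by (simp add: power_mult_distrib[symmetric])
  also have "(1.3::real) ^ m * (1 / 2) ^ t \<le> 1.3 ^ m * \<alpha>" using \<alpha> by (intro mult_left_mono) auto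
  finally have "64 * 1.2 ^ m \<le> 1.3 * (1.3 ^ (m - 1) * \<alpha>)" by (subst (asm) (2) m) simp
  then have "1.2 ^ m + 2 \<le> 1.3 ^ (m - 1) * (0.08 * \<alpha>)" using b by simp
  then show ?thesis by (simp add: m_def)
qed

lemma large_phi_condition: "2 * \<eta> \<le> \<alpha> ^ (64 * t) * \<sigma> ^ (64 * t + 3) * pair_density"
proof -
  have "2 * \<eta> \<le> 2 * (\<rho> ^ 2 * \<sigma> ^ (64 * t + 3))" using t by (intro mult_left_mono eta_le) auto
  also have "\<dots> = (2 * \<rho>) * \<sigma> ^ (64 * t + 3) * \<rho>" by (simp add: power2_eq_square)
  also have "\<dots> \<le> \<alpha> ^ (64 * t) * \<sigma> ^ (64 * t + 3) * pair_density"
  proof (intro mult_mono order_refl)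
    have "2 * \<rho> \<le> 2 * (1 / 2) ^ Suc (t * (64 * t))"
      using t_sq by (intro mult_left_mono rho_le) (auto simp: power2_eq_square)
    also have "\<dots> \<le> \<alpha> ^ (64 * t)" using alpha_power[of "64 * t"] by simp
    finally show "2 * \<rho> \<le> \<alpha> ^ (64 * t)" .
    show "\<rho> \<le> pair_density" using pair_density_ge parameters_pos by simp
  qed (use parameters_pos \<sigma> in auto)
  finally show ?thesis .
qed

lemma row_condition: "\<rho> * 2 ^ (64 * t) \<le> \<alpha> ^ (64 * t)"
proof -
  have "\<rho> * 2 ^ (64 * t) \<le> (1 / 2) ^ (t * (64 * t) + 64 * t) * 2 ^ (64 * t)"
    using t_sq by (intro mult_right_mono rho_le) (auto simp: power2_eq_square)
  also have "\<dots> = (1 / 2) ^ (t * (64 * t)) * ((1 / 2) ^ (64 * t) * 2 ^ (64 * t))" by (simp add: power_add)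
  also have "\<dots> = (1 / 2) ^ (t * (64 * t))" by (simp add: power_mult_distrib[symmetric])
  also have "\<dots> \<le> \<alpha> ^ (64 * t)" by (rule alpha_power)
  finally show ?thesis .
qed

lemma rho_small: "8 * \<rho> \<le> 0.001 * \<alpha>"
proof -
  have "8 * \<rho> \<le> 8 * (1 / 2) ^ (13 + t)"
    using t_sq t by (intro mult_left_mono rho_le) auto
  also have "\<dots> = (8 * (1 / 2) ^ 13) * (1 / 2) ^ t" by (simp only: power_add mult.assoc)
  also have "\<dots> \<le> 0.001 * (1 / 2) ^ t" by (intro mult_right_mono) (simp_all add: power_divide)
  also have "\<dots> \<le> 0.001 * \<alpha>" using \<alpha> by simp
  finally show ?thesis .
qed

lemma card_condition:
  assumes "1 / \<eta> \<le> N"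
  shows "2 * real (64 * t) \<le> 0.81 * \<alpha>\<^sup>2 * \<sigma> ^ 3 * N"
proof -
  have "2 * real (64 * t) * \<eta> \<le> 2 * real (64 * t) * (\<rho> ^ 1 * \<sigma> ^ 3)"
    using t by (intro mult_left_mono eta_le) auto
  also have "\<dots> = (128 * real t * \<rho>) * \<sigma> ^ 3" by simp
  also have "\<dots> \<le> (0.81 * \<alpha>\<^sup>2) * \<sigma> ^ 3"
  proof (intro mult_right_mono)
    have "128 * real t * \<rho> \<le> 128 * 2 ^ t * (1 / 2) ^ (8 + t + t * 2)"
      using t_sq t parameters_pos by (intro mult_mono rho_le) (auto intro: less_imp_le of_nat_less_two_power)
    also have "\<dots> = (128 * (1 / 2) ^ 8) * (2 ^ t * (1 / 2) ^ t) * (1 / 2) ^ (t * 2)"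
      by (simp only: power_add mult_ac)
    also have "\<dots> = (1 / 2) * (1 / 2) ^ (t * 2)"
      unfolding power_mult_distrib[symmetric] by (simp add: power_divide)
    also have "\<dots> \<le> 0.81 * \<alpha>\<^sup>2" using alpha_power[of 2] by (intro mult_mono) auto
    finally show "128 * real t * \<rho> \<le> 0.81 * \<alpha>\<^sup>2" .
  qed (use \<sigma> in auto)
  finally have "2 * real (64 * t) \<le> 0.81 * \<alpha>\<^sup>2 * \<sigma> ^ 3 * (1 / \<eta>)"
    using parameters_pos by (simp add: pos_le_divide_eq)
  also have "\<dots> \<le> 0.81 * \<alpha>\<^sup>2 * \<sigma> ^ 3 * N" using assms \<sigma> by (intro mult_left_mono) auto
  finally show ?thesis .
qed

lemma kernel_condition: "\<eta> * (2 / (\<alpha> * \<sigma>)) ^ (2 * (64 * t)) \<le> 0.1 * \<alpha> * \<sigma> ^ 3"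
proof -
  define m where "m = 2 * (64 * t)"
  have "\<eta> * 2 ^ m \<le> (\<rho> ^ 1 * \<sigma> ^ (m + 3)) * 2 ^ m"
    using t by (intro mult_right_mono eta_le) (auto simp: m_def)
  also have "\<dots> = (\<rho> * 2 ^ m) * \<sigma> ^ (m + 3)" by simp
  also have "\<dots> \<le> (0.1 * \<alpha> ^ (m + 1)) * \<sigma> ^ (m + 3)"
  proof (intro mult_right_mono)
    have "4 + t * (m + 1) + m = 4 + 128 * t\<^sup>2 + 129 * t"
      by (simp add: m_def algebra_simps power2_eq_square)
    then have "4 + t * (m + 1) + m \<le> 600 * t\<^sup>2" using t_sq by linarith
    then have "\<rho> * 2 ^ m \<le> (1 / 2) ^ (4 + t * (m + 1) + m) * 2 ^ m"
      by (intro mult_right_mono rho_le) auto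
    also have "\<dots> = (1 / 2) ^ 4 * (1 / 2) ^ (t * (m + 1)) * ((1 / 2) ^ m * 2 ^ m)" by (simp add: power_add)
    also have "\<dots> = (1 / 2) ^ 4 * (1 / 2) ^ (t * (m + 1))" by (simp add: power_mult_distrib[symmetric])
    also have "\<dots> \<le> 0.1 * \<alpha> ^ (m + 1)"
      using parameters_pos by (intro mult_mono alpha_power) (auto simp: power_divide)
    finally show "\<rho> * 2 ^ m \<le> 0.1 * \<alpha> ^ (m + 1)" .
  qed (use \<sigma> in auto)
  finally have "\<eta> * 2 ^ m \<le> (0.1 * \<alpha> * \<sigma> ^ 3) * (\<alpha> * \<sigma>) ^ m"
    by (simp add: power_add power_mult_distrib mult_ac)
  then show ?thesis
    unfolding m_def[symmetric] power_divide times_divide_eq_right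
    using \<sigma> parameters_pos by (subst pos_divide_le_eq) auto
qed

lemma degree_condition: "\<rho> + \<eta> / \<sigma> ^ 3 \<le> 0.001 * \<alpha>"
proof -
  have "\<eta> \<le> \<rho> ^ 1 * \<sigma> ^ 3" using t by (intro eta_le) auto
  then have "\<eta> / \<sigma> ^ 3 \<le> \<rho>" using \<sigma> by (simp add: pos_divide_le_eq)
  then show ?thesis using rho_small parameters_pos by linarith
qed

lemma eta_final: "8 * \<eta> \<le> 0.001 * \<alpha> * (\<rho>\<^sup>2 * \<sigma> ^ 3)"
proof -
  have "8 * \<eta> \<le> 8 * (\<rho> ^ 3 * \<sigma> ^ 3)" using t by (intro mult_left_mono eta_le) auto
  also have "\<dots> = (8 * \<rho>) * (\<rho>\<^sup>2 * \<sigma> ^ 3)" by (simp add: power2_eq_square power3_eq_cube)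
  also have "\<dots> \<le> (0.001 * \<alpha>) * (\<rho>\<^sup>2 * \<sigma> ^ 3)" using rho_small \<sigma> by (intro mult_right_mono) auto
  finally show ?thesis .
qed

text \<open>The left side is the loss in the density bound per step: \<open>\<rho>\<close> from the
  rectangle and \<open>0.001 * \<alpha>\<close> from the thresholds used in uniformising.\<close>

lemma kappa_le: "(1 / 2 :: real) ^ (620 * t\<^sup>2) \<le> 0.001 * \<alpha> * \<rho>"
proof -
  have "(1 / 2 :: real) ^ (620 * t\<^sup>2) \<le> (1 / 2) ^ (10 + t + 600 * t\<^sup>2)"
    using t_sq by (intro half_power_le) auto
  also have "\<dots> = (1 / 2) ^ 10 * (1 / 2) ^ t * \<rho>" by (simp add: power_add \<rho>)
  also have "\<dots> \<le> 0.001 * \<alpha> * \<rho>" using \<alpha> parameters_pos by (intro mult_mono) (auto simp: power_divide)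
  finally show ?thesis .
qed

end

definition stage :: "real \<Rightarrow> real \<Rightarrow> real \<Rightarrow> 'a::elementary_2_group set \<Rightarrow> 'a set \<Rightarrow> 'a set \<Rightarrow> 'a set \<Rightarrow> ('a \<times> 'a) set \<Rightarrow> bool" where
  "stage \<eta> s a W X Y Z A \<longleftrightarrow> config W X Y Z A \<and>
     uniform W \<eta> X \<and> uniform W \<eta> Y \<and> uniform W \<eta> Z \<and>
     s \<le> dens W X \<and> s \<le> dens W Y \<and> s \<le> dens W Z \<and>
     a * (real (card X) * card Y * card Z) \<le> real (card A) * card W"

text \<open>\<open>A\<close> consists of pairs with sum in \<open>Z\<close>, whose density is the
  product of the three densities up to \<open>\<eta>\<close>, at most half that product. This caps
  the number of increments.\<close>

lemma stage_density_le:
  fixes \<alpha> \<eta> s a :: real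
  assumes st: "stage \<eta> s a W X Y Z A" and s: "0 < s" and small: "2 * \<eta> \<le> s ^ 3"
    and \<alpha>: "real (card A) * card W = \<alpha> * card X * card Y * card Z"
  shows "\<alpha> \<le> 1.5"
proof -
  have c: "config W X Y Z A" and U: "uniform W \<eta> Z" using st by (auto simp: stage_def)
  have W: "subgrp W" and sub: "X \<subseteq> W" "Y \<subseteq> W" "Z \<subseteq> W" using c by (auto simp: config_def)
  define N where "N = real (card W)"
  have N: "N > 0" using subgrpD(4)[OF W] by (simp add: N_def)
  define p where "p = dens W X * dens W Y * dens W Z"
  have "s * s * s \<le> p" unfolding p_def using st s by (intro mult_mono) (auto simp: stage_def)
  then have "s ^ 3 \<le> p" by (simp only: power3_eq_cube)
  moreover have "0 < s ^ 3" using s by simp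
  ultimately have p: "2 * \<eta> \<le> p" "0 < p" using small by linarith+
  have "A \<subseteq> schur_triples X Y Z" using c by (auto simp: config_def schur_triples_def)
  moreover have "finite (schur_triples X Y Z)"
    by (rule finite_subset[of _ "W \<times> W"]) (use sub subgrpD(1)[OF W] in \<open>auto simp: schur_triples_def\<close>)
  ultimately have "card A \<le> card (schur_triples X Y Z)" by (rule card_mono[rotated])
  then have "card A / N\<^sup>2 \<le> card (schur_triples X Y Z) / N\<^sup>2" using N by (simp add: divide_right_mono)
  also have "\<dots> \<le> p + \<eta>" using schur_triples_uniform[OF c U] unfolding p_def N_def by linarith
  also have "\<dots> \<le> 1.5 * p" using p by simp
  also have "card A / N\<^sup>2 = \<alpha> * p"
  proof -
    have "\<alpha> * p = (\<alpha> * card X * card Y * card Z) / N ^ 3"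
      by (simp add: p_def dens_def N_def power3_eq_cube)
    also have "\<dots> = card A * N / N ^ 3" using \<alpha> by (simp add: N_def)
    also have "\<dots> = card A / N\<^sup>2" using N by (simp add: power2_eq_square power3_eq_cube)
    finally show ?thesis by simp
  qed
  finally show ?thesis using p by (simp only: mult_le_cancel_right_pos)
qed

text \<open>\<open>increment\<close> supplies a denser rectangle whose sides are no longer uniform;
  \<open>uniformise\<close> restores uniformity on a subgroup and gives back part of the
  gain.\<close>

lemma density_step:
  fixes W :: "'a::elementary_2_group set" and t R :: nat and \<rho> \<sigma> \<eta> s a :: real
  assumes t: "1 \<le> t" and \<rho>: "\<rho> = (1 / 2) ^ (600 * t\<^sup>2)" and \<sigma>: "0 < \<sigma>" "\<sigma> \<le> 1"
    and \<eta>: "\<eta> = (\<rho> * \<sigma>) ^ (400 * t)"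
    and st: "stage \<eta> s a W X Y Z A" and s: "\<sigma> \<le> s" and a: "(1 / 2) ^ t \<le> a"
    and N: "1 / \<eta> \<le> card W" and R: "1 / \<eta> ^ 3 \<le> real R + 1"
  obtains W' :: "'a set" and X' Y' Z' A' where
    "stage \<eta> ((1 / 2) ^ (620 * t\<^sup>2) * s) (1.005 * a) W' X' Y' Z' A'" "card W \<le> 2 ^ R * card W'"
proof -
  have c: "config W X Y Z A" and U: "uniform W \<eta> X" "uniform W \<eta> Y" "uniform W \<eta> Z"
    and ds: "s \<le> dens W X" "s \<le> dens W Y" "s \<le> dens W Z"
    and am: "a * (real (card X) * card Y * card Z) \<le> real (card A) * card W"
    using st by (auto simp: stage_def)
  have W: "subgrp W" and sub: "X \<subseteq> W" "Y \<subseteq> W" "Z \<subseteq> W" using c by (auto simp: config_def)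
  define n where "n = real (card W)"
  have n: "n > 0" using subgrpD(4)[OF W] by (simp add: n_def)
  have s0: "0 < s" using s \<sigma> by simp
  have cpos: "real (card X) > 0" "real (card Y) > 0" "real (card Z) > 0"
  proof -
    have "0 < real (card U)" if "s \<le> dens W U" for U
    proof -
      have "s * n \<le> card U" using that n by (simp add: dens_def n_def pos_le_divide_eq)
      then show ?thesis using mult_pos_pos[OF s0 n] by linarith
    qed
    then show "real (card X) > 0" "real (card Y) > 0" "real (card Z) > 0" using ds by blast+
  qed
  define \<alpha> where "\<alpha> = real (card A) * card W / (real (card X) * card Y * card Z)"
  have \<alpha>_eq: "real (card A) * card W = \<alpha> * card X * card Y * card Z"
    using cpos by (simp add: \<alpha>_def)
  have a\<alpha>: "a \<le> \<alpha>" using am cpos by (simp add: \<alpha>_def pos_le_divide_eq mult_ac)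
  have t\<alpha>: "(1 / 2) ^ t \<le> \<alpha>" using a a\<alpha> by linarith
  note ctx = t t\<alpha> \<rho> \<sigma> \<eta>
  note pos = parameters_pos[OF ctx]
  have ds\<sigma>: "\<sigma> \<le> dens W X" "\<sigma> \<le> dens W Y" "\<sigma> \<le> dens W Z" using ds s by auto
  have "\<eta> \<le> \<rho> ^ 1 * s ^ 3"
  proof -
    have "\<eta> \<le> \<rho> ^ 1 * \<sigma> ^ 3" using t by (intro eta_le[OF ctx]) auto
    also have "\<dots> \<le> \<rho> ^ 1 * s ^ 3" using s \<sigma> pos by (intro mult_left_mono power_mono) auto
    finally show ?thesis .
  qed
  also have "\<dots> \<le> (1 / 2) * s ^ 3"
    using rho_le[OF ctx, of 1] t_sq(2)[OF ctx] s0 by (intro mult_right_mono) auto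
  finally have "2 * \<eta> \<le> s ^ 3" by simp
  then have \<alpha>15: "\<alpha> \<le> 1.5" using stage_density_le[OF st s0 _ \<alpha>_eq] by blast
  have m: "64 * t = Suc (64 * t - 1)" and m': "64 * t - 1 + 2 = 64 * t + 1" using t by auto
  obtain Y' Z' A' S T where YZ: "(Y', Z', A') = (Y, Z, A) \<or> (Y', Z', A') = (Z, Y, shear A)"
    and ST: "S \<subseteq> X" "T \<subseteq> Y'" "\<rho> * card X \<le> card S" "\<rho> * card Y' \<le> card T"
    and inc: "1.01 * \<alpha> * dens W Z' * card S * card T \<le> card (A' \<inter> S \<times> T)"
  proof (rule increment[where k = "64 * t" and j = "64 * t - 1", OF c U \<sigma>(1) ds\<sigma> pos(1) _ \<alpha>_eq pos(2)])
    show "\<alpha> \<le> 2" using \<alpha>15 by simp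
    show "8 \<le> 64 * t" "even (64 * t)" using t by auto
    show "real (64 * t) \<le> 1.08 ^ (2 * (64 * t)) * (0.15 * \<alpha>)" by (rule binomial_condition[OF ctx])
    show "2 * \<eta> \<le> \<sigma> ^ (4 * (64 * t) + 4) * \<alpha> ^ (4 * (64 * t))" by (rule codegree_condition[OF ctx])
    show "\<rho> \<le> (\<alpha>\<^sup>2 / 3) ^ (2 * (64 * t)) / 4"
      using pair_density_ge[OF ctx] unfolding pair_density_def[OF ctx] by linarith
    show "\<eta> * (2 / (\<sigma> * (\<alpha>\<^sup>2 / 3) ^ (2 * (64 * t)))) ^ Suc (64 * t - 1)
        \<le> 0.001 * \<alpha> ^ (64 * t - 1 + 2) * \<sigma> ^ 3 * (\<alpha>\<^sup>2 / 3) ^ (2 * (64 * t))"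
      using transfer_condition[OF ctx] unfolding pair_density_def[OF ctx] m[symmetric] m' .
    show "2 * \<eta> \<le> \<alpha> ^ Suc (64 * t - 1) * \<sigma> ^ (Suc (64 * t - 1) + 3) * (\<alpha>\<^sup>2 / 3) ^ (2 * (64 * t))"
      using large_phi_condition[OF ctx] unfolding pair_density_def[OF ctx] m[symmetric] .
    show "1.2 ^ Suc (64 * t - 1) + 2 \<le> 1.3 ^ (64 * t - 1) * (0.08 * \<alpha>)"
      using moment_condition[OF ctx] unfolding m[symmetric] .
    show "\<rho> * 2 ^ Suc (64 * t - 1) \<le> \<alpha> ^ Suc (64 * t - 1)"
      using row_condition[OF ctx] unfolding m[symmetric] .
    show "2 * real (64 * t) \<le> 0.81 * \<alpha>\<^sup>2 * \<sigma> ^ 3 * card W" by (rule card_condition[OF ctx N])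
    show "\<eta> * (2 / (\<alpha> * \<sigma>)) ^ (2 * (64 * t)) \<le> 0.1 * \<alpha> * \<sigma> ^ 3" by (rule kernel_condition[OF ctx])
    show "\<rho> + \<eta> / \<sigma> ^ 3 \<le> 0.001 * \<alpha>" by (rule degree_condition[OF ctx])
  qed (rule that)
  have c': "config W X Y' Z' A'" and UZ: "uniform W \<eta> Z'" and ds': "s \<le> dens W Y'" "s \<le> dens W Z'"
    using YZ
  proof -
    assume "(Y', Z', A') = (Y, Z, A) \<or> (Y', Z', A') = (Z, Y, shear A)"
    then have "(Y' = Y \<and> Z' = Z \<and> A' = A) \<or> (Y' = Z \<and> Z' = Y \<and> A' = shear A)" by simp
    then show "config W X Y' Z' A'" "uniform W \<eta> Z'" "s \<le> dens W Y'" "s \<le> dens W Z'"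
      using c config_shear[OF c] U ds by blast+
  qed
  define B where "B = A' \<inter> S \<times> T"
  have cB: "config W S T Z' B"
    unfolding config_def
  proof (intro conjI allI impI)
    fix x y e assume "(x, y) \<in> B" "(x + e, y) \<in> B" "(x, y + e) \<in> B"
    then show "e = 0" using c' unfolding config_def B_def by blast
  next
    fix x y assume "(x, y) \<in> B"
    then show "x \<in> S" "y \<in> T" "x + y \<in> Z'" using c' unfolding config_def B_def by blast+
  qed (use c' ST in \<open>auto simp: config_def\<close>)
  define x y z where "x = dens W S" and "y = dens W T" and "z = dens W Z'"
  have xyz: "\<rho> * s \<le> x" "\<rho> * s \<le> y" "s \<le> z"
  proof -
    have "\<rho> * s \<le> \<rho> * dens W X" "\<rho> * s \<le> \<rho> * dens W Y'"
      using ds ds' pos by (auto intro: mult_left_mono)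
    moreover have "\<rho> * dens W X \<le> x" "\<rho> * dens W Y' \<le> y"
      using ST(3,4) n by (auto simp: x_def y_def dens_def n_def divide_right_mono)
    ultimately show "\<rho> * s \<le> x" "\<rho> * s \<le> y" by linarith+
  qed (use ds' in \<open>simp add: z_def\<close>)
  have "0 < \<rho> * s" using pos s0 by simp
  then have xyz0: "0 < x" "0 < y" "0 < z" using xyz s0 by linarith+
  define p where "p = x * y * z"
  have p: "\<rho>\<^sup>2 * \<sigma> ^ 3 \<le> p"
  proof -
    have "(\<rho> * \<sigma>) * (\<rho> * \<sigma>) * \<sigma> \<le> (\<rho> * s) * (\<rho> * s) * s"
      using s \<sigma> pos by (intro mult_mono) auto
    also have "\<dots> \<le> p" unfolding p_def using xyz s0 pos xyz0 by (intro mult_mono) auto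
    finally show ?thesis by (simp add: power2_eq_square power3_eq_cube mult_ac)
  qed
  have p0: "0 < p" using xyz0 by (simp add: p_def)
  have low: "1.01 * \<alpha> * p \<le> card B / n\<^sup>2"
  proof -
    have "1.01 * \<alpha> * p = 1.01 * \<alpha> * z * card S * card T / n\<^sup>2"
      by (simp add: p_def x_def y_def dens_def n_def power2_eq_square)
    also have "\<dots> \<le> card B / n\<^sup>2" using inc n by (intro divide_right_mono) (auto simp: B_def z_def)
    finally show ?thesis .
  qed
  \<comment> \<open>Of the gain 1.01, the factor 1.005 is kept. Cells thin in one of the three sides
    cost 0.003, and the remaining 0.002 exceeds the total error \<open>7 * \<eta>\<close> by
    \<open>eta_final\<close>.\<close>
  define e where "e = 0.001 * \<alpha>"
  have "\<not> card B / n\<^sup>2 \<le> cell_bound \<eta> (e * x) (e * y) (e * z) (1.005 * \<alpha>) W S T Z'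
      + min 1 ((3 - energy W S T Z') / (\<eta>\<^sup>2 * (real R + 1)))"
  proof
    assume up: "card B / n\<^sup>2 \<le> cell_bound \<eta> (e * x) (e * y) (e * z) (1.005 * \<alpha>) W S T Z'
      + min 1 ((3 - energy W S T Z') / (\<eta>\<^sup>2 * (real R + 1)))"
    have "0 \<le> energy W S T Z'" unfolding energy_def by (intro add_nonneg_nonneg) auto
    then have "min 1 ((3 - energy W S T Z') / (\<eta>\<^sup>2 * (real R + 1))) \<le> 3 / (\<eta>\<^sup>2 * (real R + 1))"
      using pos by (intro min.coboundedI2 divide_right_mono) auto
    also have "\<dots> \<le> 3 * \<eta>"
    proof -
      have "1 \<le> \<eta> ^ 3 * (real R + 1)" using R pos by (simp add: pos_divide_le_eq mult.commute)
      then have "3 * 1 \<le> 3 * (\<eta> ^ 3 * (real R + 1))" by (intro mult_left_mono) auto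
      then show ?thesis using pos by (simp add: pos_divide_le_eq power2_eq_square power3_eq_cube mult_ac)
    qed
    finally have 1: "min 1 ((3 - energy W S T Z') / (\<eta>\<^sup>2 * (real R + 1))) \<le> 3 * \<eta>" .
    have "card (schur_triples S T Z') / n\<^sup>2 \<le> p + \<eta>"
      using schur_triples_uniform[OF cB UZ] unfolding p_def x_def y_def z_def n_def by linarith
    then have "1.005 * \<alpha> * (card (schur_triples S T Z') / n\<^sup>2) \<le> 1.005 * \<alpha> * (p + \<eta>)"
      using pos by (intro mult_left_mono) auto
    also have "\<dots> = 1.005 * \<alpha> * p + 1.005 * \<alpha> * \<eta>" by (rule distrib_left)
    also have "1.005 * \<alpha> * \<eta> \<le> 2 * \<eta>" using \<alpha>15 pos by (intro mult_right_mono) auto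
    finally have 2: "1.005 * \<alpha> * (card (schur_triples S T Z') / n\<^sup>2) \<le> 1.005 * \<alpha> * p + 2 * \<eta>" by simp
    have 3: "(e * x) * (y * z) + (e * y) * (x * z) + (e * z) * (x * y) = 3 * (e * p)"
      by (simp add: p_def)
    have cb: "cell_bound \<eta> (e * x) (e * y) (e * z) (1.005 * \<alpha>) W S T Z'
        = 1.005 * \<alpha> * (card (schur_triples S T Z') / n\<^sup>2) + 2 * \<eta>
          + (e * x) * (y * z) + (e * y) * (x * z) + (e * z) * (x * y)"
      by (simp add: cell_bound_def x_def y_def z_def n_def)
    have "1.01 * \<alpha> * p \<le> 1.005 * \<alpha> * p + 3 * (e * p) + 7 * \<eta>"
      using low up 1 2 3 unfolding cb by linarith
    then have "2 * (e * p) \<le> 7 * \<eta>" by (simp add: e_def)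
    moreover have "8 * \<eta> \<le> e * p"
    proof -
      have "8 * \<eta> \<le> e * (\<rho>\<^sup>2 * \<sigma> ^ 3)" using eta_final[OF ctx] by (simp add: e_def)
      also have "\<dots> \<le> e * p" using p pos by (intro mult_left_mono) (auto simp: e_def)
      finally show ?thesis .
    qed
    ultimately show False using pos by linarith
  qed
  moreover have "0 \<le> 1.005 * \<alpha>" "1.005 * \<alpha> \<le> 2" "0 \<le> e * x" "0 \<le> e * y" "0 \<le> e * z"
    using \<alpha>15 pos xyz0 by (simp_all add: e_def)
  ultimately obtain W' :: "'a set" and X1 Y1 Z1 A1
    where good: "good_cell \<eta> (e * x) (e * y) (e * z) (1.005 * \<alpha>) W' X1 Y1 Z1 A1"
      and cW: "card W \<le> 2 ^ R * card W'"
    using uniformise[OF pos(4) _ _ _ _ _ cB, of "1.005 * \<alpha>" "e * x" "e * y" "e * z" R]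
    unfolding n_def by blast
  define q where "q = (1 / 2 :: real) ^ (620 * t\<^sup>2) * s"
  have q: "q \<le> e * x" "q \<le> e * y" "q \<le> e * z"
  proof -
    have "q \<le> e * \<rho> * s" unfolding q_def e_def using kappa_le[OF ctx] s0 by (intro mult_right_mono) auto
    then have q1: "q \<le> e * (\<rho> * s)" by simp
    have e0: "0 \<le> e" using pos by (simp add: e_def)
    show "q \<le> e * x" "q \<le> e * y"
      using q1 mult_left_mono[OF xyz(1) e0] mult_left_mono[OF xyz(2) e0] by linarith+
    have "\<rho> * s \<le> 1 * s" using pos s0 by (intro mult_right_mono) auto
    then have "\<rho> * s \<le> z" using xyz(3) by simp
    then show "q \<le> e * z" using q1 mult_left_mono[of "\<rho> * s" z e] e0 by linarith
  qed
  have "stage \<eta> q (1.005 * a) W' X1 Y1 Z1 A1"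
    unfolding stage_def
  proof (intro conjI)
    define k where "k = real (card W')"
    have "subgrp W'" using good by (auto simp: good_cell_def config_def)
    then have k: "k > 0" using subgrpD(4) by (auto simp: k_def)
    have "1.005 * a * (real (card X1) * card Y1 * card Z1) \<le> 1.005 * \<alpha> * (real (card X1) * card Y1 * card Z1)"
      using a\<alpha> by (intro mult_right_mono) auto
    also have "\<dots> = (1.005 * \<alpha> * (dens W' X1 * dens W' Y1 * dens W' Z1) * k\<^sup>2) * k"
      using k by (simp add: dens_def k_def power2_eq_square)
    also have "\<dots> \<le> card A1 * k"
      using good k by (intro mult_right_mono) (auto simp: good_cell_def k_def)
    finally show "1.005 * a * (real (card X1) * card Y1 * card Z1) \<le> real (card A1) * card W'"
      by (simp add: k_def)
  qed (use good q in \<open>auto simp: good_cell_def\<close>)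
  then show ?thesis using that cW by (simp add: q_def)
qed

lemma uniform_self:
  assumes "subgrp W" "0 \<le> \<eta>"
  shows "uniform W \<eta> W"
proof -
  have d: "dens W W = 1" using subgrpD(4)[OF assms(1)] by (simp add: dens_def)
  have "(\<Sum>y\<in>W. \<Sum>z\<in>W. (of_bool (y + z \<in> W) - dens W W) * a y * b z) = 0" for a b :: "'a \<Rightarrow> real"
    using subgrpD(3)[OF assms(1)] by (intro sum.neutral ballI) (simp add: d)
  then show ?thesis unfolding uniform_def using assms(2) by simp
qed

text \<open>After \<open>600 * t\<close> steps the relative density would be at least
  \<open>8 ^ t * (1 / 2) ^ t\<close>, since 1.005^200 >= 2; this is at least 4, contradicting the
  cap 1.5. \<open>\<sigma>\<close> is the density bound after all these steps, fixed in advance so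
  that one \<open>\<eta>\<close> serves throughout.\<close>

lemma corner_free_dens_less:
  fixes W :: "'a::elementary_2_group set"
  assumes t: "1 \<le> t" and c: "config W W W W A" and W: "card W = 2 ^ n"
    and n: "2 ^ (800000000 * t ^ 4) \<le> n"
  shows "card A < (1 / 2) ^ t * (real (card W))\<^sup>2"
proof (rule ccontr)
  assume "\<not> ?thesis"
  then have big: "(1 / 2) ^ t * (real (card W))\<^sup>2 \<le> card A" by simp
  define \<kappa> where "\<kappa> = (1 / 2 :: real) ^ (620 * t\<^sup>2)"
  define \<sigma> where "\<sigma> = \<kappa> ^ (600 * t)"
  define \<rho> where "\<rho> = (1 / 2 :: real) ^ (600 * t\<^sup>2)"
  define \<eta> where "\<eta> = (\<rho> * \<sigma>) ^ (400 * t)"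
  define E where "E = (600 * t\<^sup>2 + 620 * t\<^sup>2 * (600 * t)) * (400 * t)"
  \<comment> \<open>Since \<open>\<eta>\<close> is 2^-\<open>E\<close>, this is
    \<open>\<eta>\<close> to the power -3, the number of cuts that makes the energy term at most
    \<open>3 * \<eta>\<close>.\<close>
  define R where "R = (2::nat) ^ (3 * E)"
  have sW: "subgrp W" using c by (simp add: config_def)
  have \<eta>E: "\<eta> = (1 / 2) ^ E"
    unfolding \<eta>_def \<rho>_def \<sigma>_def \<kappa>_def E_def by (simp only: power_mult[symmetric] power_add[symmetric])
  have \<kappa>: "0 < \<kappa>" "\<kappa> \<le> 1" by (auto simp: \<kappa>_def power_le_one)
  have \<sigma>: "0 < \<sigma>" "\<sigma> \<le> 1" using \<kappa> by (auto simp: \<sigma>_def power_le_one)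
  have \<eta>: "0 < \<eta>" by (simp add: \<eta>E)
  have R: "1 / \<eta> ^ 3 \<le> real R + 1"
    by (simp add: \<eta>E R_def power_divide power_mult[symmetric] mult.commute)
  \<comment> \<open>All cuts must leave a subgroup with at least 1 / \<open>\<eta>\<close> elements.
    \<open>E\<close> has degree 4 in \<open>t\<close>, with coefficients 148800000 and 240000; five
    times their sum is below 800000000.\<close>
  have exponent: "R * (600 * t) + E \<le> n"
  proof -
    have t4: "t\<^sup>2 * t \<le> t ^ 4" "t ^ 4 \<ge> 1"
      using t by (auto simp: power2_eq_square power4_eq_xxxx)
    have "E = 240000 * (t\<^sup>2 * t) + 148800000 * t ^ 4"
      by (simp add: E_def algebra_simps power2_eq_square power4_eq_xxxx)
    then have E5: "5 * E \<le> 800000000 * t ^ 4" using t4 by linarith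
    have "600 * t \<le> E"
    proof -
      have "600 * t * 1 \<le> 600 * t * (400 * t\<^sup>2)" using t by (intro mult_le_mono2) (simp add: power2_eq_square)
      also have "\<dots> \<le> E" by (simp add: E_def algebra_simps power2_eq_square)
      finally show ?thesis by simp
    qed
    then have "600 * t \<le> 2 ^ E" "E \<le> 2 ^ E" using less_exp[of E] by (auto intro: order_trans)
    then have "R * (600 * t) + E \<le> 2 ^ (3 * E) * 2 ^ E + 2 ^ E * 1"
      unfolding R_def by (intro add_mono mult_le_mono) auto
    also have "\<dots> \<le> 2 ^ (3 * E) * 2 ^ E + 2 ^ (3 * E) * 2 ^ E"
      by (intro add_mono) auto
    also have "\<dots> = 2 ^ (4 * E + 1)" by (simp add: power_add[symmetric])
    also have "\<dots> \<le> 2 ^ (800000000 * t ^ 4)"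
      using E5 t \<open>600 * t \<le> E\<close> by (intro power_increasing) auto
    finally show ?thesis using n by linarith
  qed
  have "i \<le> 600 * t \<Longrightarrow> \<exists>(W' :: 'a set) X Y Z A. stage \<eta> (\<kappa> ^ i) (1.005 ^ i * (1 / 2) ^ t) W' X Y Z A
      \<and> card W \<le> 2 ^ (R * i) * card W'" for i
  proof (induction i)
    case 0
    have "(1 / 2) ^ t * (real (card W) * card W * card W) \<le> real (card A) * card W"
      using mult_right_mono[OF big, of "card W"] by (simp add: power2_eq_square mult_ac)
    then have "stage \<eta> (\<kappa> ^ 0) (1.005 ^ 0 * (1 / 2) ^ t) W W W W A"
      using c uniform_self[OF sW] \<eta> subgrpD(4)[OF sW] by (simp add: stage_def dens_def)
    then show ?case by (metis mult_0_right mult_1 order_refl power_0)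
  next
    case (Suc i)
    then obtain W' :: "'a set" and X Y Z A' where st: "stage \<eta> (\<kappa> ^ i) (1.005 ^ i * (1 / 2) ^ t) W' X Y Z A'"
      and cW: "card W \<le> 2 ^ (R * i) * card W'" by auto
    have "2 ^ E \<le> card W'"
    proof -
      have "R * i + E \<le> R * (600 * t) + E" using Suc.prems by simp
      then have "R * i + E \<le> n" using exponent by linarith
      then have "(2::nat) ^ (R * i + E) \<le> 2 ^ n" by (rule power_increasing) simp
      then have "2 ^ (R * i) * 2 ^ E \<le> 2 ^ (R * i) * card W'" using cW W unfolding power_add by linarith
      then show ?thesis by simp
    qed
    then have "real (2 ^ E) \<le> card W'" by (rule of_nat_mono)
    then have N: "1 / \<eta> \<le> card W'" by (simp add: \<eta>E power_divide)
    have "\<sigma> \<le> \<kappa> ^ i" unfolding \<sigma>_def using Suc.prems \<kappa> by (intro power_decreasing) auto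
    moreover have "1 * (1 / 2) ^ t \<le> 1.005 ^ i * (1 / 2 :: real) ^ t"
      by (intro mult_right_mono one_le_power) auto
    then have "(1 / 2) ^ t \<le> 1.005 ^ i * (1 / 2 :: real) ^ t" by simp
    ultimately obtain W2 :: "'a set" and X2 Y2 Z2 A2 where
      "stage \<eta> (\<kappa> * \<kappa> ^ i) (1.005 * (1.005 ^ i * (1 / 2) ^ t)) W2 X2 Y2 Z2 A2" "card W' \<le> 2 ^ R * card W2"
      using density_step[OF t \<rho>_def \<sigma> \<eta>_def st _ _ N R] unfolding \<kappa>_def by blast
    moreover from this(2) have "card W \<le> 2 ^ (R * Suc i) * card W2"
    proof -
      assume "card W' \<le> 2 ^ R * card W2"
      then have "card W \<le> 2 ^ (R * i) * (2 ^ R * card W2)"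
        using cW mult_le_mono2 order_trans by blast
      then show ?thesis by (simp add: power_add mult_ac)
    qed
    ultimately show ?case by (metis mult.assoc power_Suc)
  qed
  from this[of "600 * t"] obtain W' :: "'a set" and X Y Z A'
    where st: "stage \<eta> \<sigma> (1.005 ^ (600 * t) * (1 / 2) ^ t) W' X Y Z A'"
    unfolding \<sigma>_def by auto
  have "(2::real) \<le> 1.005 ^ 200" using Bernoulli_inequality[of "0.005::real" 200] by simp
  then have "(2::real) ^ (3 * t) \<le> (1.005 ^ 200) ^ (3 * t)" by (intro power_mono) auto
  then have "(8::real) ^ t \<le> 1.005 ^ (600 * t)" by (simp add: power_mult[symmetric]) (simp add: power_mult)
  then have "8 ^ t * (1 / 2) ^ t \<le> 1.005 ^ (600 * t) * (1 / 2 :: real) ^ t" by (intro mult_right_mono) auto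
  moreover have "(4::real) ^ 1 \<le> 4 ^ t" using t by (intro power_increasing) auto
  moreover have "8 ^ t * (1 / 2) ^ t = (4::real) ^ t" by (simp add: power_mult_distrib[symmetric])
  ultimately have four: "4 \<le> 1.005 ^ (600 * t) * (1 / 2 :: real) ^ t" by simp
  have pos: "0 < real (card X) * card Y * card Z"
  proof -
    have "0 < card U" if "\<sigma> \<le> dens W' U" for U
      using that \<sigma> by (cases "card U = 0") (auto simp: dens_def)
    then show ?thesis using st by (simp add: stage_def)
  qed
  define \<alpha> where "\<alpha> = real (card A') * card W' / (real (card X) * card Y * card Z)"
  have "real (card X) * card Y * card Z \<noteq> 0" using pos by linarith
  then have "\<alpha> * (real (card X) * card Y * card Z) = real (card A') * card W'"
    unfolding \<alpha>_def times_divide_eq_left by (rule nonzero_mult_div_cancel_right)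
  then have "real (card A') * card W' = \<alpha> * card X * card Y * card Z" by (simp only: mult.assoc)
  moreover have "2 * \<eta> \<le> \<sigma> ^ 3"
  proof -
    have "(\<rho> * \<sigma>) ^ (400 * t) \<le> (\<rho> * \<sigma>) ^ 3"
      using t \<sigma> by (intro power_decreasing) (auto simp: \<rho>_def power_le_one mult_le_one)
    also have "\<dots> = \<rho> ^ 3 * \<sigma> ^ 3" by (rule power_mult_distrib)
    also have "\<rho> ^ 3 \<le> (1 / 2) ^ 1"
      unfolding \<rho>_def power_mult[symmetric] using t by (intro power_decreasing) (auto simp: power2_eq_square)
    finally show ?thesis using \<sigma> by (simp add: \<eta>_def mult_right_mono)
  qed
  ultimately have "\<alpha> \<le> 1.5" using stage_density_le[OF st \<sigma>(1)] by blast
  moreover have "1.005 ^ (600 * t) * (1 / 2) ^ t \<le> \<alpha>"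
    using st pos unfolding stage_def \<alpha>_def by (simp add: pos_le_divide_eq)
  ultimately show False using four by linarith
qed

section \<open>Transfer to the group of binary vectors\<close>

instance bit :: elementary_2_group
proof
  fix x :: bit
  have "x + x = 2 * x" by (rule mult_2[symmetric])
  also have "\<dots> = 0" by (simp only: bit_2_eq_0 mult_zero_left)
  finally show "x + x = 0" .
qed

instance "fun" :: (type, elementary_2_group) elementary_2_group
  by standard (rule ext, simp only: plus_fun_apply add_self zero_fun_apply)

text \<open>Embeds every binary vector space into the single type
  \<open>nat \<Rightarrow> bit\<close>, as a finite subgroup. Positions from \<open>n\<close> on
  become 0, whereas extensional vectors are \<open>undefined\<close> there.\<close>

definition bits :: "nat \<Rightarrow> (nat \<Rightarrow> int) \<Rightarrow> nat \<Rightarrow> bit" where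
  "bits n v i = of_bool (i < n \<and> odd (v i))"

lemma carrier_F2_vec: "carrier (F2_vec n) = (\<Pi>\<^sub>E i\<in>{..<n}. {0..1})"
  by (simp add: F2_vec_def residue_ring_def)

lemma mult_F2_vec: "u \<otimes>\<^bsub>F2_vec n\<^esub> v = (\<lambda>i\<in>{..<n}. (u i + v i) mod 2)"
  by (simp add: F2_vec_def residue_ring_def)

lemma bits_mult: "bits n (u \<otimes>\<^bsub>F2_vec n\<^esub> v) = bits n u + bits n v"
proof
  fix i
  have "of_bool (p \<noteq> q) = (of_bool p + of_bool q :: bit)" for p q
    by (cases p; cases q) (simp_all only: of_bool_eq add_self add_0_left add_0_right not_True_eq_False not_False_eq_True simp_thms)
  moreover have "(i < n \<and> odd ((u \<otimes>\<^bsub>F2_vec n\<^esub> v) i)) \<longleftrightarrow> (i < n \<and> odd (u i)) \<noteq> (i < n \<and> odd (v i))"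
    by (cases "i < n") (auto simp: mult_F2_vec)
  ultimately show "bits n (u \<otimes>\<^bsub>F2_vec n\<^esub> v) i = (bits n u + bits n v) i"
    by (simp only: bits_def plus_fun_apply)
qed

lemma inj_bits: "inj_on (bits n) (carrier (F2_vec n))"
proof (rule inj_onI)
  fix u v assume u: "u \<in> carrier (F2_vec n)" and v: "v \<in> carrier (F2_vec n)" and eq: "bits n u = bits n v"
  show "u = v"
  proof (rule PiE_ext[OF u[unfolded carrier_F2_vec] v[unfolded carrier_F2_vec]])
    fix i assume i: "i \<in> {..<n}"
    have "u i \<in> {0..1}" "v i \<in> {0..1}"
      using PiE_mem[OF u[unfolded carrier_F2_vec] i] PiE_mem[OF v[unfolded carrier_F2_vec] i] .
    then have "0 \<le> u i \<and> u i \<le> 1" "0 \<le> v i \<and> v i \<le> 1" by simp_all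
    moreover have "odd (u i) \<longleftrightarrow> odd (v i)"
    proof -
      have "(of_bool (odd (u i)) :: bit) = of_bool (odd (v i))"
        using fun_cong[OF eq, of i] i by (simp only: bits_def lessThan_iff simp_thms)
      then show ?thesis by (simp only: of_bool_eq_iff)
    qed
    ultimately show "u i = v i" by presburger
  qed
qed

lemma corner_free_F2_vec_card_less:
  assumes t: "1 \<le> t" and A: "A \<subseteq> carrier (F2_vec n) \<times> carrier (F2_vec n)" "corner_free (F2_vec n) A"
    and n: "2 ^ (800000000 * t ^ 4) \<le> n"
  shows "card A < (1 / 2) ^ t * ((2::real) ^ n)\<^sup>2"
proof -
  let ?G = "F2_vec n"
  interpret G: comm_group ?G by (rule comm_group_F2_vec)
  define W where "W = bits n ` carrier ?G"
  define B where "B = map_prod (bits n) (bits n) ` A"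
  have cardW: "card W = 2 ^ n"
    unfolding W_def using card_image[OF inj_bits] order_F2_vec[of n] by (simp add: order_def)
  have inj: "\<And>u v. u \<in> carrier ?G \<Longrightarrow> v \<in> carrier ?G \<Longrightarrow> bits n u = bits n v \<Longrightarrow> u = v"
    using inj_bits by (auto dest: inj_onD)
  have one: "bits n \<one>\<^bsub>?G\<^esub> = 0"
    using bits_mult[of n "\<one>\<^bsub>?G\<^esub>" "\<one>\<^bsub>?G\<^esub>"] by simp
  have "inj_on (map_prod (bits n) (bits n)) A"
    using map_prod_inj_on[OF inj_bits inj_bits] A(1) by (rule inj_on_subset)
  then have cardB: "card B = card A" unfolding B_def by (rule card_image)
  have "config W W W W B"
    unfolding config_def
  proof (intro conjI allI impI)
    show "subgrp W"
      unfolding subgrp_def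
    proof (intro conjI ballI)
      show "finite W" unfolding W_def using finite_carrier_F2_vec by simp
      show "0 \<in> W" unfolding W_def using one by (metis G.one_closed imageI)
      show "x + y \<in> W" if "x \<in> W" "y \<in> W" for x y
        using that unfolding W_def by (auto simp: bits_mult[symmetric])
    qed
    then show "x + y \<in> W" if "(x, y) \<in> B" for x y
      using that A(1) unfolding B_def W_def by (auto simp: bits_mult[symmetric])
    show "x \<in> W" "y \<in> W" if "(x, y) \<in> B" for x y
      using that A(1) unfolding B_def W_def by auto
    fix x y e assume xy: "(x, y) \<in> B" "(x + e, y) \<in> B" "(x, y + e) \<in> B"
    obtain u v where uv: "(u, v) \<in> A" "x = bits n u" "y = bits n v" using xy(1) by (auto simp: B_def)
    obtain u' v' where u': "(u', v') \<in> A" "x + e = bits n u'" "y = bits n v'" using xy(2) by (auto simp: B_def)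
    obtain u'' v'' where v'': "(u'', v'') \<in> A" "x = bits n u''" "y + e = bits n v''" using xy(3) by (auto simp: B_def)
    have car: "u \<in> carrier ?G" "v \<in> carrier ?G" "u' \<in> carrier ?G" "v' \<in> carrier ?G"
      "u'' \<in> carrier ?G" "v'' \<in> carrier ?G" using uv u' v'' A(1) by auto
    have same: "v' = v" "u'' = u" using inj car uv u' v'' by metis+
    \<comment> \<open>The product is the difference of \<open>u\<close> and \<open>u'\<close>,
      because every element is its own inverse.\<close>
    define w where "w = u \<otimes>\<^bsub>?G\<^esub> u'"
    have w: "w \<in> carrier ?G" using car by (simp add: w_def)
    have bw: "bits n w = e" by (simp add: w_def bits_mult uv(2)[symmetric] u'(2)[symmetric])
    have "u \<otimes>\<^bsub>?G\<^esub> w = u'"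
      using car w u'(2) uv(2) by (intro inj) (auto simp: bits_mult bw)
    moreover have "v \<otimes>\<^bsub>?G\<^esub> w = v''"
      using car w v''(3) uv(3) by (intro inj) (auto simp: bits_mult bw)
    ultimately have sub: "{(u, v), (u \<otimes>\<^bsub>?G\<^esub> w, v), (u, v \<otimes>\<^bsub>?G\<^esub> w)} \<subseteq> A"
      using uv u' v'' same by simp
    have "w = \<one>\<^bsub>?G\<^esub>"
      using A(2) sub car w unfolding corner_free_def is_corner_def by blast
    then show "e = 0" using bw one by simp
  qed auto
  from corner_free_dens_less[OF t this cardW n] show ?thesis
    by (simp add: cardB cardW)
qed

lemma r_corner_attained:
  obtains A where "A \<subseteq> carrier (F2_vec n) \<times> carrier (F2_vec n)" "corner_free (F2_vec n) A"
    "card A = r_corner (F2_vec n)"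
proof -
  let ?C = "carrier (F2_vec n) \<times> carrier (F2_vec n)"
  let ?S = "{card A | A. A \<subseteq> ?C \<and> corner_free (F2_vec n) A}"
  have "finite (card ` Pow ?C)" using finite_carrier_F2_vec by simp
  then have "finite ?S" by (rule finite_subset[rotated]) auto
  moreover have "corner_free (F2_vec n) {}" by (auto simp: corner_free_def is_corner_def)
  then have "?S \<noteq> {}" by blast
  ultimately have "Max ?S \<in> ?S" by (rule Max_in)
  then show ?thesis using that unfolding r_corner_def by auto
qed

theorem theorem1p1:
  shows "\<exists>K::real. \<exists>n\<^sub>0::nat. K > 0 \<and>
    (\<forall>n\<ge>n\<^sub>0. let N = (2::real) ^ n in
       real (r_corner (F2_vec n)) \<le> K * N\<^sup>2 * (ln (ln (ln N)) / ln (ln N)))"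
proof -
  \<comment> \<open>The size condition of the density bound for the \<open>t\<close> chosen below,
    which is at most \<open>log 2 (ln n) + 1\<close>.\<close>
  have "\<forall>\<^sub>F n in sequentially. 800000000 * (log 2 (ln (real n)) + 1) ^ 4 \<le> log 2 (real n)"
    by real_asymp
  moreover have "\<forall>\<^sub>F n in sequentially. 2 \<le> ln (real n)" by real_asymp
  moreover have "\<forall>\<^sub>F n in sequentially. 1 \<le> ln (ln (real n * ln 2))" by real_asymp
  moreover have "\<forall>\<^sub>F n in sequentially. 1 \<le> ln (real n * ln 2)" by real_asymp
  ultimately have "\<forall>\<^sub>F n in sequentially. real (r_corner (F2_vec n))
      \<le> 1 * ((2::real) ^ n)\<^sup>2 * (ln (ln (ln (2 ^ n))) / ln (ln (2 ^ n)))"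
  proof eventually_elim
    case (elim n)
    have n0: "n > 0" using elim(2) by (cases n) auto
    \<comment> \<open>Then \<open>(1 / 2) ^ t\<close> is at most 1 / \<open>ln n\<close>, hence at
      most 1 / \<open>L\<close> for \<open>L = ln (ln N)\<close>; the factor
      \<open>ln L \<ge> 1\<close> of the target is to spare, and the constant can be 1.\<close>
    define t where "t = nat \<lceil>log 2 (ln n)\<rceil>"
    have l: "1 \<le> log 2 (ln n)" using elim(2) by (simp add: le_log_iff)
    have tl: "log 2 (ln n) \<le> t" "t \<le> log 2 (ln n) + 1" using l by (auto simp: t_def)
    have t1: "1 \<le> t" using l tl(1) by linarith
    have "real t ^ 4 \<le> (log 2 (ln n) + 1) ^ 4" using tl by (intro power_mono) auto
    then have "real (800000000 * t ^ 4) \<le> log 2 n" using elim(1) by simp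
    then have "2 powr real (800000000 * t ^ 4) \<le> n" using n0 by (simp add: le_log_iff)
    then have "real (2 ^ (800000000 * t ^ 4)) \<le> real n" by (subst (asm) powr_realpow) auto
    then have n: "2 ^ (800000000 * t ^ 4) \<le> n" by (simp only: of_nat_le_iff)
    obtain A where A: "A \<subseteq> carrier (F2_vec n) \<times> carrier (F2_vec n)" "corner_free (F2_vec n) A"
      "card A = r_corner (F2_vec n)" by (rule r_corner_attained)
    have lt: "ln n \<le> 2 ^ t"
    proof -
      have "ln n = 2 powr (log 2 (ln n))" using elim(2) by simp
      also have "\<dots> \<le> 2 powr t" using tl(1) by (intro powr_mono) auto
      finally show ?thesis by (simp add: powr_realpow)
    qed
    have lnN: "ln (2 ^ n) = real n * ln 2" by (simp add: ln_realpow)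
    define L where "L = ln (real n * ln 2)"
    have L: "0 < L" using elim(4) by (simp add: L_def)
    have "real n * ln 2 \<le> real n * 1" using ln_2_less_1 by (intro mult_left_mono) auto
    then have "L \<le> ln n" unfolding L_def using n0 by (subst ln_le_cancel_iff) auto
    then have "1 / 2 ^ t \<le> 1 / L" using lt L by (intro divide_left_mono) auto
    also have "\<dots> \<le> ln L / L" using elim(3) L by (intro divide_right_mono) (auto simp: L_def)
    finally have bound: "(1 / 2) ^ t \<le> ln L / L" by (simp add: power_divide)
    have "real (r_corner (F2_vec n)) \<le> (1 / 2) ^ t * ((2::real) ^ n)\<^sup>2"
      using corner_free_F2_vec_card_less[OF t1 A(1,2) n] A(3) by simp
    also have "\<dots> \<le> ln L / L * ((2::real) ^ n)\<^sup>2" using bound by (intro mult_right_mono) auto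
    finally show ?case unfolding lnN L_def[symmetric] by (simp add: mult.commute)
  qed
  then obtain n0 where "\<forall>n\<ge>n0. real (r_corner (F2_vec n))
      \<le> 1 * ((2::real) ^ n)\<^sup>2 * (ln (ln (ln (2 ^ n))) / ln (ln (2 ^ n)))"
    unfolding eventually_sequentially by blast
  then show ?thesis unfolding Let_def by (intro exI[of _ 1] exI[of _ n0]) auto
qed

end
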